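(* Let $I=(X_i\geq\varphi_i)_{1\leq i\leq n}$ be a system of inequalities over $\Omega=(\Omega_v,\Omega_p)$ with $\Omega_v=\{X_1,\dots,X_n\}$, and let $\mathbf P\in(2^V)^{\Omega_p}$ be an assignment in which each $\mathbf P(P)$, $P\in\Omega_p$, is a finite union of hemihedra. Let $\mathbf X=(\mathbf X_1,\dots,\mathbf X_n)$ be the unique smallest solution of $I$ under $\mathbf P$. Then each $\mathbf X_i$, $1\leq i\leq n$, is a hemihedron. Moreover, there exists an algorithm which takes as input the system $I$ and descriptions of the finite unions of hemihedra $\mathbf P(P)$, $P\in\Omega_p$, and produces as output semi-linear descriptions of the hemihedra $\mathbf X_i$, $1\leq i\leq n$ (i.e. each $\mathbf X_i$ is described by a quantifier-free first-order formula whose atoms are affine equalities or inequalities).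
   Context: $V$ is a finite-dimensional real vector space, $2^V$ its set of subsets, $\mathcal C(V)$ its set of convex subsets (including $\emptyset$). A hemihedron is a convex set $H\subset V$ for which there exist finitely many polytopes $Q_1,\dots,Q_m\subset V$ with $H=\bigcup_{i=1}^m\operatorname{relint}(Q_i)$ (with $\operatorname{relint}(Q)=Q$ if $Q$ is a point; the empty union is allowed). Equivalently, a hemihedron is a bounded convex semi-linear subset of $V$. For $A,B\subset V$ and $\rho\in\mathbb R$: $\rho\cdot A=\{\rho x: x\in A\}$; $A+B=\{a+b: a\in A,b\in B\}$; $A\,\widehat\oplus\,B=A\cup B$; and the positive geometric join is $A\,\mathring\star\,B=\{\lambda a+(1-\lambda)b: 0<\lambda<1,\ a\in A,\ b\in B\}$ (associative and commutative). Syntax. $\Omega_v$ (variables) and $\Omega_p$ (parameters) are disjoint finite sets of symbols, $\Omega=(\Omega_v,\Omega_p)$. $\mathrm{CL}(\Omega)$ is the set of formal convex linear combinations $E=\sum_{\omega\in\Omega_v\cup\Omega_p}\lambda_\omega\cdot\omega$ with $\lambda_\omega\geq0$, $\sum\lambda_\omega=1$. A monomial over $\Omega$ is a formal product $E_1\mathring\star\cdots\mathring\star E_k$, $k\geq1$, of distinct elements of $\mathrm{CL}(\Omega)$, up to permutation of factors (formally $E\mathring\star E=E$). A polynomial over $\Omega$ is a formal sum $M_1\widehat\oplus\cdots\widehat\oplus M_k$, $k\geq0$, of distinct monomials, up to permutation (formally $M\widehat\oplus M=M$); $\mathbb P[\Omega]$ is the set of polynomials. A system of inequalities over $\Omega$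 is a tuple $(X_i\geq\varphi_i)_{1\leq i\leq n}$ with $\Omega_v=\{X_1,\dots,X_n\}$ and $\varphi_i\in\mathbb P[\Omega]$. Evaluation. For $\mathbf X\in\mathcal C(V)^{\Omega_v}$ and $\mathbf P\in(2^V)^{\Omega_p}$: $\operatorname{eval}(E;\mathbf X,\mathbf P)=\sum_{X\in\Omega_v,\lambda_X>0}\lambda_X\cdot\mathbf X(X)+\sum_{P\in\Omega_p,\lambda_P>0}\lambda_P\cdot\mathbf P(P)$ (Minkowski sums); for a monomial, $\operatorname{eval}$ is the positive geometric join of the evaluations of its distinct factors; for a polynomial, the union of the evaluations of its monomials (the empty polynomial evaluates to $\emptyset$). Solutions. Write $\mathbf X_i=\mathbf X(X_i)$. $\mathbf X\in\mathcal C(V)^{\Omega_v}$ is a solution of $I$ under $\mathbf P$ if $\mathbf X_i\supseteq\operatorname{eval}(\varphi_i;\mathbf X,\mathbf P)$ for all $i$. The smallest solution is the minimum solution under componentwise inclusion, i.e. the componentwise intersection of all solutions (it is always itself a solution). "Algorithm" means an algorithm performing arithmetic operations and comparisons on real numbers, with input sets described by quantifier-free formulas. *)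

theory Defs
  imports "HOL-Analysis.Analysis" "HOL-Library.Multiset"
begin

section \<open>Hemihedra\<close>

text \<open>For a single point the library's relative interior is the point itself, and the empty
  family of polytopes shows that the empty set is a hemihedron.\<close>

definition hemihedron :: "'a::euclidean_space set \<Rightarrow> bool" where
  "hemihedron H \<longleftrightarrow> convex H \<and>
     (\<exists>\<Q>. finite \<Q> \<and> (\<forall>Q\<in>\<Q>. polytope Q) \<and> H = (\<Union>Q\<in>\<Q>. rel_interior Q))"

definition finite_union_of_hemihedra :: "'a::euclidean_space set \<Rightarrow> bool" where
  "finite_union_of_hemihedra A \<longleftrightarrow>
     (\<exists>\<H>. finite \<H> \<and> (\<forall>H\<in>\<H>. hemihedron H) \<and> A = \<Union>\<H>)"

section \<open>Positive geometric join\<close>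

definition pos_join :: "'a::real_vector set \<Rightarrow> 'a set \<Rightarrow> 'a set" where
  "pos_join A B = {l *\<^sub>R a + (1 - l) *\<^sub>R b | l a b. 0 < l \<and> l < 1 \<and> a \<in> A \<and> b \<in> B}"

fun join_list :: "'a::real_vector set list \<Rightarrow> 'a set" where
  "join_list [] = {}" \<comment> \<open>never used: monomials have at least one factor\<close>
| "join_list [A] = A"
| "join_list (A # B # As) = pos_join A (join_list (B # As))"

lemma pos_join_commute: "pos_join A B = pos_join B A"
proof -
  have "pos_join A B \<subseteq> pos_join B A" for A B :: "'a set"
  proof
    fix x assume "x \<in> pos_join A B"
    then obtain l a b where *: "0 < l" "l < 1" "a \<in> A" "b \<in> B"
      and x: "x = l *\<^sub>R a + (1 - l) *\<^sub>R b"
      by (auto simp: pos_join_def)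
    have "x = (1 - l) *\<^sub>R b + (1 - (1 - l)) *\<^sub>R a"
      using x by (simp add: add.commute)
    with * show "x \<in> pos_join B A"
      unfolding pos_join_def mem_Collect_eq
      by (intro exI[of _ "1 - l"] exI[of _ b] exI[of _ a]) simp
  qed
  then show ?thesis by blast
qed

lemma pos_join_assoc: "pos_join (pos_join A B) C = pos_join A (pos_join B C)"
proof -
  have sub: "pos_join (pos_join A B) C \<subseteq> pos_join A (pos_join B C)" for A B C :: "'a set"
  proof
    fix x assume "x \<in> pos_join (pos_join A B) C"
    then obtain l m a b c where l: "0 < l" "l < 1" and m: "0 < m" "m < 1"
      and abc: "a \<in> A" "b \<in> B" "c \<in> C"
      and x: "x = l *\<^sub>R (m *\<^sub>R a + (1 - m) *\<^sub>R b) + (1 - l) *\<^sub>R c"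
      by (auto simp: pos_join_def)
    have lm: "0 < l * m" "l * m < l"
      using l m by auto
    define k where "k = l * (1 - m) / (1 - l * m)"
    have pos: "0 < 1 - l * m" using lm l by linarith
    have k: "0 < k" "k < 1"
      using l m pos by (auto simp: k_def field_simps)
    have k1: "(1 - l * m) * k = l * (1 - m)"
      using pos by (simp add: k_def)
    have k2: "(1 - l * m) * (1 - k) = 1 - l"
      using k1 by (simp add: algebra_simps)
    have "(1 - l * m) *\<^sub>R (k *\<^sub>R b + (1 - k) *\<^sub>R c) = (l * (1 - m)) *\<^sub>R b + (1 - l) *\<^sub>R c"
      by (simp only: scaleR_add_right scaleR_scaleR k1 k2)
    then have "x = (l * m) *\<^sub>R a + (1 - l * m) *\<^sub>R (k *\<^sub>R b + (1 - k) *\<^sub>R c)"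
      using x by (simp add: scaleR_add_right)
    moreover have "k *\<^sub>R b + (1 - k) *\<^sub>R c \<in> pos_join B C"
      using k abc by (auto simp: pos_join_def)
    moreover have "l * m < 1" using lm l by linarith
    ultimately show "x \<in> pos_join A (pos_join B C)"
      using lm(1) abc(1) unfolding pos_join_def[of A] by blast
  qed
  have "pos_join A (pos_join B C) = pos_join (pos_join C B) A"
    by (metis pos_join_commute)
  also have "\<dots> \<subseteq> pos_join C (pos_join B A)" by (rule sub)
  also have "\<dots> = pos_join (pos_join A B) C"
    by (metis pos_join_commute)
  finally show ?thesis using sub by blast
qed

lemma pos_join_mono: "A \<subseteq> A' \<Longrightarrow> B \<subseteq> B' \<Longrightarrow> pos_join A B \<subseteq> pos_join A' B'"
  unfolding pos_join_def by blast

lemma join_list_Cons: "As \<noteq> [] \<Longrightarrow> join_list (A # As) = pos_join A (join_list As)"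
  by (cases As) auto

lemma join_list_remove1:
  assumes "A \<in> set As" "remove1 A As \<noteq> []"
  shows "join_list As = pos_join A (join_list (remove1 A As))"
  using assms
proof (induction As)
  case (Cons B As)
  show ?case
  proof (cases "A = B")
    case True
    with Cons.prems show ?thesis by (simp add: join_list_Cons)
  next
    case False
    with Cons.prems have A: "A \<in> set As" by auto
    then have ne: "As \<noteq> []" by auto
    show ?thesis
    proof (cases "remove1 A As = []")
      case True
      with A have "As = [A]" by (cases As) (auto split: if_splits)
      with False show ?thesis by (simp add: pos_join_commute)
    next
      case ne': False
      have "join_list (B # As) = pos_join B (pos_join A (join_list (remove1 A As)))"
        using Cons.IH A ne ne' by (simp add: join_list_Cons)
      also have "\<dots> = pos_join A (pos_join B (join_list (remove1 A As)))"
        by (metis pos_join_assoc pos_join_commute)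
      finally show ?thesis using False ne' by (simp add: join_list_Cons)
    qed
  qed
qed simp

lemma join_list_mset:
  assumes "mset As = mset Bs"
  shows "join_list As = join_list Bs"
  using assms
proof (induction As arbitrary: Bs)
  case (Cons A As)
  have A: "A \<in> set Bs"
    using Cons.prems by (metis list.set_intros(1) mset_eq_setD)
  have ms: "mset As = mset (remove1 A Bs)"
    using Cons.prems by (metis mset_remove1 add_mset_remove_trivial mset.simps(2))
  show ?case
  proof (cases "As = []")
    case True
    then have "mset (remove1 A Bs) = {#}" using ms by (metis mset.simps(1))
    then have "remove1 A Bs = []" by (metis mset_zero_iff)
    with A have "Bs = [A]" by (cases Bs) (auto split: if_splits)
    with True show ?thesis by simp
  next
    case False
    then have "remove1 A Bs \<noteq> []" using ms by (metis mset_zero_iff mset.simps(1))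
    with A have "join_list Bs = pos_join A (join_list (remove1 A Bs))"
      by (rule join_list_remove1)
    with False Cons.IH[OF ms] show ?thesis by (simp add: join_list_Cons)
  qed
qed simp

section \<open>Convex combinations, monomials, polynomials, systems of inequalities\<close>

text \<open>A formal convex combination is its coefficient function, which vanishes outside the
  alphabet. Monomials and polynomials are given by lists: the factors of a monomial are
  distinct, and the monomials of a polynomial are distinct up to permutation of their factors.
  Evaluation does not depend on the order of the list elements
  (see \<open>eval_mono_perm\<close> and \<open>eval_poly_perm\<close> below).\<close>

type_synonym 's cl = "'s \<Rightarrow> real"
type_synonym 's mono = "'s cl list"
type_synonym 's polynom = "'s mono list"
type_synonym 's system = "('s \<times> 's polynom) list"

definition alphabet :: "'s set \<Rightarrow> 's set \<Rightarrow> bool" where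
  "alphabet \<Omega>v \<Omega>p \<longleftrightarrow> finite \<Omega>v \<and> finite \<Omega>p \<and> \<Omega>v \<inter> \<Omega>p = {}"

definition CL :: "'s set \<Rightarrow> 's set \<Rightarrow> 's cl set" where
  "CL \<Omega>v \<Omega>p = {E. (\<forall>\<omega>. 0 \<le> E \<omega>) \<and> (\<forall>\<omega>. \<omega> \<notin> \<Omega>v \<union> \<Omega>p \<longrightarrow> E \<omega> = 0) \<and> (\<Sum>\<omega>\<in>\<Omega>v \<union> \<Omega>p. E \<omega>) = 1}"

definition monomials :: "'s set \<Rightarrow> 's set \<Rightarrow> 's mono set" where
  "monomials \<Omega>v \<Omega>p = {M. M \<noteq> [] \<and> set M \<subseteq> CL \<Omega>v \<Omega>p \<and> distinct M}"

definition polynomials :: "'s set \<Rightarrow> 's set \<Rightarrow> 's polynom set" where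
  "polynomials \<Omega>v \<Omega>p = {\<phi>. set \<phi> \<subseteq> monomials \<Omega>v \<Omega>p \<and> distinct (map set \<phi>)}"

definition ineq_system :: "'s set \<Rightarrow> 's set \<Rightarrow> 's system \<Rightarrow> bool" where
  "ineq_system \<Omega>v \<Omega>p I \<longleftrightarrow>
     distinct (map fst I) \<and> set (map fst I) = \<Omega>v \<and> (\<forall>(x, \<phi>)\<in>set I. \<phi> \<in> polynomials \<Omega>v \<Omega>p)"

text \<open>The sums are Minkowski sums of sets.\<close>

definition eval_cl ::
  "'s set \<Rightarrow> 's set \<Rightarrow> ('s \<Rightarrow> 'a::real_vector set) \<Rightarrow> ('s \<Rightarrow> 'a set) \<Rightarrow> 's cl \<Rightarrow> 'a set" where
  "eval_cl \<Omega>v \<Omega>p X P E =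
     (\<Sum>\<omega> \<in> {\<omega>\<in>\<Omega>v. E \<omega> > 0}. (*\<^sub>R) (E \<omega>) ` X \<omega>) + (\<Sum>\<omega> \<in> {\<omega>\<in>\<Omega>p. E \<omega> > 0}. (*\<^sub>R) (E \<omega>) ` P \<omega>)"

definition eval_mono ::
  "'s set \<Rightarrow> 's set \<Rightarrow> ('s \<Rightarrow> 'a::real_vector set) \<Rightarrow> ('s \<Rightarrow> 'a set) \<Rightarrow> 's mono \<Rightarrow> 'a set" where
  "eval_mono \<Omega>v \<Omega>p X P M = join_list (map (eval_cl \<Omega>v \<Omega>p X P) M)"

definition eval_poly ::
  "'s set \<Rightarrow> 's set \<Rightarrow> ('s \<Rightarrow> 'a::real_vector set) \<Rightarrow> ('s \<Rightarrow> 'a set) \<Rightarrow> 's polynom \<Rightarrow> 'a set" where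
  "eval_poly \<Omega>v \<Omega>p X P \<phi> = (\<Union>M\<in>set \<phi>. eval_mono \<Omega>v \<Omega>p X P M)"

lemma eval_mono_perm:
  "mset M = mset N \<Longrightarrow> eval_mono \<Omega>v \<Omega>p X P M = eval_mono \<Omega>v \<Omega>p X P N"
  unfolding eval_mono_def by (rule join_list_mset) simp

lemma eval_poly_perm:
  "mset \<phi> = mset \<psi> \<Longrightarrow> eval_poly \<Omega>v \<Omega>p X P \<phi> = eval_poly \<Omega>v \<Omega>p X P \<psi>"
  unfolding eval_poly_def using mset_eq_setD by metis

definition solution ::
  "'s set \<Rightarrow> 's set \<Rightarrow> 's system \<Rightarrow> ('s \<Rightarrow> 'a::real_vector set) \<Rightarrow> ('s \<Rightarrow> 'a set) \<Rightarrow> bool" where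
  "solution \<Omega>v \<Omega>p I P X \<longleftrightarrow>
     (\<forall>x\<in>\<Omega>v. convex (X x)) \<and> (\<forall>(x, \<phi>)\<in>set I. eval_poly \<Omega>v \<Omega>p X P \<phi> \<subseteq> X x)"

definition smallest_solution ::
  "'s set \<Rightarrow> 's set \<Rightarrow> 's system \<Rightarrow> ('s \<Rightarrow> 'a::real_vector set) \<Rightarrow> ('s \<Rightarrow> 'a set) \<Rightarrow> bool" where
  "smallest_solution \<Omega>v \<Omega>p I P X \<longleftrightarrow>
     solution \<Omega>v \<Omega>p I P X \<and> (\<forall>Y. solution \<Omega>v \<Omega>p I P Y \<longrightarrow> (\<forall>x\<in>\<Omega>v. X x \<subseteq> Y x))"

lemma sum_set_mono:
  fixes F G :: "'s \<Rightarrow> 'a::real_vector set"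
  assumes "\<And>x. x \<in> S \<Longrightarrow> F x \<subseteq> G x"
  shows "sum F S \<subseteq> sum G S"
  using assms
proof (induction S rule: infinite_finite_induct)
  case (insert x S)
  then have "F x + sum F S \<subseteq> G x + sum G S" by (intro set_plus_mono2) simp_all
  with insert.hyps show ?case by simp
qed simp_all

lemma eval_cl_mono:
  assumes "\<And>x. x \<in> \<Omega>v \<Longrightarrow> X x \<subseteq> Y x"
  shows "eval_cl \<Omega>v \<Omega>p X P E \<subseteq> eval_cl \<Omega>v \<Omega>p Y P E"
  unfolding eval_cl_def
  by (intro set_plus_mono2 sum_set_mono order_refl image_mono) (auto dest: assms)

lemma join_list_mono:
  assumes "\<And>E. E \<in> set M \<Longrightarrow> f E \<subseteq> g E"
  shows "join_list (map f M) \<subseteq> join_list (map g M)"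
  using assms
proof (induction M)
  case (Cons E M)
  show ?case
  proof (cases "M = []")
    case False
    have "pos_join (f E) (join_list (map f M)) \<subseteq> pos_join (g E) (join_list (map g M))"
      by (intro pos_join_mono Cons.IH Cons.prems) simp_all
    with False show ?thesis by (simp add: join_list_Cons)
  qed (simp add: Cons.prems)
qed simp

lemma eval_poly_mono:
  assumes "\<And>x. x \<in> \<Omega>v \<Longrightarrow> X x \<subseteq> Y x"
  shows "eval_poly \<Omega>v \<Omega>p X P \<phi> \<subseteq> eval_poly \<Omega>v \<Omega>p Y P \<phi>"
  unfolding eval_poly_def eval_mono_def
  by (intro UN_mono order_refl join_list_mono eval_cl_mono assms)

lemma smallest_solution_exists:
  assumes "ineq_system \<Omega>v \<Omega>p I"
  shows "smallest_solution \<Omega>v \<Omega>p I P (\<lambda>x. \<Inter>{Y x | Y. solution \<Omega>v \<Omega>p I P Y})"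
    (is "smallest_solution _ _ _ _ ?X")
proof -
  have le: "?X x \<subseteq> Y x" if "solution \<Omega>v \<Omega>p I P Y" for x Y
    using that by blast
  have "convex (?X x)" if "x \<in> \<Omega>v" for x
    using that by (intro convex_Inter) (auto simp: solution_def)
  moreover have "eval_poly \<Omega>v \<Omega>p ?X P \<phi> \<subseteq> ?X x" if I: "(x, \<phi>) \<in> set I" for x \<phi>
  proof -
    have "eval_poly \<Omega>v \<Omega>p ?X P \<phi> \<subseteq> Y x" if Y: "solution \<Omega>v \<Omega>p I P Y" for Y
    proof -
      have "eval_poly \<Omega>v \<Omega>p ?X P \<phi> \<subseteq> eval_poly \<Omega>v \<Omega>p Y P \<phi>"
        by (intro eval_poly_mono le[OF Y])
      also have "\<dots> \<subseteq> Y x" using Y I by (auto simp: solution_def)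
      finally show ?thesis .
    qed
    then show ?thesis by blast
  qed
  ultimately have "solution \<Omega>v \<Omega>p I P ?X"
    unfolding solution_def by blast
  with le show ?thesis unfolding smallest_solution_def by blast
qed

lemma smallest_solution_unique:
  assumes "smallest_solution \<Omega>v \<Omega>p I P X" "smallest_solution \<Omega>v \<Omega>p I P Y" "x \<in> \<Omega>v"
  shows "X x = Y x"
  using assms unfolding smallest_solution_def by (meson subset_antisym)

section \<open>Semi-linear descriptions\<close>

text \<open>Quantifier-free formulas; an affine form on the space is \<open>x \<mapsto> a \<bullet> x - c\<close>.\<close>

datatype 'a qf =
    EqAt 'a real
  | LeAt 'a real
  | LessAt 'a real
  | NotF "'a qf"
  | AndF "'a qf" "'a qf"
  | OrF "'a qf" "'a qf"

fun described :: "'a::euclidean_space qf \<Rightarrow> 'a set" where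
  "described (EqAt a c) = {x. a \<bullet> x = c}"
| "described (LeAt a c) = {x. a \<bullet> x \<le> c}"
| "described (LessAt a c) = {x. a \<bullet> x < c}"
| "described (NotF F) = - described F"
| "described (AndF F G) = described F \<inter> described G"
| "described (OrF F G) = described F \<union> described G"

section \<open>Algorithms over the reals\<close>

text \<open>A WHILE language over finite binary trees with real leaves. A program computes a partial
  function on trees; real numbers are accessible only through exact arithmetic, comparison,
  and the constants 0 and 1. Ill-typed operations and division by zero are undefined.\<close>

datatype data = Nul | Num real | Pair data data

datatype prog =
    Ident | Fst | Snd | CNul | CZero | COne
  | IsPair | IsNum | Add | Sub | Mul | Div | Less
  | Tuple prog prog
  | Seq prog prog \<comment> \<open>first the left program, then the right one\<close>
  | Cond prog prog prog
  | While prog prog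

definition of_bool_data :: "bool \<Rightarrow> data" where
  "of_bool_data b = (if b then Num 1 else Nul)"

inductive run :: "prog \<Rightarrow> data \<Rightarrow> data \<Rightarrow> bool" where
  Ident: "run Ident x x"
| Fst: "run Fst (Pair x y) x"
| Snd: "run Snd (Pair x y) y"
| CNul: "run CNul x Nul"
| CZero: "run CZero x (Num 0)"
| COne: "run COne x (Num 1)"
| IsPair: "run IsPair x (of_bool_data (\<exists>y z. x = Pair y z))"
| IsNum: "run IsNum x (of_bool_data (\<exists>r. x = Num r))"
| Add: "run Add (Pair (Num r) (Num s)) (Num (r + s))"
| Sub: "run Sub (Pair (Num r) (Num s)) (Num (r - s))"
| Mul: "run Mul (Pair (Num r) (Num s)) (Num (r * s))"
| Div: "s \<noteq> 0 \<Longrightarrow> run Div (Pair (Num r) (Num s)) (Num (r / s))"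
| Less: "run Less (Pair (Num r) (Num s)) (of_bool_data (r < s))"
| Tuple: "run p x y \<Longrightarrow> run q x z \<Longrightarrow> run (Tuple p q) x (Pair y z)"
| Seq: "run p x y \<Longrightarrow> run q y z \<Longrightarrow> run (Seq p q) x z"
| CondT: "run b x c \<Longrightarrow> c \<noteq> Nul \<Longrightarrow> run p x y \<Longrightarrow> run (Cond b p q) x y"
| CondF: "run b x Nul \<Longrightarrow> run q x y \<Longrightarrow> run (Cond b p q) x y"
| WhileF: "run b x Nul \<Longrightarrow> run (While b p) x x"
| WhileT: "run b x c \<Longrightarrow> c \<noteq> Nul \<Longrightarrow> run p x y \<Longrightarrow> run (While b p) y z \<Longrightarrow> run (While b p) x z"

inductive_cases run_primE:
  "run Ident x y" "run Fst x y" "run Snd x y" "run CNul x y" "run CZero x y" "run COne x y"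
  "run IsPair x y" "run IsNum x y" "run Add x y" "run Sub x y" "run Mul x y" "run Div x y"
  "run Less x y"
inductive_cases run_TupleE: "run (Tuple p q) x y"
inductive_cases run_SeqE: "run (Seq p q) x y"
inductive_cases run_CondE: "run (Cond b p q) x y"
inductive_cases run_WhileE: "run (While b p) x y"

lemma run_deterministic: "run p x y \<Longrightarrow> run p x z \<Longrightarrow> y = z"
proof (induction arbitrary: z rule: run.induct)
  case (Tuple p x y q w)
  from Tuple.prems Tuple.IH show ?case by (metis run_TupleE)
next
  case (Seq p x y q w)
  from Seq.prems Seq.IH show ?case by (metis run_SeqE)
next
  case (CondT b x c p y q)
  from CondT.prems CondT.IH CondT.hyps show ?case by (metis run_CondE)
next
  case (CondF b x q y p)
  from CondF.prems CondF.IH CondF.hyps show ?case by (metis run_CondE)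
next
  case (WhileF b x p)
  from WhileF.prems WhileF.IH WhileF.hyps show ?case by (metis run_WhileE)
next
  case (WhileT b x c p y w)
  from WhileT.prems WhileT.IH WhileT.hyps show ?case by (metis run_WhileE)
qed (erule run_primE; simp)+

section \<open>Encoding of inputs and outputs\<close>

text \<open>Vectors are given by their coordinates with respect to a listing \<open>bs\<close> of the standard
  basis, convex combinations by their coefficients in the order of a listing \<open>ss\<close> of the
  symbols.\<close>

fun enc_list :: "data list \<Rightarrow> data" where
  "enc_list [] = Nul"
| "enc_list (x # xs) = Pair x (enc_list xs)"

definition enc_vec :: "'a::euclidean_space list \<Rightarrow> 'a \<Rightarrow> data" where
  "enc_vec bs a = enc_list (map (\<lambda>b. Num (a \<bullet> b)) bs)"

fun enc_qf :: "'a::euclidean_space list \<Rightarrow> 'a qf \<Rightarrow> data" where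
  "enc_qf bs (EqAt a c) = enc_list [Num 0, enc_vec bs a, Num c]"
| "enc_qf bs (LeAt a c) = enc_list [Num 1, enc_vec bs a, Num c]"
| "enc_qf bs (LessAt a c) = enc_list [Num 2, enc_vec bs a, Num c]"
| "enc_qf bs (NotF F) = enc_list [Num 3, enc_qf bs F]"
| "enc_qf bs (AndF F G) = enc_list [Num 4, enc_qf bs F, enc_qf bs G]"
| "enc_qf bs (OrF F G) = enc_list [Num 5, enc_qf bs F, enc_qf bs G]"

definition enc_qfs :: "'a::euclidean_space list \<Rightarrow> 'a qf list \<Rightarrow> data" where
  "enc_qfs bs Fs = enc_list (map (enc_qf bs) Fs)"

definition enc_cl :: "'s list \<Rightarrow> 's cl \<Rightarrow> data" where
  "enc_cl ss E = enc_list (map (\<lambda>\<omega>. Num (E \<omega>)) ss)"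

definition enc_mono :: "'s list \<Rightarrow> 's mono \<Rightarrow> data" where
  "enc_mono ss M = enc_list (map (enc_cl ss) M)"

definition enc_polynom :: "'s list \<Rightarrow> 's polynom \<Rightarrow> data" where
  "enc_polynom ss \<phi> = enc_list (map (enc_mono ss) \<phi>)"

text \<open>The \<open>i\<close>-th variable is the left-hand side of the \<open>i\<close>-th inequality; \<open>ps\<close> lists the
  parameters.\<close>

definition enc_system :: "'s list \<Rightarrow> 's system \<Rightarrow> data" where
  "enc_system ps I = enc_list (map (\<lambda>(x, \<phi>). enc_polynom (map fst I @ ps) \<phi>) I)"

end

theory Submission
  imports Defs "HOL-Library.While_Combinator"
begin

text \<open>
  A point \<open>x\<close> of the component \<open>X i\<close> is produced by a finite derivation tree. Recording only how
  much mass the tree sends through each monomial factor, and through each point of a parameter,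
  turns it into a flow: mass \<open>1\<close> enters at \<open>i\<close>, is conserved at the other variables and leaves
  at the parameters, with barycentre \<open>x\<close>. Conversely, a flow comes from a tree as soon as its support is productive, i.e.
  its monomials can be ordered so that each of them only uses symbols produced before. Indeed,
  let \<open>D\<close> be the set of points of \<open>X i\<close> which are values of (nonnegative) flows along the support.
  Linear programming duality, applied to the support functions of the analogous sets for all
  symbols, places \<open>x\<close> in the closure of \<open>D\<close>; as the weights of the flow are positive, it can be prolonged beyond
  \<open>x\<close> away from any point of \<open>D\<close>. So \<open>x\<close> lies in the relative interior of \<open>D\<close>, hence in \<open>D\<close>.

  The flows with a given support form a projection of a semi-linear set, and there are finitely
  many supports, so Fourier-Motzkin elimination computes a description of \<open>X i\<close>. Since \<open>X i\<close> is also convex and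
  bounded, it is a hemihedron: cut it into the sign cells of the affine forms of its description.
\<close>

section \<open>Computability of list functions\<close>

text \<open>Iterating the inequalities from the empty assignment need not stabilise, so
  semi-linearity is not visible from finitely many evaluations. Since joins use only positive
  weights, the components are in general neither open nor closed, and computing their closures would
  leave the boundary undecided. A parameter may be nonconvex, and a weight times an unknown point is
  not linear. Both are cured by splitting each parameter into convex cells, the branches of a
  disjunctive normal form, and by passing to the cone over each cell, where the scaled point is
  itself the unknown. These cones, and those of the monomials, are closed under addition, so two
  uses of a production merge into one: the number of productions bounds the number of steps, and as
  many rounds of elimination are exact. The program is uniform in the alphabet and the system; the
  dimension of the space enters it only through a constant zero vector.\<close>

definition computable :: "('e \<Rightarrow> data) \<Rightarrow> ('r \<Rightarrow> data) \<Rightarrow> ('e \<Rightarrow> 'r) \<Rightarrow> bool" where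
  "computable e r f \<longleftrightarrow> (\<exists>p. \<forall>x. run p (e x) (r (f x)))"

lemma compI: "(\<And>x. run p (e x) (r (f x))) \<Longrightarrow> computable e r f"
  unfolding computable_def by blast

lemma compE: assumes "computable e r f" obtains p where "\<And>x. run p (e x) (r (f x))"
  using assms unfolding computable_def by blast

definition enc_pair :: "('x \<Rightarrow> data) \<Rightarrow> ('y \<Rightarrow> data) \<Rightarrow> 'x \<times> 'y \<Rightarrow> data" where
  "enc_pair a b z = Pair (a (fst z)) (b (snd z))"

abbreviation lst :: "('x \<Rightarrow> data) \<Rightarrow> 'x list \<Rightarrow> data" where
  "lst a \<equiv> \<lambda>xs. enc_list (map a xs)"

text \<open>A bound variable of a definition becomes a projection of the environment, so that
  \<open>(rule computes)+\<close> compiles the definition into a program.\<close>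

named_theorems computes

section \<open>Projections, composition, arithmetic and Boolean operations\<close>

lemma comp_ident: "computable e e (\<lambda>x. x)"
  by (rule compI[where p = Ident]) (rule run.Ident)

lemma comp_fst: "computable e (enc_pair a b) f \<Longrightarrow> computable e a (\<lambda>x. fst (f x))"
proof (elim compE)
  fix p assume "\<And>x. run p (e x) (enc_pair a b (f x))"
  then show ?thesis by (intro compI[where p = "Seq p Fst"]) (metis enc_pair_def run.Seq run.Fst)
qed

lemma comp_snd: "computable e (enc_pair a b) f \<Longrightarrow> computable e b (\<lambda>x. snd (f x))"
proof (elim compE)
  fix p assume "\<And>x. run p (e x) (enc_pair a b (f x))"
  then show ?thesis by (intro compI[where p = "Seq p Snd"]) (metis enc_pair_def run.Seq run.Snd)
qed

lemma comp_pair: "computable e a f \<Longrightarrow> computable e b g \<Longrightarrow> computable e (enc_pair a b) (\<lambda>x. (f x, g x))"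
proof (elim compE)
  fix p q assume "\<And>x. run p (e x) (a (f x))" "\<And>x. run q (e x) (b (g x))"
  then show ?thesis by (intro compI[where p = "Tuple p q"]) (auto simp: enc_pair_def intro: run.Tuple)
qed

lemma comp_trans: "computable e a f \<Longrightarrow> computable a b g \<Longrightarrow> computable e b (\<lambda>x. g (f x))"
proof (elim compE)
  fix p q assume "\<And>x. run p (e x) (a (f x))" "\<And>x. run q (a x) (b (g x))"
  then show ?thesis by (intro compI[where p = "Seq p q"]) (blast intro: run.Seq)
qed

lemma comp_zero: "computable e Num (\<lambda>_. 0)" and comp_one: "computable e Num (\<lambda>_. 1)"
  by (rule compI, rule run.CZero run.COne)+

lemma comp_arith:
  assumes "computable e Num f" "computable e Num g"
  shows comp_add: "computable e Num (\<lambda>x. f x + g x)"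
    and comp_diff: "computable e Num (\<lambda>x. f x - g x)"
    and comp_mult: "computable e Num (\<lambda>x. f x * g x)"
    and comp_less: "computable e of_bool_data (\<lambda>x. f x < g x)"
proof -
  from assms obtain p q where pq: "\<And>x. run p (e x) (Num (f x))" "\<And>x. run q (e x) (Num (g x))"
    unfolding computable_def by blast
  note * = run.Seq[OF run.Tuple[OF pq]]
  show "computable e Num (\<lambda>x. f x + g x)" "computable e Num (\<lambda>x. f x - g x)" "computable e Num (\<lambda>x. f x * g x)"
    "computable e of_bool_data (\<lambda>x. f x < g x)"
    by (rule compI, rule *, rule run.intros)+
qed

lemma comp_minus: "computable e Num f \<Longrightarrow> computable e Num (\<lambda>x. - f x)"
  using comp_diff[OF comp_zero] by simp

lemma comp_if:
  assumes "computable e of_bool_data b" "computable e a f" "computable e a g"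
  shows "computable e a (\<lambda>x. if b x then f x else g x)"
proof -
  from assms obtain p q r where pqr: "\<And>x. run p (e x) (of_bool_data (b x))" "\<And>x. run q (e x) (a (f x))" "\<And>x. run r (e x) (a (g x))"
    unfolding computable_def by blast
  then have "run (Cond p q r) (e x) (a (if b x then f x else g x))" for x
    using run.CondT[of p "e x" "Num 1" q "a (f x)" r] run.CondF[of p "e x" r "a (g x)" q] pqr[of x]
    by (cases "b x") (auto simp: of_bool_data_def)
  then show ?thesis by (rule compI)
qed

lemma comp_False: "computable e of_bool_data (\<lambda>_. False)" and comp_True: "computable e of_bool_data (\<lambda>_. True)"
  by (rule compI, simp add: of_bool_data_def, rule run.CNul run.COne)+

lemma comp_not: "computable e of_bool_data f \<Longrightarrow> computable e of_bool_data (\<lambda>x. \<not> f x)"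
  using comp_if[OF _ comp_False comp_True, of e f] by (rule back_subst[of "computable e of_bool_data"]) auto

lemma comp_conj: "computable e of_bool_data f \<Longrightarrow> computable e of_bool_data g \<Longrightarrow> computable e of_bool_data (\<lambda>x. f x \<and> g x)"
  using comp_if[OF _ _ comp_False, of e f g] by (rule back_subst[of "computable e of_bool_data"]) auto

lemma comp_disj: "computable e of_bool_data f \<Longrightarrow> computable e of_bool_data g \<Longrightarrow> computable e of_bool_data (\<lambda>x. f x \<or> g x)"
  using comp_if[OF _ comp_True, of e f g] by (rule back_subst[of "computable e of_bool_data"]) auto

lemma comp_imp: "computable e of_bool_data f \<Longrightarrow> computable e of_bool_data g \<Longrightarrow> computable e of_bool_data (\<lambda>x. f x \<longrightarrow> g x)"
  using comp_disj[OF comp_not, of e f g] by simp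

section \<open>Lists, folds and terminating loops\<close>

lemma comp_Nil: "computable e (lst a) (\<lambda>_. [])"
  by (rule compI, simp, rule run.CNul)

lemma comp_Cons: "computable e a f \<Longrightarrow> computable e (lst a) g \<Longrightarrow> computable e (lst a) (\<lambda>x. f x # g x)"
proof (elim compE)
  fix p q assume "\<And>x. run p (e x) (a (f x))" "\<And>x. run q (e x) (lst a (g x))"
  then show ?thesis by (intro compI[where p = "Tuple p q"]) (auto intro: run.Tuple)
qed

text \<open>An encoded list is a \<open>Pair\<close> exactly when it is nonempty, so
  \<open>IsPair\<close> decides the case. In the second case the list is passed on as it stands,
  since its encoding is also that of the pair of head and tail.\<close>

lemma comp_case_list:
  assumes "computable e (lst a) l" "computable e b f" "computable (enc_pair e (enc_pair a (lst a))) b (\<lambda>z. g (fst z) (fst (snd z)) (snd (snd z)))"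
  shows "computable e b (\<lambda>x. case l x of [] \<Rightarrow> f x | h # t \<Rightarrow> g x h t)"
proof -
  from assms obtain p q r where pqr: "\<And>x. run p (e x) (lst a (l x))" "\<And>x. run q (e x) (b (f x))"
    "\<And>z. run r (enc_pair e (enc_pair a (lst a)) z) (b (g (fst z) (fst (snd z)) (snd (snd z))))"
    unfolding computable_def by blast
  have "run (Cond (Seq p IsPair) (Seq (Tuple Ident p) r) q) (e x) (b (case l x of [] \<Rightarrow> f x | h # t \<Rightarrow> g x h t))" for x
  proof (cases "l x")
    case Nil
    then have "run (Seq p IsPair) (e x) Nul"
      using run.Seq[OF pqr(1)[of x] run.IsPair] by (simp add: of_bool_data_def)
    then show ?thesis using pqr(2) Nil by (auto intro: run.CondF)
  next
    case (Cons h t)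
    then have "run (Seq p IsPair) (e x) (Num 1)"
      using run.Seq[OF pqr(1)[of x] run.IsPair] by (simp add: of_bool_data_def)
    moreover have "run (Seq (Tuple Ident p) r) (e x) (b (g x h t))"
      using run.Seq[OF run.Tuple[OF run.Ident pqr(1)[of x]], of r] pqr(3)[of "(x, h, t)"] Cons
      by (simp add: enc_pair_def)
    ultimately show ?thesis using Cons by (auto intro: run.CondT)
  qed
  then show ?thesis by (rule compI)
qed

text \<open>A loop on triples of environment, remaining list and accumulator. The environment is
  carried along because \<open>f\<close> may refer to it; this is how nested folds compile.\<close>

lemma comp_fold:
  assumes "computable e (lst a) l" "computable e b s" "computable (enc_pair (enc_pair e a) b) b (\<lambda>z. f (fst (fst z)) (snd (fst z)) (snd z))"
  shows "computable e b (\<lambda>x. fold (\<lambda>y. f x y) (l x) (s x))"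
proof -
  from assms obtain p q r where pqr: "\<And>x. run p (e x) (lst a (l x))" "\<And>x. run q (e x) (b (s x))"
    "\<And>z. run r (enc_pair (enc_pair e a) b z) (b (f (fst (fst z)) (snd (fst z)) (snd z)))"
    unfolding computable_def by blast
  \<comment> \<open>The new triple consists of the old environment, the tail of the list, and the
    result of \<open>r\<close> on environment, head and accumulator.\<close>
  let ?body = "Tuple Fst (Tuple (Seq Snd (Seq Fst Snd)) (Seq (Tuple (Tuple Fst (Seq Snd (Seq Fst Fst))) (Seq Snd Snd)) r))"
  let ?w = "While (Seq Snd (Seq Fst IsPair)) ?body"
  have loop: "run ?w (Pair (e x) (Pair (lst a xs) (b t))) (Pair (e x) (Pair Nul (b (fold (f x) xs t))))" for x xs t
  proof (induction xs arbitrary: t)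
    case Nil
    have "run (Seq Snd (Seq Fst IsPair)) (Pair (e x) (Pair Nul (b t))) (of_bool_data False)"
      using run.Seq[OF run.Snd run.Seq[OF run.Fst run.IsPair], of "e x" Nul "b t"] by simp
    then show ?case by (auto simp: of_bool_data_def intro: run.WhileF)
  next
    case (Cons y xs)
    let ?in = "Pair (e x) (Pair (Pair (a y) (lst a xs)) (b t))"
    have 1: "run (Seq Snd (Seq Fst IsPair)) ?in (of_bool_data True)"
      using run.Seq[OF run.Snd run.Seq[OF run.Fst run.IsPair], of "e x" "Pair (a y) (lst a xs)" "b t"] by simp
    have "run r (Pair (Pair (e x) (a y)) (b t)) (b (f x y t))"
      using pqr(3)[of "((x, y), t)"] by (simp add: enc_pair_def)
    then have 2: "run ?body ?in (Pair (e x) (Pair (lst a xs) (b (f x y t))))"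
      by (auto intro!: run.intros)
    show ?case
      using run.WhileT[OF 1 _ 2 Cons.IH] by (simp add: of_bool_data_def)
  qed
  have "run (Seq (Tuple Ident (Tuple p q)) (Seq ?w (Seq Snd Snd))) (e x) (b (fold (f x) (l x) (s x)))" for x
    by (rule run.Seq[OF run.Tuple[OF run.Ident run.Tuple[OF pqr(1,2)]] run.Seq[OF loop run.Seq[OF run.Snd run.Snd]]])
  then show ?thesis by (rule compI)
qed

text \<open>The function \<open>while\<close> is total in the logic, but a program loop that does
  not halt has no result. The measure \<open>m\<close> turns the unfolding equation into a
  terminating run.\<close>

lemma comp_while:
  fixes m :: "'x \<Rightarrow> nat"
  assumes "computable a of_bool_data b" "computable a a f" "\<And>x. b x \<Longrightarrow> m (f x) < m x" "computable e a s"
  shows "computable e a (\<lambda>x. while b f (s x))"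
proof -
  from assms(1,2) obtain p q where pq: "\<And>x. run p (a x) (of_bool_data (b x))" "\<And>x. run q (a x) (a (f x))"
    unfolding computable_def by blast
  have "run (While p q) (a x) (a (while b f x))" for x
  proof (induction "m x" arbitrary: x rule: less_induct)
    case less
    show ?case
    proof (cases "b x")
      case True
      then have "while b f x = while b f (f x)" by (subst while_unfold) simp
      moreover have "run p (a x) (Num 1)" using pq(1)[of x] True by (simp add: of_bool_data_def)
      ultimately show ?thesis using run.WhileT[OF _ _ pq(2) less[OF assms(3)[OF True]]] by auto
    next
      case False
      then have "while b f x = x" by (subst while_unfold) simp
      then show ?thesis using pq(1)[of x] False by (auto simp: of_bool_data_def intro: run.WhileF)
    qed
  qed
  then have "computable a a (\<lambda>x. while b f x)" by (rule compI)
  from comp_trans[OF assms(4) this] show ?thesis .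
qed

lemmas [computes] = comp_fst comp_snd comp_pair comp_zero comp_one comp_add comp_diff comp_mult comp_less comp_minus
  comp_if comp_False comp_True comp_not comp_conj comp_disj comp_imp comp_Nil comp_Cons comp_case_list comp_fold comp_ident

lemma comp_rev [computes]:
  assumes "computable e (lst a) l"
  shows "computable e (lst a) (\<lambda>x. rev (l x))"
proof -
  have "computable e (lst a) (\<lambda>x. fold (\<lambda>y s. y # s) (l x) [])"
    by (rule assms computes )+
  then show ?thesis by (simp add: fold_Cons_rev)
qed

lemma comp_foldr [computes]:
  assumes "computable e (lst a) l" "computable e b s" "computable (enc_pair (enc_pair e a) b) b (\<lambda>z. f (fst (fst z)) (snd (fst z)) (snd z))"
  shows "computable e b (\<lambda>x. foldr (\<lambda>y. f x y) (l x) (s x))"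
  unfolding foldr_conv_fold by (rule assms comp_fold comp_rev)+

lemma comp_append [computes]:
  assumes "computable e (lst a) l" "computable e (lst a) k"
  shows "computable e (lst a) (\<lambda>x. l x @ k x)"
proof -
  have "computable e (lst a) (\<lambda>x. foldr (\<lambda>y s. y # s) (l x) (k x))"
    by (rule assms computes )+
  then show ?thesis by (simp add: foldr_conv_fold fold_Cons_rev)
qed

lemma comp_map [computes]:
  assumes "computable e (lst a) l" "computable (enc_pair e a) b (\<lambda>z. f (fst z) (snd z))"
  shows "computable e (lst b) (\<lambda>x. map (\<lambda>y. f x y) (l x))"
proof -
  have "computable e (lst b) (\<lambda>x. foldr (\<lambda>y s. f x y # s) (l x) [])"
    by (rule assms computes comp_trans[OF comp_fst[OF comp_ident] assms(2)])+
  moreover have "foldr (\<lambda>y s. g y # s) xs [] = map g xs" for g :: "'b \<Rightarrow> 'c" and xs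
    by (induction xs) auto
  ultimately show ?thesis by simp
qed

lemma comp_concat [computes]:
  assumes "computable e (lst (lst a)) l"
  shows "computable e (lst a) (\<lambda>x. concat (l x))"
proof -
  have "computable e (lst a) (\<lambda>x. foldr (\<lambda>y s. y @ s) (l x) [])"
    by (rule assms computes )+
  moreover have "foldr (\<lambda>y s. y @ s) xs [] = concat xs" for xs :: "'b list list"
    by (induction xs) auto
  ultimately show ?thesis by simp
qed

text \<open>A fold over the first list which consumes the second as part of its state. Once the
  second list is empty the remaining steps change nothing, which gives the truncation of
  \<open>zip\<close>.\<close>

lemma comp_zip [computes]:
  assumes "computable e (lst a) l" "computable e (lst b) k"
  shows "computable e (lst (enc_pair a b)) (\<lambda>x. zip (l x) (k x))"
proof -
  let ?f = "\<lambda>y s. case fst s of [] \<Rightarrow> ([], snd s) | h # t \<Rightarrow> (t, (y, h) # snd s)"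
  have "computable e (lst (enc_pair a b)) (\<lambda>x. rev (snd (fold (\<lambda>y s. ?f y s) (l x) (k x, []))))"
    by (rule assms computes )+
  moreover have "snd (fold ?f xs (ys, zs)) = rev (zip xs ys) @ zs" for xs :: "'b list" and ys :: "'c list" and zs
  proof (induction xs arbitrary: ys zs)
    case (Cons x xs)
    have "snd (fold ?f xs ([], zs)) = zs" for zs by (induction xs) auto
    then show ?case using Cons by (cases ys) auto
  qed simp
  ultimately show ?thesis by simp
qed

lemma comp_list_all [computes]:
  assumes "computable e (lst a) l" "computable (enc_pair e a) of_bool_data (\<lambda>z. f (fst z) (snd z))"
  shows "computable e of_bool_data (\<lambda>x. list_all (\<lambda>y. f x y) (l x))"
proof -
  have "computable e of_bool_data (\<lambda>x. foldr (\<lambda>y s. f x y \<and> s) (l x) True)"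
    by (rule assms computes comp_trans[OF comp_fst[OF comp_ident] assms(2)])+
  moreover have "foldr (\<lambda>y s. g y \<and> s) xs True = list_all g xs" for g :: "'b \<Rightarrow> bool" and xs
    by (induction xs) auto
  ultimately show ?thesis by simp
qed

text \<open>Natural numbers are not among the data of the programs, so a length enters only through
  a list that has it: one tail is taken per element of \<open>k\<close>.\<close>

lemma comp_drop [computes]:
  assumes "computable e (lst b) k" "computable e (lst a) l"
  shows "computable e (lst a) (\<lambda>x. drop (length (k x)) (l x))"
proof -
  have "computable e (lst a) (\<lambda>x. fold (\<lambda>_ s. case s of [] \<Rightarrow> [] | h # t \<Rightarrow> t) (k x) (l x))"
    by (rule assms computes )+
  moreover have "fold (\<lambda>_ s. case s of [] \<Rightarrow> [] | h # t \<Rightarrow> t) xs ys = drop (length xs) ys" for xs :: "'b list" and ys :: "'c list"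
    by (induction xs arbitrary: ys) (auto simp: drop_Suc tl_def)
  ultimately show ?thesis by simp
qed

section \<open>The algorithm\<close>

lemma comp_Let [computes]:
  assumes "computable e a f" "computable (enc_pair e a) b (\<lambda>z. g (fst z) (snd z))"
  shows "computable e b (\<lambda>x. let y = f x in g x y)"
  using comp_trans[OF comp_pair[OF comp_ident assms(1)] assms(2)] by simp

text \<open>The dimension \<open>d\<close> is fixed when the program is written, so the zero vector
  is a constant built by recursion on \<open>d\<close>.\<close>

lemma comp_replicate: "computable e (lst Num) (\<lambda>_. replicate d 0)"
  by (induction d) (simp, rule computes, simp, (rule computes | assumption)+)

text \<open>The encoding of formulas whose vectors are coordinate lists already. With it the
  algorithm is a function on lists, independent of the type of the space.\<close>

fun enc_lqf :: "real list qf \<Rightarrow> data" where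
  "enc_lqf (EqAt a c) = enc_list [Num 0, lst Num a, Num c]"
| "enc_lqf (LeAt a c) = enc_list [Num 1, lst Num a, Num c]"
| "enc_lqf (LessAt a c) = enc_list [Num 2, lst Num a, Num c]"
| "enc_lqf (NotF F) = enc_list [Num 3, enc_lqf F]"
| "enc_lqf (AndF F G) = enc_list [Num 4, enc_lqf F, enc_lqf G]"
| "enc_lqf (OrF F G) = enc_list [Num 5, enc_lqf F, enc_lqf G]"

primrec numeral_prog :: "nat \<Rightarrow> prog" where
  "numeral_prog 0 = CZero"
| "numeral_prog (Suc n) = Seq (Tuple (numeral_prog n) COne) prog.Add"

lemma run_numeral_prog: "run (numeral_prog n) x (Num (real n))"
proof (induction n)
  case (Suc n)
  show ?case using run.Seq[OF run.Tuple[OF Suc run.COne] run.Add] by (simp add: add.commute)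
qed (simp add: run.CZero)

text \<open>Numbers can be compared only by \<open><\<close>, so the constructor tags 0 to 5 are
  told apart by thresholds. The input is an environment paired with an encoded formula.\<close>

definition tag_less :: "nat \<Rightarrow> prog" where
  "tag_less n = Seq (Tuple (Seq Snd Fst) (numeral_prog n)) Less"

lemma run_tag_less: "run (tag_less n) (Pair u (Pair (Num r) w)) (of_bool_data (r < real n))"
  unfolding tag_less_def by (rule run.Seq[OF run.Tuple[OF run.Seq[OF run.Snd run.Fst] run_numeral_prog] run.Less])

lemma comp_qf_atoms:
  assumes "computable e (lst Num) f" "computable e Num g"
  shows "computable e enc_lqf (\<lambda>x. EqAt (f x) (g x))" "computable e enc_lqf (\<lambda>x. LeAt (f x) (g x))"
    "computable e enc_lqf (\<lambda>x. LessAt (f x) (g x))"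
proof -
  from assms obtain p q where pq: "\<And>x. run p (e x) (lst Num (f x))" "\<And>x. run q (e x) (Num (g x))"
    unfolding computable_def by blast
  have *: "run (Tuple (numeral_prog n) (Tuple p (Tuple q CNul))) (e x)
     (Pair (Num (real n)) (Pair (lst Num (f x)) (Pair (Num (g x)) Nul)))" for n x
    by (intro run.Tuple run_numeral_prog pq run.CNul)
  show "computable e enc_lqf (\<lambda>x. EqAt (f x) (g x))" using *[of 0] by (intro compI[where p = "Tuple (numeral_prog 0) (Tuple p (Tuple q CNul))"]) simp
  show "computable e enc_lqf (\<lambda>x. LeAt (f x) (g x))" using *[of 1] by (intro compI[where p = "Tuple (numeral_prog 1) (Tuple p (Tuple q CNul))"]) simp
  show "computable e enc_lqf (\<lambda>x. LessAt (f x) (g x))" using *[of 2] by (intro compI[where p = "Tuple (numeral_prog 2) (Tuple p (Tuple q CNul))"]) simp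
qed

lemma comp_qf_junctors:
  assumes "computable e enc_lqf f" "computable e enc_lqf g"
  shows "computable e enc_lqf (\<lambda>x. AndF (f x) (g x))" "computable e enc_lqf (\<lambda>x. OrF (f x) (g x))"
proof -
  from assms obtain p q where pq: "\<And>x. run p (e x) (enc_lqf (f x))" "\<And>x. run q (e x) (enc_lqf (g x))"
    unfolding computable_def by blast
  have *: "run (Tuple (numeral_prog n) (Tuple p (Tuple q CNul))) (e x)
     (Pair (Num (real n)) (Pair (enc_lqf (f x)) (Pair (enc_lqf (g x)) Nul)))" for n x
    by (intro run.Tuple run_numeral_prog pq run.CNul)
  show "computable e enc_lqf (\<lambda>x. AndF (f x) (g x))" using *[of 4] by (intro compI[where p = "Tuple (numeral_prog 4) (Tuple p (Tuple q CNul))"]) simp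
  show "computable e enc_lqf (\<lambda>x. OrF (f x) (g x))" using *[of 5] by (intro compI[where p = "Tuple (numeral_prog 5) (Tuple p (Tuple q CNul))"]) simp
qed

lemmas [computes] = comp_qf_atoms comp_qf_junctors

lemma comp_case_qf [computes]:
  assumes "computable e enc_lqf F"
    "computable (enc_pair e (enc_pair (lst Num) Num)) b (\<lambda>z. f0 (fst z) (fst (snd z)) (snd (snd z)))"
    "computable (enc_pair e (enc_pair (lst Num) Num)) b (\<lambda>z. f1 (fst z) (fst (snd z)) (snd (snd z)))"
    "computable (enc_pair e (enc_pair (lst Num) Num)) b (\<lambda>z. f2 (fst z) (fst (snd z)) (snd (snd z)))"
    "computable (enc_pair e enc_lqf) b (\<lambda>z. f3 (fst z) (snd z))"
    "computable (enc_pair e (enc_pair enc_lqf enc_lqf)) b (\<lambda>z. f4 (fst z) (fst (snd z)) (snd (snd z)))"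
    "computable (enc_pair e (enc_pair enc_lqf enc_lqf)) b (\<lambda>z. f5 (fst z) (fst (snd z)) (snd (snd z)))"
  shows "computable e b (\<lambda>x. case F x of EqAt a c \<Rightarrow> f0 x a c | LeAt a c \<Rightarrow> f1 x a c | LessAt a c \<Rightarrow> f2 x a c
    | NotF A \<Rightarrow> f3 x A | AndF A B \<Rightarrow> f4 x A B | OrF A B \<Rightarrow> f5 x A B)"
    (is "computable e b ?f")
proof -
  obtain p where p: "\<And>x. run p (e x) (enc_lqf (F x))" using assms(1) by (rule compE) blast
  obtain p0 where p0: "\<And>z. run p0 (enc_pair e (enc_pair (lst Num) Num) z) (b (f0 (fst z) (fst (snd z)) (snd (snd z))))"
    using assms(2) by (rule compE) blast
  obtain p1 where p1: "\<And>z. run p1 (enc_pair e (enc_pair (lst Num) Num) z) (b (f1 (fst z) (fst (snd z)) (snd (snd z))))"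
    using assms(3) by (rule compE) blast
  obtain p2 where p2: "\<And>z. run p2 (enc_pair e (enc_pair (lst Num) Num) z) (b (f2 (fst z) (fst (snd z)) (snd (snd z))))"
    using assms(4) by (rule compE) blast
  obtain p3 where p3: "\<And>z. run p3 (enc_pair e enc_lqf z) (b (f3 (fst z) (snd z)))"
    using assms(5) by (rule compE) blast
  obtain p4 where p4: "\<And>z. run p4 (enc_pair e (enc_pair enc_lqf enc_lqf) z) (b (f4 (fst z) (fst (snd z)) (snd (snd z))))"
    using assms(6) by (rule compE) blast
  obtain p5 where p5: "\<And>z. run p5 (enc_pair e (enc_pair enc_lqf enc_lqf) z) (b (f5 (fst z) (fst (snd z)) (snd (snd z))))"
    using assms(7) by (rule compE) blast
  let ?one = "Tuple Fst (Seq Snd (Seq Snd Fst))"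
  let ?two = "Tuple Fst (Tuple (Seq Snd (Seq Snd Fst)) (Seq Snd (Seq Snd (Seq Snd Fst))))"
  \<comment> \<open>The thresholds increase, so each test first succeeds at a single tag.
    \<open>?one\<close> and \<open>?two\<close> strip the tag and pair the environment with the one
    or two arguments.\<close>
  let ?sw = "Cond (tag_less 1) (Seq ?two p0) (Cond (tag_less 2) (Seq ?two p1) (Cond (tag_less 3) (Seq ?two p2)
    (Cond (tag_less 4) (Seq ?one p3) (Cond (tag_less 5) (Seq ?two p4) (Seq ?two p5)))))"
  have one: "run ?one (Pair u (Pair t (Pair v w))) (Pair u v)" for u v w t
    by (rule run.Tuple run.Seq run.Fst run.Snd)+
  have two: "run ?two (Pair u (Pair t (Pair v (Pair w w')))) (Pair u (Pair v w))" for u v w w' t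
    by (rule run.Tuple run.Seq run.Fst run.Snd)+
  have T: "r < real n \<Longrightarrow> run q (Pair u (Pair (Num r) w)) y \<Longrightarrow> run (Cond (tag_less n) q q') (Pair u (Pair (Num r) w)) y" for r n u w q q' y
    using run_tag_less[of n u r w] by (intro run.CondT[of _ _ "Num 1"]) (auto simp: of_bool_data_def)
  have N: "\<not> r < real n \<Longrightarrow> run q' (Pair u (Pair (Num r) w)) y \<Longrightarrow> run (Cond (tag_less n) q q') (Pair u (Pair (Num r) w)) y" for r n u w q q' y
    using run_tag_less[of n u r w] by (intro run.CondF) (auto simp: of_bool_data_def)
  have "run ?sw (Pair (e x) (enc_lqf (F x))) (b (?f x))" for x
  proof (cases "F x")
    case (EqAt a c)
    then show ?thesis using run.Seq[OF two, of p0 "e x" "lst Num a" "Num c" "b (f0 x a c)"] p0[of "(x, a, c)"]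
      by (simp add: enc_pair_def T)
  next
    case (LeAt a c)
    then show ?thesis using run.Seq[OF two, of p1 "e x" "lst Num a" "Num c" "b (f1 x a c)"] p1[of "(x, a, c)"]
      by (simp add: enc_pair_def T N)
  next
    case (LessAt a c)
    then show ?thesis using run.Seq[OF two, of p2 "e x" "lst Num a" "Num c" "b (f2 x a c)"] p2[of "(x, a, c)"]
      by (simp add: enc_pair_def T N)
  next
    case (NotF A)
    then show ?thesis using run.Seq[OF one, of p3 "e x" "enc_lqf A" "b (f3 x A)"] p3[of "(x, A)"]
      by (simp add: enc_pair_def T N)
  next
    case (AndF A B)
    then show ?thesis using run.Seq[OF two, of p4 "e x" "enc_lqf A" "enc_lqf B" "b (f4 x A B)"] p4[of "(x, A, B)"]
      by (simp add: enc_pair_def T N)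
  next
    case (OrF A B)
    then show ?thesis using run.Seq[OF two, of p5 "e x" "enc_lqf A" "enc_lqf B" "b (f5 x A B)"] p5[of "(x, A, B)"]
      by (simp add: enc_pair_def N)
  qed
  then have "run (Seq (Tuple Ident p) ?sw) (e x) (b (?f x))" for x
    by (rule run.Seq[OF run.Tuple[OF run.Ident p]])
  then show ?thesis by (rule compI)
qed

section \<open>Fourier-Motzkin elimination for homogeneous constraints\<close>

type_synonym constr = "bool \<times> real list"

text \<open>The constraint \<open>(s, l)\<close> on \<open>v\<close> is \<open>0 < dot l v\<close> if \<open>s\<close> holds, and \<open>0 \<le> dot l v\<close> otherwise.\<close>

definition dot :: "real list \<Rightarrow> real list \<Rightarrow> real" where
  "dot l v = foldr (\<lambda>p s. fst p * snd p + s) (zip l v) 0"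

definition neg :: "real list \<Rightarrow> real list" where
  "neg l = map (\<lambda>c. - c) l"

definition holds :: "bool \<Rightarrow> real \<Rightarrow> bool" where
  "holds s r \<longleftrightarrow> (if s then 0 < r else 0 \<le> r)"

definition sat :: "real list \<Rightarrow> constr list \<Rightarrow> bool" where
  "sat v A \<longleftrightarrow> (\<forall>a\<in>set A. holds (fst a) (dot (snd a) v))"

text \<open>One Fourier-Motzkin resolvent. Here \<open>h\<close> and \<open>snd a\<close> are the
  positive leading coefficient and the tail of a lower bound on the eliminated variable, while
  \<open>a'\<close> is a complete constraint. The positive multipliers \<open>- h'\<close> and
  \<open>h\<close> cancel that variable, and the resolvent is strict as soon as one parent
  is.\<close>

definition combine :: "real \<Rightarrow> constr \<Rightarrow> constr \<Rightarrow> constr list" where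
  "combine h a a' = (case snd a' of [] \<Rightarrow> [] | h' # t' \<Rightarrow>
     if h' < 0 then [(fst a \<or> fst a', map (\<lambda>p. h * snd p - h' * fst p) (zip (snd a) t'))] else [])"

definition eliminate :: "constr list \<Rightarrow> constr list" where
  "eliminate A = concat (map (\<lambda>a. case snd a of [] \<Rightarrow> [] | h # t \<Rightarrow>
     if 0 < h then concat (map (\<lambda>a'. combine h (fst a, t) a') A)
     else if h < 0 then [] else [(fst a, t)]) A)"

text \<open>Adds the cone of all \<open>\<Sum>j. w j *\<^sub>R G ! j\<close> with \<open>w\<close> subject to \<open>B\<close> to the cone \<open>A\<close>: the
  coefficients \<open>w\<close> are prepended as new coordinates and then eliminated.\<close>

definition add_generators :: "real list list \<Rightarrow> constr list \<Rightarrow> real list \<Rightarrow> constr list \<Rightarrow> constr list" where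
  "add_generators G B z A = fold (\<lambda>_ C. eliminate C) G
     (map (\<lambda>a. (fst a, map (\<lambda>g. - dot (snd a) g) G @ snd a)) A @ map (\<lambda>b. (fst b, snd b @ z)) B)"

text \<open>The rows of the identity matrix of size \<open>length l\<close>; the list serves as a
  counter.\<close>

definition units :: "real list \<Rightarrow> real list list" where
  "units l = foldr (\<lambda>_ us. (1 # map (\<lambda>_. 0) us) # map (\<lambda>u. 0 # u) us) l []"

abbreviation "enc_vecs \<equiv> lst (lst Num)"
abbreviation "enc_constr \<equiv> enc_pair of_bool_data (lst Num)"
abbreviation "enc_constrs \<equiv> lst enc_constr"

lemma comp_dot [computes]:
  assumes "computable e (lst Num) f" "computable e (lst Num) g"
  shows "computable e Num (\<lambda>x. dot (f x) (g x))"
  unfolding dot_def by (rule assms computes)+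

lemma comp_neg [computes]:
  assumes "computable e (lst Num) f"
  shows "computable e (lst Num) (\<lambda>x. neg (f x))"
  unfolding neg_def by (rule assms computes)+

lemma comp_units [computes]:
  assumes "computable e (lst Num) f"
  shows "computable e enc_vecs (\<lambda>x. units (f x))"
  unfolding units_def by (rule assms computes)+

text \<open>The arguments occur below bound variables of the body, where the environment is larger
  than \<open>e\<close>. Compiling the function on tuples and composing afterwards avoids moving the
  programs of the arguments there. The same pattern recurs below.\<close>

lemma comp_combine [computes]:
  assumes "computable e Num f" "computable e enc_constr g" "computable e enc_constr h"
  shows "computable e enc_constrs (\<lambda>x. combine (f x) (g x) (h x))"
proof -
  have "computable (enc_pair (enc_pair Num enc_constr) enc_constr) enc_constrs (\<lambda>z. combine (fst (fst z)) (snd (fst z)) (snd z))"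
    unfolding combine_def by (rule computes)+
  from comp_trans[OF comp_pair[OF comp_pair[OF assms(1,2)] assms(3)] this] show ?thesis by simp
qed

lemma comp_eliminate [computes]:
  assumes "computable e enc_constrs f"
  shows "computable e enc_constrs (\<lambda>x. eliminate (f x))"
proof -
  have "computable enc_constrs enc_constrs (\<lambda>z. eliminate z)"
    unfolding eliminate_def by (rule computes)+
  from comp_trans[OF assms this] show ?thesis .
qed

lemma comp_add_generators [computes]:
  assumes "computable e enc_vecs g" "computable e enc_constrs b" "computable e (lst Num) z" "computable e enc_constrs a"
  shows "computable e enc_constrs (\<lambda>x. add_generators (g x) (b x) (z x) (a x))"
proof -
  have "computable (enc_pair (enc_pair enc_vecs enc_constrs) (enc_pair (lst Num) enc_constrs)) enc_constrs
    (\<lambda>z. add_generators (fst (fst z)) (snd (fst z)) (fst (snd z)) (snd (snd z)))"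
    unfolding add_generators_def by (rule computes)+
  from comp_trans[OF comp_pair[OF comp_pair[OF assms(1,2)] comp_pair[OF assms(3,4)]] this] show ?thesis by simp
qed

section \<open>Disjunctive normal form by a worklist\<close>

type_synonym branch = "(bool \<times> real list qf) list \<times> constr list"

text \<open>A branch consists of the signed formulas still to be decomposed and of the constraints
  collected so far. The constraints refer to the vector \<open>1 # y\<close>, where \<open>y\<close> is the point
  at which the formula is evaluated.\<close>

definition dnf_step :: "branch list \<times> constr list list \<Rightarrow> branch list \<times> constr list list" where
  "dnf_step s = (case fst s of [] \<Rightarrow> s | br # w \<Rightarrow> (case fst br of [] \<Rightarrow> (w, snd br # snd s) | it # todo \<Rightarrow>
     (case snd it of
        EqAt a c \<Rightarrow> if fst it then ((todo, (False, c # neg a) # (False, - c # a) # snd br) # w, snd s)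
           else ((todo, (True, c # neg a) # snd br) # (todo, (True, - c # a) # snd br) # w, snd s)
      | LeAt a c \<Rightarrow> ((todo, (if fst it then (False, c # neg a) else (True, - c # a)) # snd br) # w, snd s)
      | LessAt a c \<Rightarrow> ((todo, (if fst it then (True, c # neg a) else (False, - c # a)) # snd br) # w, snd s)
      | NotF F \<Rightarrow> (((\<not> fst it, F) # todo, snd br) # w, snd s)
      | AndF F G \<Rightarrow> if fst it then (((True, F) # (True, G) # todo, snd br) # w, snd s)
           else (((False, F) # todo, snd br) # ((False, G) # todo, snd br) # w, snd s)
      | OrF F G \<Rightarrow> if fst it then (((True, F) # todo, snd br) # ((True, G) # todo, snd br) # w, snd s)
           else (((False, F) # (False, G) # todo, snd br) # w, snd s))))"

definition dnf :: "real list qf \<Rightarrow> constr list list" where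
  "dnf F = snd (while (\<lambda>s. case fst s of [] \<Rightarrow> False | _ # _ \<Rightarrow> True) dnf_step ([([(True, F)], [])], []))"

text \<open>Base 3 makes every step decrease. Up to a common factor, a junctor of weight
  \<open>3 ^ (m + n + 1)\<close> is replaced by \<open>3 ^ m + 3 ^ n\<close> or by
  \<open>3 ^ (m + n)\<close>, and a negated equation splits into two branches, each lighter by a
  factor 3. A finished branch still weighs 1 as long as it waits in the worklist.\<close>

definition qf_weight :: "(bool \<times> real list qf) list \<times> constr list \<Rightarrow> nat" where
  "qf_weight br = 3 ^ (\<Sum>it\<leftarrow>fst br. size (snd it))"

lemma dnf_step_less:
  assumes "case fst s of [] \<Rightarrow> False | _ # _ \<Rightarrow> True"
  shows "(\<Sum>br\<leftarrow>fst (dnf_step s). qf_weight br) < (\<Sum>br\<leftarrow>fst s. qf_weight br)"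
proof -
  have *: "(3::nat) ^ m + 3 ^ n < 3 ^ Suc (m + n)" for m n
  proof -
    have "(3::nat) ^ m * 1 \<le> 3 ^ m * 3 ^ n" "1 * (3::nat) ^ n \<le> 3 ^ m * 3 ^ n" "(0::nat) < 3 ^ m * 3 ^ n" by (auto intro!: mult_le_mono)
    then show ?thesis unfolding power_Suc power_add by linarith
  qed
  have **: "(3::nat) ^ a * 3 ^ b + 3 ^ c * 3 ^ b < 3 * (3 ^ a * (3 ^ c * 3 ^ b))" for a b c
  proof -
    have "(3::nat) ^ a * 3 ^ b + 3 ^ c * 3 ^ b = (3 ^ a + 3 ^ c) * 3 ^ b" by (simp add: algebra_simps)
    also have "\<dots> < 3 ^ Suc (a + c) * 3 ^ b" using *[of a c] by (intro mult_strict_right_mono) auto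
    finally show ?thesis by (simp add: power_add mult.assoc)
  qed
  obtain br w where s: "fst s = br # w" using assms by (auto split: list.splits)
  show ?thesis
  proof (cases "fst br")
    case Nil
    then show ?thesis using s by (simp add: dnf_step_def qf_weight_def)
  next
    case (Cons it todo)
    then show ?thesis using s
      by (cases "snd it") (auto simp: dnf_step_def qf_weight_def power_add mult.assoc **)
  qed
qed

lemma comp_dnf_step:
  "computable (enc_pair (lst (enc_pair (lst (enc_pair of_bool_data enc_lqf)) enc_constrs)) (lst enc_constrs))
     (enc_pair (lst (enc_pair (lst (enc_pair of_bool_data enc_lqf)) enc_constrs)) (lst enc_constrs)) (\<lambda>s. dnf_step s)"
  unfolding dnf_step_def by (rule computes)+

lemma comp_dnf [computes]:
  assumes "computable e enc_lqf F"
  shows "computable e (lst enc_constrs) (\<lambda>x. dnf (F x))"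
proof -
  let ?e = "enc_pair (lst (enc_pair (lst (enc_pair of_bool_data enc_lqf)) enc_constrs)) (lst enc_constrs)"
  have 1: "computable ?e of_bool_data (\<lambda>s. case fst s of [] \<Rightarrow> False | _ # _ \<Rightarrow> True)"
    by (rule computes)+
  have 2: "computable e ?e (\<lambda>x. ([([(True, F x)], [])], []))"
    by (rule assms computes)+
  show ?thesis unfolding dnf_def
    by (rule comp_snd[OF comp_while[OF 1 comp_dnf_step, where m = "\<lambda>s. \<Sum>br\<leftarrow>fst s. qf_weight br", OF dnf_step_less 2]])
qed

section \<open>The solver on lists\<close>

type_synonym list_production = "(real list \<times> real list list) \<times> (real list list \<times> constr list)"

text \<open>The coordinates of a flow are the balances at the variables and at the parameters, followed
  by the coordinates of its value in the vector space. A production \<open>((k, M), (G, B))\<close>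
  requires the symbols occurring in \<open>M\<close>, records the unit vector \<open>k\<close> of its target symbol in the list
  \<open>U\<close> of produced symbols, and contributes the cone given by \<open>G\<close> and \<open>B\<close>.\<close>

definition mono_prod :: "real list \<Rightarrow> real list \<Rightarrow> real list list \<Rightarrow> list_production" where
  "mono_prod z k M = ((k, M), (map (\<lambda>E. map (\<lambda>p. fst p - snd p) (zip (E @ z) k)) M,
     map (\<lambda>u. (True, u)) (units (map (\<lambda>_. 0) M))))"

definition cell_prod :: "real list \<Rightarrow> real list list \<Rightarrow> real list \<Rightarrow> constr list \<Rightarrow> list_production" where
  "cell_prod z V p c = ((p, []), (neg p # V, (True, 1 # z) # c))"

text \<open>The unit vectors \<open>E\<close> are listed in the order variables, parameters,
  coordinates of the space, so the two uses of \<open>drop\<close> reach the vectors of the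
  parameters and of the space. Each branch of a normal form becomes a production of its own.\<close>

definition prods :: "real list \<Rightarrow> real list list list list \<Rightarrow> real list qf list \<Rightarrow> real list list \<Rightarrow> list_production list" where
  "prods z S Fs E = concat (map (\<lambda>p. map (\<lambda>M. mono_prod z (snd p) M) (fst p)) (zip S E)) @
     concat (map (\<lambda>p. map (\<lambda>c. cell_prod z (drop (length Fs) (drop (length S) E)) (snd p) c) (dnf (fst p)))
       (zip Fs (drop (length S) E)))"

definition enabled :: "real list \<Rightarrow> real list list \<Rightarrow> bool" where
  "enabled U M = list_all (\<lambda>E. list_all (\<lambda>p. 0 < fst p \<longrightarrow> 0 < snd p) (zip E U)) M"

text \<open>Old states are kept, so \<open>n\<close> rounds yield all sequences of at most
  \<open>n\<close> firings.\<close>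

definition extend :: "real list \<Rightarrow> list_production list \<Rightarrow> (real list \<times> constr list) list \<Rightarrow> (real list \<times> constr list) list" where
  "extend z Ps S = S @ concat (map (\<lambda>s. concat (map (\<lambda>p. if enabled (fst s) (snd (fst p))
     then [(map (\<lambda>q. fst q + snd q) (zip (fst s) (fst (fst p))), add_generators (fst (snd p)) (snd (snd p)) z (snd s))]
     else []) Ps)) S)"

text \<open>Substitutes the vector with balance \<open>- i\<close> and value \<open>x\<close> into
  the constraints and solves for the part that is linear in the coordinates of \<open>x\<close>. For
  a zero vector \<open>z\<close>, the formulas \<open>LeAt z 0\<close> and \<open>LessAt z 0\<close>
  are the constants true and false.\<close>

definition read_off :: "real list \<Rightarrow> real list list \<Rightarrow> real list \<Rightarrow> (real list \<times> constr list) list \<Rightarrow> real list qf" where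
  "read_off z V i S = foldr (\<lambda>s F. OrF (foldr (\<lambda>a G. AndF
     (if fst a then LessAt (map (\<lambda>u. - dot (snd a) u) V) (- dot (snd a) i)
      else LeAt (map (\<lambda>u. - dot (snd a) u) V) (- dot (snd a) i)) G) (snd s) (LeAt z 0)) F) S (LessAt z 0)"

text \<open>The initial constraints \<open>0 \<le> u\<close> and \<open>0 \<le> - u\<close> for all
  unit vectors describe the cone {0}. The fold over \<open>Ps\<close> only counts: there are as many
  rounds as productions, which suffices by \<open>flow_bound\<close>.\<close>

definition solve :: "real list \<Rightarrow> real list list list list \<Rightarrow> real list qf list \<Rightarrow> real list qf list" where
  "solve z S Fs = (let E = units (map (\<lambda>_. 0) S @ map (\<lambda>_. 0) Fs @ z); n = map (\<lambda>_. 0) E; Ps = prods z S Fs E;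
     T = fold (\<lambda>_ T. extend n Ps T) Ps [(n, concat (map (\<lambda>u. [(False, u), (False, neg u)]) E))] in
     map (\<lambda>p. read_off z (drop (length Fs) (drop (length S) E)) (snd p) T) (zip S E))"

abbreviation "enc_list_production \<equiv> enc_pair (enc_pair (lst Num) enc_vecs) (enc_pair enc_vecs enc_constrs)"
abbreviation "enc_states \<equiv> lst (enc_pair (lst Num) enc_constrs)"

lemma comp_mono_prod [computes]:
  assumes "computable e (lst Num) z" "computable e (lst Num) k" "computable e enc_vecs M"
  shows "computable e enc_list_production (\<lambda>x. mono_prod (z x) (k x) (M x))"
proof -
  have "computable (enc_pair (enc_pair (lst Num) (lst Num)) enc_vecs) enc_list_production (\<lambda>x. mono_prod (fst (fst x)) (snd (fst x)) (snd x))"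
    unfolding mono_prod_def by (rule computes)+
  from comp_trans[OF comp_pair[OF comp_pair[OF assms(1,2)] assms(3)] this] show ?thesis by simp
qed

lemma comp_cell_prod [computes]:
  assumes "computable e (lst Num) z" "computable e enc_vecs V" "computable e (lst Num) p" "computable e enc_constrs c"
  shows "computable e enc_list_production (\<lambda>x. cell_prod (z x) (V x) (p x) (c x))"
  unfolding cell_prod_def by (rule assms computes)+

lemma comp_prods [computes]:
  assumes "computable e (lst Num) z" "computable e (lst (lst enc_vecs)) S" "computable e (lst enc_lqf) Fs" "computable e enc_vecs E"
  shows "computable e (lst enc_list_production) (\<lambda>x. prods (z x) (S x) (Fs x) (E x))"
proof -
  have "computable (enc_pair (enc_pair (lst Num) (lst (lst enc_vecs))) (enc_pair (lst enc_lqf) enc_vecs)) (lst enc_list_production)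
    (\<lambda>x. prods (fst (fst x)) (snd (fst x)) (fst (snd x)) (snd (snd x)))"
    unfolding prods_def by (rule computes)+
  from comp_trans[OF comp_pair[OF comp_pair[OF assms(1,2)] comp_pair[OF assms(3,4)]] this] show ?thesis by simp
qed

lemma comp_enabled [computes]:
  assumes "computable e (lst Num) U" "computable e enc_vecs M"
  shows "computable e of_bool_data (\<lambda>x. enabled (U x) (M x))"
proof -
  have "computable (enc_pair (lst Num) enc_vecs) of_bool_data (\<lambda>x. enabled (fst x) (snd x))"
    unfolding enabled_def by (rule computes)+
  from comp_trans[OF comp_pair[OF assms] this] show ?thesis by simp
qed

lemma comp_extend [computes]:
  assumes "computable e (lst Num) z" "computable e (lst enc_list_production) Ps" "computable e enc_states S"
  shows "computable e enc_states (\<lambda>x. extend (z x) (Ps x) (S x))"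
proof -
  have "computable (enc_pair (enc_pair (lst Num) (lst enc_list_production)) enc_states) enc_states (\<lambda>x. extend (fst (fst x)) (snd (fst x)) (snd x))"
    unfolding extend_def by (rule computes)+
  from comp_trans[OF comp_pair[OF comp_pair[OF assms(1,2)] assms(3)] this] show ?thesis by simp
qed

lemma comp_read_off [computes]:
  assumes "computable e (lst Num) z" "computable e enc_vecs V" "computable e (lst Num) i" "computable e enc_states S"
  shows "computable e enc_lqf (\<lambda>x. read_off (z x) (V x) (i x) (S x))"
proof -
  have "computable (enc_pair (enc_pair (lst Num) enc_vecs) (enc_pair (lst Num) enc_states)) enc_lqf
    (\<lambda>x. read_off (fst (fst x)) (snd (fst x)) (fst (snd x)) (snd (snd x)))"
    unfolding read_off_def by (rule computes)+
  from comp_trans[OF comp_pair[OF comp_pair[OF assms(1,2)] comp_pair[OF assms(3,4)]] this] show ?thesis by simp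
qed

theorem comp_solve:
  "computable (enc_pair (lst (lst enc_vecs)) (lst enc_lqf)) (lst enc_lqf) (\<lambda>x. solve (replicate d 0) (fst x) (snd x))"
  unfolding solve_def by (rule comp_replicate computes)+

section \<open>Hemihedra and semi-linear sets\<close>

definition semilinear :: "'a::euclidean_space set \<Rightarrow> bool" where
  "semilinear A \<longleftrightarrow> (\<exists>F. described F = A)"

lemma semilinear_halfspace:
  "semilinear {x. a \<bullet> x \<le> c}" "semilinear {x. a \<bullet> x < c}" "semilinear {x. a \<bullet> x = c}"
  unfolding semilinear_def by (metis described.simps)+

lemma semilinear_Int: "semilinear A \<Longrightarrow> semilinear B \<Longrightarrow> semilinear (A \<inter> B)"
  and semilinear_Un: "semilinear A \<Longrightarrow> semilinear B \<Longrightarrow> semilinear (A \<union> B)"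
  unfolding semilinear_def by (metis described.simps)+

lemma semilinear_empty: "semilinear {}" and semilinear_UNIV: "semilinear UNIV"
  using semilinear_halfspace(2)[of 0 0] semilinear_halfspace(1)[of 0 0] by simp_all

lemma semilinear_INT: "finite K \<Longrightarrow> (\<And>k. k \<in> K \<Longrightarrow> semilinear (A k)) \<Longrightarrow> semilinear (\<Inter>k\<in>K. A k)"
  by (induction K rule: finite_induct) (auto intro: semilinear_Int semilinear_UNIV)

lemma semilinear_UN: "finite K \<Longrightarrow> (\<And>k. k \<in> K \<Longrightarrow> semilinear (A k)) \<Longrightarrow> semilinear (\<Union>k\<in>K. A k)"
  by (induction K rule: finite_induct) (auto intro: semilinear_Un semilinear_empty)

lemma semilinear_polyhedron: "polyhedron S \<Longrightarrow> semilinear S"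
proof -
  assume "polyhedron S"
  then obtain F where F: "finite F" "S = \<Inter>F" "\<forall>h\<in>F. \<exists>a b. a \<noteq> 0 \<and> h = {x. a \<bullet> x \<le> b}"
    unfolding polyhedron_def by blast
  then have "semilinear (\<Inter>h\<in>F. h)" by (intro semilinear_INT) (auto intro: semilinear_halfspace)
  then show ?thesis using F by simp
qed

text \<open>For an irredundant family of half-spaces, the relative interior is cut out of
  \<open>S\<close> by the strict versions of their inequalities.\<close>

lemma semilinear_rel_interior:
  assumes "polyhedron S"
  shows "semilinear (rel_interior S)"
proof -
  obtain F where F: "finite F" "S = affine hull S \<inter> \<Inter>F"
    "\<forall>h\<in>F. \<exists>a b. a \<noteq> 0 \<and> h = {x. a \<bullet> x \<le> b}"
    "\<forall>F'. F' \<subset> F \<longrightarrow> S \<subset> affine hull S \<inter> \<Inter>F'"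
    using assms unfolding polyhedron_Int_affine_minimal by meson
  then obtain a b where ab: "\<And>h. h \<in> F \<Longrightarrow> a h \<noteq> 0 \<and> h = {x. a h \<bullet> x \<le> b h}" by metis
  have "rel_interior S = {x \<in> S. \<forall>h\<in>F. a h \<bullet> x < b h}"
    using F ab by (intro rel_interior_polyhedron_explicit) auto
  also have "\<dots> = S \<inter> (\<Inter>h\<in>F. {x. a h \<bullet> x < b h})" by auto
  finally show ?thesis using F(1) semilinear_polyhedron[OF assms]
    by (auto intro!: semilinear_Int semilinear_INT semilinear_halfspace)
qed

lemma semilinear_hemihedra:
  assumes "finite_union_of_hemihedra A"
  shows "semilinear A"
proof -
  obtain \<H> where H: "finite \<H>" "\<forall>H\<in>\<H>. hemihedron H" "A = \<Union>\<H>"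
    using assms by (auto simp: finite_union_of_hemihedra_def)
  have "semilinear H" if mem: "H \<in> \<H>" for H
  proof -
    obtain \<Q> where "finite \<Q>" "\<forall>Q\<in>\<Q>. polytope Q" "H = (\<Union>Q\<in>\<Q>. rel_interior Q)"
      using bspec[OF H(2) mem] by (auto simp: hemihedron_def)
    then show ?thesis by (auto intro!: semilinear_UN semilinear_rel_interior polytope_imp_polyhedron)
  qed
  then have "semilinear (\<Union>H\<in>\<H>. H)" using H(1) by (intro semilinear_UN)
  then show ?thesis using H(3) by simp
qed

lemma bounded_hemihedra:
  assumes "finite_union_of_hemihedra A"
  shows "bounded A"
proof -
  have "bounded H" if H: "hemihedron H" for H :: "'a set"
  proof -
    obtain \<Q> where "finite \<Q>" "\<forall>Q\<in>\<Q>. polytope Q" "H = (\<Union>Q\<in>\<Q>. rel_interior Q)"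
      using H by (auto simp: hemihedron_def)
    then show ?thesis
      using polytope_imp_bounded bounded_subset rel_interior_subset by (auto intro!: bounded_UN) blast
  qed
  then show ?thesis using assms by (auto simp: finite_union_of_hemihedra_def intro!: bounded_Union)
qed

section \<open>Sign cells of affine forms\<close>

fun atoms :: "'a::euclidean_space qf \<Rightarrow> ('a \<times> real) set" where
  "atoms (EqAt a c) = {(a, c)}"
| "atoms (LeAt a c) = {(a, c)}"
| "atoms (LessAt a c) = {(a, c)}"
| "atoms (NotF F) = atoms F"
| "atoms (AndF F G) = atoms F \<union> atoms G"
| "atoms (OrF F G) = atoms F \<union> atoms G"

lemma finite_atoms: "finite (atoms F)"
  by (induction F) auto

lemma described_sgn_cong:
  "(\<And>a c. (a, c) \<in> atoms F \<Longrightarrow> sgn (a \<bullet> x - c) = sgn (a \<bullet> y - c)) \<Longrightarrow> x \<in> described F \<longleftrightarrow> y \<in> described F"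
proof (induction F)
  case (EqAt a c)
  then show ?case by (force simp: sgn_if split: if_splits)
next
  case (LeAt a c)
  then show ?case by (force simp: sgn_if split: if_splits)
next
  case (LessAt a c)
  then show ?case by (force simp: sgn_if split: if_splits)
qed auto

definition sign_cell :: "('a::euclidean_space \<times> real) set \<Rightarrow> 'a \<Rightarrow> 'a set" where
  "sign_cell K x = {y. \<forall>(a, c)\<in>K. sgn (a \<bullet> y - c) = sgn (a \<bullet> x - c)}"

text \<open>A cell is determined by its sign pattern, a map from \<open>K\<close> to {-1, 0,
  1}.\<close>

lemma finite_sign_cells:
  assumes "finite K"
  shows "finite (range (sign_cell K))"
proof -
  let ?s = "\<lambda>x. restrict (\<lambda>(a, c). sgn (a \<bullet> x - c)) K"
  have "sign_cell K x = {y. \<forall>(a, c)\<in>K. sgn (a \<bullet> y - c) = ?s x (a, c)}" for x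
    unfolding sign_cell_def by auto
  then have "range (sign_cell K) \<subseteq> (\<lambda>s. {y. \<forall>(a, c)\<in>K. sgn (a \<bullet> y - c) = s (a, c)}) ` (K \<rightarrow>\<^sub>E {-1, 0, 1})"
  proof (intro image_subsetI image_eqI[where x = "?s _"])
    fix x show "?s x \<in> K \<rightarrow>\<^sub>E {-1, 0, 1}"
      by (rule restrict_PiE_iff[THEN iffD2]) (auto simp: sgn_real_def split: if_splits)
  qed
  then show ?thesis by (rule finite_subset) (intro finite_imageI finite_PiE assms, auto)
qed

text \<open>A cell is an affine subspace \<open>L\<close> cut by finitely many open half-spaces,
  hence convex and relatively open. Weakening the strict inequalities gives a polyhedron
  \<open>B\<close>. It is the closure, because a segment from \<open>x\<close> to a point of
  \<open>B\<close> stays in the cell except possibly at its far end.\<close>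

lemma sign_cell_polytope:
  assumes K: "finite K" and bd: "bounded (sign_cell K x)"
  shows "polytope (closure (sign_cell K x))" "rel_interior (closure (sign_cell K x)) = sign_cell K x"
proof -
  let ?C = "sign_cell K x"
  define s where "s = (\<lambda>(a, c). sgn (a \<bullet> x - c))"
  define L where "L = (\<Inter>(a, c)\<in>{k\<in>K. s k = 0}. {y. a \<bullet> y = c})"
  define Q where "Q = (\<Inter>(a, c)\<in>{k\<in>K. s k \<noteq> 0}. {y. 0 < s (a, c) * (a \<bullet> y - c)})"
  have sgn_eq: "sgn r = s k \<longleftrightarrow> (if s k = 0 then r = 0 else 0 < s k * r)" for r :: real and k
    by (auto simp: s_def sgn_if zero_less_mult_iff split: prod.splits if_splits)
  have C: "?C = L \<inter> Q"
    unfolding sign_cell_def L_def Q_def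
    using sgn_eq by (fastforce simp: s_def)
  have x: "x \<in> ?C" by (simp add: sign_cell_def)
  have aff: "affine L" unfolding L_def by (intro affine_Inter) (auto simp: affine_hyperplane)
  have opQ: "open Q" unfolding Q_def using K by (intro open_INT) (auto intro!: open_Collect_less continuous_intros)
  have "affine hull ?C = affine hull L" using x aff opQ unfolding C by (intro affine_hull_affine_Int_open) auto
  then have hull: "affine hull ?C = L" using aff by (simp add: affine_hull_eq)
  have "openin (top_of_set L) ?C" unfolding C using opQ by (auto simp: openin_open)
  then have ri: "rel_interior ?C = ?C" using hull by (intro rel_interior_openin) simp
  have "convex {y. 0 < t * (a \<bullet> y - c)}" for a :: 'a and t c :: real
  proof -
    have "{y. 0 < t * (a \<bullet> y - c)} = {y. (t *\<^sub>R a) \<bullet> y > t * c}" by (auto simp: algebra_simps)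
    then show ?thesis by (simp only: convex_halfspace_gt)
  qed
  then have "convex Q" unfolding Q_def by (intro convex_INT) auto
  then have cvx: "convex ?C" unfolding C using aff \<open>convex Q\<close> by (intro convex_Int) (rule affine_imp_convex)
  then show "rel_interior (closure ?C) = ?C" using convex_rel_interior_closure[OF cvx] ri by simp
  define B where "B = L \<inter> (\<Inter>(a, c)\<in>{k\<in>K. s k \<noteq> 0}. {y. 0 \<le> s (a, c) * (a \<bullet> y - c)})"
  have polyB: "polyhedron B"
  proof -
    have "polyhedron {y. 0 \<le> t * (a \<bullet> y - c)}" for a :: 'a and t c :: real
    proof -
      have "{y. 0 \<le> t * (a \<bullet> y - c)} = {y. (t *\<^sub>R a) \<bullet> y \<ge> t * c}" by (auto simp: algebra_simps)
      then show ?thesis by (simp only: polyhedron_halfspace_ge)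
    qed
    then show ?thesis unfolding B_def L_def using K
      by (intro polyhedron_Int polyhedron_Inter) (auto simp: polyhedron_hyperplane)
  qed
  have seg: "(1 - t) *\<^sub>R y + t *\<^sub>R x \<in> ?C" if y: "y \<in> B" and t: "0 < t" "t \<le> 1" for y t
  proof -
    have xL: "x \<in> L" and xQ: "x \<in> Q" using x C by auto
    have "(1 - t) *\<^sub>R y + t *\<^sub>R x \<in> L" using aff xL y unfolding B_def affine_def by auto
    moreover have "(1 - t) *\<^sub>R y + t *\<^sub>R x \<in> Q"
      unfolding Q_def
    proof (clarify, goal_cases)
      case (1 a c)
      have "0 \<le> (1 - t) * (s (a, c) * (a \<bullet> y - c))" using y t 1 unfolding B_def by (intro mult_nonneg_nonneg[of "1 - t"]) auto
      moreover have "0 < t * (s (a, c) * (a \<bullet> x - c))" using xQ t 1 unfolding Q_def by (intro mult_pos_pos[of t]) auto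
      ultimately have "0 < (1 - t) * (s (a, c) * (a \<bullet> y - c)) + t * (s (a, c) * (a \<bullet> x - c))" by linarith
      also have "\<dots> = s (a, c) * (a \<bullet> ((1 - t) *\<^sub>R y + t *\<^sub>R x) - c)" by (simp add: algebra_simps inner_add_right)
      finally show ?case .
    qed
    ultimately show ?thesis unfolding C by simp
  qed
  have "B \<subseteq> closure ?C"
  proof
    fix y assume y: "y \<in> B"
    have "((\<lambda>t. (1 - t) *\<^sub>R y + t *\<^sub>R x) \<longlongrightarrow> (1 - 0) *\<^sub>R y + 0 *\<^sub>R x) (at_right 0)"
      by (intro tendsto_intros)
    moreover have "\<forall>\<^sub>F t in at_right 0. (1 - t) *\<^sub>R y + t *\<^sub>R x \<in> ?C"
      by (rule eventually_mono[OF eventually_at_right_real[of 0 "1::real"]]) (auto intro: seg[OF y])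
    ultimately show "y \<in> closure ?C"
      by (intro Lim_in_closed_set[of "closure ?C" "\<lambda>t. (1 - t) *\<^sub>R y + t *\<^sub>R x" "at_right 0"])
        (auto elim!: eventually_mono intro: closure_subset[THEN subsetD])
  qed
  moreover have "closure ?C \<subseteq> B"
  proof (rule closure_minimal)
    show "?C \<subseteq> B" unfolding C B_def Q_def by (auto intro: less_imp_le)
    show "closed B" using polyB by (rule polyhedron_imp_closed)
  qed
  ultimately have "closure ?C = B" by blast
  then show "polytope (closure ?C)" using polyB bounded_closure[OF bd] by (simp add: polytope_eq_bounded_polyhedron)
qed

text \<open>A cell meeting \<open>A\<close> lies in \<open>A\<close> and is therefore bounded, so
  its closure is a polytope with the cell as relative interior.\<close>

lemma hemihedron_of_semilinear:
  assumes "convex A" "bounded A" "semilinear A"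
  shows "hemihedron A"
proof -
  obtain F where F: "described F = A" using assms(3) by (auto simp: semilinear_def)
  let ?c = "sign_cell (atoms F)"
  have sub: "?c x \<subseteq> A" if "x \<in> A" for x
  proof
    fix y assume "y \<in> ?c x"
    then have "x \<in> described F \<longleftrightarrow> y \<in> described F"
      by (intro described_sgn_cong) (force simp: sign_cell_def)
    then show "y \<in> A" using that F by simp
  qed
  have bd: "bounded (?c x)" if "x \<in> A" for x using sub[OF that] assms(2) by (rule bounded_subset[rotated])
  have "A = (\<Union>x\<in>A. ?c x)" using sub by (force simp: sign_cell_def)
  also have "\<dots> = (\<Union>x\<in>A. rel_interior (closure (?c x)))"
    using sign_cell_polytope(2)[OF finite_atoms bd] by simp
  also have "\<dots> = (\<Union>Q\<in>(\<lambda>x. closure (?c x)) ` A. rel_interior Q)" by simp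
  finally have "A = \<dots>" .
  moreover have "finite ((\<lambda>x. closure (?c x)) ` A)"
  proof -
    have "(\<lambda>x. closure (?c x)) ` A \<subseteq> closure ` range ?c" by auto
    then show ?thesis using finite_sign_cells[OF finite_atoms] by (meson finite_imageI finite_subset)
  qed
  moreover have "\<forall>Q\<in>(\<lambda>x. closure (?c x)) ` A. polytope Q"
    using sign_cell_polytope(1)[OF finite_atoms bd] by simp
  ultimately show ?thesis using assms(1) unfolding hemihedron_def by blast
qed

section \<open>Flows and the smallest solution\<close>

lemma join_list_iff:
  assumes "distinct M" "M \<noteq> []"
  shows "x \<in> join_list (map f M) \<longleftrightarrow>
    (\<exists>\<mu> e. (\<forall>E\<in>set M. 0 < \<mu> E \<and> e E \<in> f E) \<and> sum \<mu> (set M) = 1 \<and> x = (\<Sum>E\<in>set M. \<mu> E *\<^sub>R e E))"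
  using assms
proof (induction M arbitrary: x)
  case (Cons F M)
  let ?ex = "\<exists>\<mu> e. (\<forall>E\<in>set (F # M). 0 < \<mu> E \<and> e E \<in> f E) \<and> sum \<mu> (set (F # M)) = 1 \<and> x = (\<Sum>E\<in>set (F # M). \<mu> E *\<^sub>R e E)"
  show ?case
  proof (cases "M = []")
    case True
    show ?thesis
    proof
      assume "x \<in> join_list (map f (F # M))"
      with True show ?ex
        by (intro exI[of _ "\<lambda>_. 1"] exI[of _ "\<lambda>_. x"]) auto
    qed (use True in auto)
  next
    case False
    have F: "F \<notin> set M" and M: "distinct M" using Cons.prems by auto
    note IH = Cons.IH[OF M False]
    have eq: "join_list (map f (F # M)) = pos_join (f F) (join_list (map f M))"
      using False by (simp add: join_list_Cons)
    show ?thesis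
    proof
      assume "x \<in> join_list (map f (F # M))"
      then obtain l a b where l: "0 < l" "l < 1" "a \<in> f F" "b \<in> join_list (map f M)"
        and x: "x = l *\<^sub>R a + (1 - l) *\<^sub>R b"
        unfolding eq pos_join_def by auto
      from l(4) IH obtain \<mu> e where me: "\<forall>E\<in>set M. 0 < \<mu> E \<and> e E \<in> f E" "sum \<mu> (set M) = 1"
        "b = (\<Sum>E\<in>set M. \<mu> E *\<^sub>R e E)" by auto
      define \<mu>' where "\<mu>' E = (if E = F then l else (1 - l) * \<mu> E)" for E
      define e' where "e' E = (if E = F then a else e E)" for E
      have s1: "sum \<mu>' (set M) = (1 - l) * sum \<mu> (set M)"
        unfolding sum_distrib_left using F by (intro sum.cong) (auto simp: \<mu>'_def)
      have s2: "(\<Sum>E\<in>set M. \<mu>' E *\<^sub>R e' E) = (1 - l) *\<^sub>R b"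
        unfolding me(3) scaleR_sum_right using F by (intro sum.cong) (auto simp: \<mu>'_def e'_def)
      show ?ex
        using l me F s1 s2 x
        by (intro exI[of _ \<mu>'] exI[of _ e']) (auto simp: \<mu>'_def e'_def)
    next
      assume ?ex
      then obtain \<mu> e where me: "\<forall>E\<in>set (F # M). 0 < \<mu> E \<and> e E \<in> f E"
        "\<mu> F + sum \<mu> (set M) = 1" "x = \<mu> F *\<^sub>R e F + (\<Sum>E\<in>set M. \<mu> E *\<^sub>R e E)"
        using F by auto
      \<comment> \<open>The tail is normalised by its total weight, which is positive because the
        tail is nonempty.\<close>
      define s where "s = sum \<mu> (set M)"
      have s: "s > 0" unfolding s_def using me(1) False by (intro sum_pos) auto
      define b where "b = (\<Sum>E\<in>set M. (\<mu> E / s) *\<^sub>R e E)"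
      have sb: "s *\<^sub>R b = (\<Sum>E\<in>set M. \<mu> E *\<^sub>R e E)"
        unfolding b_def scaleR_sum_right using s by (intro sum.cong) auto
      have "(\<Sum>E\<in>set M. \<mu> E / s) = 1"
        using s by (simp flip: sum_divide_distrib add: s_def)
      then have "b \<in> join_list (map f M)"
        unfolding IH b_def using me(1) s by (intro exI[of _ "\<lambda>E. \<mu> E / s"] exI[of _ e]) auto
      moreover have "x = \<mu> F *\<^sub>R e F + (1 - \<mu> F) *\<^sub>R b"
        using me sb by (simp add: s_def algebra_simps flip: eq_diff_eq)
      moreover have "0 < \<mu> F" "\<mu> F < 1" "e F \<in> f F" using me s by (auto simp: s_def)
      ultimately show "x \<in> join_list (map f (F # M))"
        unfolding eq pos_join_def by blast
    qed
  qed
qed simp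

definition val :: "'s set \<Rightarrow> ('s \<Rightarrow> 'a set) \<Rightarrow> ('s \<Rightarrow> 'a set) \<Rightarrow> 's \<Rightarrow> 'a set" where
  "val \<Omega>v X P \<sigma> = (if \<sigma> \<in> \<Omega>v then X \<sigma> else P \<sigma>)"

text \<open>Symbols of coefficient zero put no condition on \<open>y\<close>: their values may be
  empty without emptying the Minkowski sum.\<close>

lemma eval_cl_iff:
  assumes "alphabet \<Omega>v \<Omega>p" "E \<in> CL \<Omega>v \<Omega>p"
  shows "x \<in> eval_cl \<Omega>v \<Omega>p X P E \<longleftrightarrow>
    (\<exists>y. (\<forall>\<sigma>\<in>\<Omega>v \<union> \<Omega>p. 0 < E \<sigma> \<longrightarrow> y \<sigma> \<in> val \<Omega>v X P \<sigma>) \<and> x = (\<Sum>\<sigma>\<in>\<Omega>v \<union> \<Omega>p. E \<sigma> *\<^sub>R y \<sigma>))"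
    (is "_ \<longleftrightarrow> ?r")
proof -
  let ?\<Omega> = "\<Omega>v \<union> \<Omega>p"
  let ?S = "{\<sigma>\<in>?\<Omega>. 0 < E \<sigma>}"
  have fin: "finite \<Omega>v" "finite \<Omega>p" "\<Omega>v \<inter> \<Omega>p = {}" using assms by (auto simp: alphabet_def)
  have E0: "E \<sigma> = 0" if "\<sigma> \<in> ?\<Omega> - ?S" for \<sigma> using assms(2) that by (auto simp: CL_def order.order_iff_strict)
  have S: "?S = {\<sigma>\<in>\<Omega>v. E \<sigma> > 0} \<union> {\<sigma>\<in>\<Omega>p. E \<sigma> > 0}" by auto
  have "eval_cl \<Omega>v \<Omega>p X P E = (\<Sum>\<sigma>\<in>?S. (*\<^sub>R) (E \<sigma>) ` val \<Omega>v X P \<sigma>)"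
    unfolding S using fin
    by (subst sum.union_disjoint)
       (auto simp: eval_cl_def val_def disjoint_iff split: if_splits intro!: arg_cong2[of _ _ _ _ "(+)"] sum.cong)
  also have "\<dots> = {sum s ?S |s. \<forall>i\<in>?S. s i \<in> (*\<^sub>R) (E i) ` val \<Omega>v X P i}"
    using fin by (intro set_sum_alt) auto
  finally have eq: "eval_cl \<Omega>v \<Omega>p X P E = \<dots>" .
  show ?thesis
  proof
    assume "x \<in> eval_cl \<Omega>v \<Omega>p X P E"
    then obtain s where s: "\<forall>i\<in>?S. s i \<in> (*\<^sub>R) (E i) ` val \<Omega>v X P i" "x = sum s ?S"
      unfolding eq by auto
    then obtain y where y: "\<And>i. i \<in> ?S \<Longrightarrow> s i = E i *\<^sub>R y i \<and> y i \<in> val \<Omega>v X P i"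
      unfolding image_iff by metis
    have "x = (\<Sum>\<sigma>\<in>?\<Omega>. E \<sigma> *\<^sub>R y \<sigma>)"
      unfolding s(2)
    proof (rule sum.mono_neutral_cong_left)
      show "\<forall>i\<in>?\<Omega> - ?S. E i *\<^sub>R y i = 0" using E0 by simp
    qed (use fin y in auto)
    then show ?r
      using y by (intro exI[of _ y]) auto
  next
    assume ?r
    then obtain y where y: "\<forall>\<sigma>\<in>?\<Omega>. 0 < E \<sigma> \<longrightarrow> y \<sigma> \<in> val \<Omega>v X P \<sigma>" "x = (\<Sum>\<sigma>\<in>?\<Omega>. E \<sigma> *\<^sub>R y \<sigma>)" by auto
    have "x = (\<Sum>\<sigma>\<in>?S. E \<sigma> *\<^sub>R y \<sigma>)"
      unfolding y(2) using fin E0 by (intro sum.mono_neutral_cong_right) auto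
    then show "x \<in> eval_cl \<Omega>v \<Omega>p X P E"
      unfolding eq using y(1) by blast
  qed
qed

text \<open>Each factor has its own family \<open>y E\<close>, since one symbol may contribute
  different points to different factors.\<close>

lemma eval_mono_iff:
  assumes "alphabet \<Omega>v \<Omega>p" "M \<in> monomials \<Omega>v \<Omega>p"
  shows "x \<in> eval_mono \<Omega>v \<Omega>p X P M \<longleftrightarrow>
    (\<exists>\<mu> y. (\<forall>E\<in>set M. 0 < \<mu> E \<and> (\<forall>\<sigma>\<in>\<Omega>v \<union> \<Omega>p. 0 < E \<sigma> \<longrightarrow> y E \<sigma> \<in> val \<Omega>v X P \<sigma>)) \<and>
      sum \<mu> (set M) = 1 \<and> x = (\<Sum>E\<in>set M. \<mu> E *\<^sub>R (\<Sum>\<sigma>\<in>\<Omega>v \<union> \<Omega>p. E \<sigma> *\<^sub>R y E \<sigma>)))"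
    (is "?l \<longleftrightarrow> ?r")
proof -
  have M: "distinct M" "M \<noteq> []" "set M \<subseteq> CL \<Omega>v \<Omega>p" using assms(2) by (auto simp: monomials_def)
  show ?thesis
  proof
    assume ?l
    then obtain \<mu> e where me: "\<forall>E\<in>set M. 0 < \<mu> E \<and> e E \<in> eval_cl \<Omega>v \<Omega>p X P E"
      "sum \<mu> (set M) = 1" "x = (\<Sum>E\<in>set M. \<mu> E *\<^sub>R e E)"
      unfolding eval_mono_def join_list_iff[OF M(1,2)] by auto
    have "\<forall>E\<in>set M. \<exists>y. (\<forall>\<sigma>\<in>\<Omega>v \<union> \<Omega>p. 0 < E \<sigma> \<longrightarrow> y \<sigma> \<in> val \<Omega>v X P \<sigma>) \<and> e E = (\<Sum>\<sigma>\<in>\<Omega>v \<union> \<Omega>p. E \<sigma> *\<^sub>R y \<sigma>)"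
      using me(1) M(3) eval_cl_iff[OF assms(1)] by blast
    then obtain y where y: "\<And>E. E \<in> set M \<Longrightarrow> (\<forall>\<sigma>\<in>\<Omega>v \<union> \<Omega>p. 0 < E \<sigma> \<longrightarrow> y E \<sigma> \<in> val \<Omega>v X P \<sigma>) \<and> e E = (\<Sum>\<sigma>\<in>\<Omega>v \<union> \<Omega>p. E \<sigma> *\<^sub>R y E \<sigma>)"
      by metis
    then show ?r using me by (intro exI[of _ \<mu>] exI[of _ y]) auto
  next
    assume ?r
    then obtain \<mu> y where my: "\<forall>E\<in>set M. 0 < \<mu> E \<and> (\<forall>\<sigma>\<in>\<Omega>v \<union> \<Omega>p. 0 < E \<sigma> \<longrightarrow> y E \<sigma> \<in> val \<Omega>v X P \<sigma>)"
      "sum \<mu> (set M) = 1" "x = (\<Sum>E\<in>set M. \<mu> E *\<^sub>R (\<Sum>\<sigma>\<in>\<Omega>v \<union> \<Omega>p. E \<sigma> *\<^sub>R y E \<sigma>))" by auto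
    have "(\<Sum>\<sigma>\<in>\<Omega>v \<union> \<Omega>p. E \<sigma> *\<^sub>R y E \<sigma>) \<in> eval_cl \<Omega>v \<Omega>p X P E" if "E \<in> set M" for E
      using that my(1) M(3) by (intro eval_cl_iff[OF assms(1), THEN iffD2] exI[of _ "y E"]) auto
    then show ?l
      unfolding eval_mono_def join_list_iff[OF M(1,2)] using my
      by (intro exI[of _ \<mu>] exI[of _ "\<lambda>E. \<Sum>\<sigma>\<in>\<Omega>v \<union> \<Omega>p. E \<sigma> *\<^sub>R y E \<sigma>"]) auto
  qed
qed

section \<open>Cones generated by rays of balance and value\<close>

definition \<delta> :: "'s \<Rightarrow> 's \<Rightarrow> real" where "\<delta> k \<sigma> = (if \<sigma> = k then 1 else 0)"

definition nonneg_cone :: "'s set \<Rightarrow> (('s \<Rightarrow> real) \<times> 'a::real_vector) set \<Rightarrow> ('s \<Rightarrow> real) \<Rightarrow> 'a \<Rightarrow> bool" where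
  "nonneg_cone \<Omega> R b x \<longleftrightarrow> (\<exists>r. (\<forall>v\<in>R. 0 \<le> r v) \<and> (\<forall>\<sigma>\<in>\<Omega>. b \<sigma> = (\<Sum>v\<in>R. r v * fst v \<sigma>)) \<and>
     x = (\<Sum>v\<in>R. r v *\<^sub>R snd v))"

text \<open>With all coefficients positive, \<open>R\<close> is exactly the support of the flow. The
  nonnegative variant above is the relaxation with support inside \<open>R\<close>.\<close>

definition pos_cone :: "'s set \<Rightarrow> (('s \<Rightarrow> real) \<times> 'a::real_vector) set \<Rightarrow> ('s \<Rightarrow> real) \<Rightarrow> 'a \<Rightarrow> bool" where
  "pos_cone \<Omega> R b x \<longleftrightarrow> (\<exists>r. (\<forall>v\<in>R. 0 < r v) \<and> (\<forall>\<sigma>\<in>\<Omega>. b \<sigma> = (\<Sum>v\<in>R. r v * fst v \<sigma>)) \<and>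
     x = (\<Sum>v\<in>R. r v *\<^sub>R snd v))"

lemma nonneg_coneE:
  assumes "nonneg_cone \<Omega> R b x"
  obtains r where "\<forall>v\<in>R. 0 \<le> r v" "\<forall>\<sigma>\<in>\<Omega>. b \<sigma> = (\<Sum>v\<in>R. r v * fst v \<sigma>)" "x = (\<Sum>v\<in>R. r v *\<^sub>R snd v)"
  using assms unfolding nonneg_cone_def by blast

lemma pos_coneE:
  assumes "pos_cone \<Omega> R b x"
  obtains r where "\<forall>v\<in>R. 0 < r v" "\<forall>\<sigma>\<in>\<Omega>. b \<sigma> = (\<Sum>v\<in>R. r v * fst v \<sigma>)" "x = (\<Sum>v\<in>R. r v *\<^sub>R snd v)"
  using assms unfolding pos_cone_def by blast

lemma nonneg_cone_add:
  assumes "nonneg_cone \<Omega> R b x" "nonneg_cone \<Omega> R c y" "\<And>\<sigma>. \<sigma> \<in> \<Omega> \<Longrightarrow> d \<sigma> = b \<sigma> + c \<sigma>"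
  shows "nonneg_cone \<Omega> R d (x + y)"
proof -
  obtain r where r: "\<forall>v\<in>R. 0 \<le> r v" "\<forall>\<sigma>\<in>\<Omega>. b \<sigma> = (\<Sum>v\<in>R. r v * fst v \<sigma>)" "x = (\<Sum>v\<in>R. r v *\<^sub>R snd v)"
    using assms(1) by (rule nonneg_coneE)
  obtain s where s: "\<forall>v\<in>R. 0 \<le> s v" "\<forall>\<sigma>\<in>\<Omega>. c \<sigma> = (\<Sum>v\<in>R. s v * fst v \<sigma>)" "y = (\<Sum>v\<in>R. s v *\<^sub>R snd v)"
    using assms(2) by (rule nonneg_coneE)
  from r s show ?thesis using assms(3) unfolding nonneg_cone_def
    by (intro exI[of _ "\<lambda>v. r v + s v"]) (auto simp: algebra_simps sum.distrib)
qed

lemma nonneg_cone_scale: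
  assumes "nonneg_cone \<Omega> R b x" "0 \<le> t" "\<And>\<sigma>. \<sigma> \<in> \<Omega> \<Longrightarrow> c \<sigma> = t * b \<sigma>"
  shows "nonneg_cone \<Omega> R c (t *\<^sub>R x)"
proof -
  obtain r where "\<forall>v\<in>R. 0 \<le> r v" "\<forall>\<sigma>\<in>\<Omega>. b \<sigma> = (\<Sum>v\<in>R. r v * fst v \<sigma>)" "x = (\<Sum>v\<in>R. r v *\<^sub>R snd v)"
    using assms(1) by (rule nonneg_coneE)
  then show ?thesis using assms(2,3) unfolding nonneg_cone_def
    by (intro exI[of _ "\<lambda>v. t * r v"]) (auto simp: algebra_simps sum_distrib_left scaleR_sum_right)
qed

lemma nonneg_cone_zero: "\<forall>\<sigma>\<in>\<Omega>. b \<sigma> = 0 \<Longrightarrow> nonneg_cone \<Omega> R b 0"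
  unfolding nonneg_cone_def by (intro exI[of _ "\<lambda>_. 0"]) auto

lemma nonneg_cone_ray:
  assumes "v \<in> R" "finite R" "\<And>\<sigma>. \<sigma> \<in> \<Omega> \<Longrightarrow> b \<sigma> = fst v \<sigma>"
  shows "nonneg_cone \<Omega> R b (snd v)"
  unfolding nonneg_cone_def using assms
  by (intro exI[of _ "\<lambda>w. if w = v then 1 else 0"]) (auto simp: if_distrib[of "\<lambda>x. x * _"] if_distrib[of "\<lambda>x. x *\<^sub>R _"] sum.delta cong: if_cong)

text \<open>The hypothesis on points speaks of positive \<open>t j\<close> only, because the points
  chosen at symbols of coefficient zero are arbitrary.\<close>

lemma nonneg_cone_sum:
  assumes "finite J" "\<And>j. j \<in> J \<Longrightarrow> 0 < t j \<Longrightarrow> nonneg_cone \<Omega> R (b j) (x j)" "\<And>j. j \<in> J \<Longrightarrow> 0 \<le> t j"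
    "\<And>\<sigma>. \<sigma> \<in> \<Omega> \<Longrightarrow> c \<sigma> = (\<Sum>j\<in>J. t j * b j \<sigma>)"
  shows "nonneg_cone \<Omega> R c (\<Sum>j\<in>J. t j *\<^sub>R x j)"
  using assms
proof (induction J arbitrary: c rule: finite_induct)
  case empty
  then show ?case by (auto intro: nonneg_cone_zero)
next
  case (insert j J)
  have 1: "nonneg_cone \<Omega> R (\<lambda>\<sigma>. \<Sum>j\<in>J. t j * b j \<sigma>) (\<Sum>j\<in>J. t j *\<^sub>R x j)"
    by (rule insert.IH) (use insert.prems in auto)
  have "nonneg_cone \<Omega> R (\<lambda>\<sigma>. t j * b j \<sigma>) (t j *\<^sub>R x j)"
  proof (cases "t j = 0")
    case True
    then show ?thesis by (auto intro: nonneg_cone_zero)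
  next
    case False
    then show ?thesis using insert.prems(1,2)[of j] by (intro nonneg_cone_scale) (auto simp: order.order_iff_strict)
  qed
  from nonneg_cone_add[OF this 1] show ?case using insert by auto
qed

lemma nonneg_cone_mono:
  assumes "nonneg_cone \<Omega> R b x" "R \<subseteq> R'" "finite R'"
  shows "nonneg_cone \<Omega> R' b x"
proof -
  obtain r where r: "\<forall>v\<in>R. 0 \<le> r v" "\<forall>\<sigma>\<in>\<Omega>. b \<sigma> = (\<Sum>v\<in>R. r v * fst v \<sigma>)" "x = (\<Sum>v\<in>R. r v *\<^sub>R snd v)"
    using assms(1) by (rule nonneg_coneE)
  let ?r = "\<lambda>v. if v \<in> R then r v else 0"
  have "(\<Sum>v\<in>R'. ?r v * fst v \<sigma>) = (\<Sum>v\<in>R. r v * fst v \<sigma>)" for \<sigma>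
    using assms by (intro sum.mono_neutral_cong_right) auto
  moreover have "(\<Sum>v\<in>R'. ?r v *\<^sub>R snd v) = (\<Sum>v\<in>R. r v *\<^sub>R snd v)"
    using assms by (intro sum.mono_neutral_cong_right) auto
  ultimately show ?thesis unfolding nonneg_cone_def using r by (intro exI[of _ ?r]) auto
qed

lemma pos_cone_add:
  assumes "pos_cone \<Omega> R b x" "pos_cone \<Omega> S c y" "\<And>\<sigma>. \<sigma> \<in> \<Omega> \<Longrightarrow> d \<sigma> = b \<sigma> + c \<sigma>" "finite R" "finite S"
  shows "pos_cone \<Omega> (R \<union> S) d (x + y)"
proof -
  obtain r where r: "\<forall>v\<in>R. 0 < r v" "\<forall>\<sigma>\<in>\<Omega>. b \<sigma> = (\<Sum>v\<in>R. r v * fst v \<sigma>)" "x = (\<Sum>v\<in>R. r v *\<^sub>R snd v)"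
    using assms(1) by (rule pos_coneE)
  obtain s where s: "\<forall>v\<in>S. 0 < s v" "\<forall>\<sigma>\<in>\<Omega>. c \<sigma> = (\<Sum>v\<in>S. s v * fst v \<sigma>)" "y = (\<Sum>v\<in>S. s v *\<^sub>R snd v)"
    using assms(2) by (rule pos_coneE)
  let ?r = "\<lambda>v. if v \<in> R then r v else 0" and ?s = "\<lambda>v. if v \<in> S then s v else 0"
  have "(\<Sum>v\<in>R \<union> S. ?r v * fst v \<sigma>) = (\<Sum>v\<in>R. r v * fst v \<sigma>)"
    "(\<Sum>v\<in>R \<union> S. ?s v * fst v \<sigma>) = (\<Sum>v\<in>S. s v * fst v \<sigma>)" for \<sigma>
    using assms by (auto intro!: sum.mono_neutral_cong_right)
  moreover have "(\<Sum>v\<in>R \<union> S. ?r v *\<^sub>R snd v) = (\<Sum>v\<in>R. r v *\<^sub>R snd v)"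
    "(\<Sum>v\<in>R \<union> S. ?s v *\<^sub>R snd v) = (\<Sum>v\<in>S. s v *\<^sub>R snd v)"
    using assms by (auto intro!: sum.mono_neutral_cong_right)
  moreover have "\<forall>v\<in>R \<union> S. 0 < ?r v + ?s v" using r(1) s(1) by (auto simp: add_pos_pos)
  ultimately show ?thesis unfolding pos_cone_def using r s assms(3)
    by (intro exI[of _ "\<lambda>v. ?r v + ?s v"]) (auto simp only: distrib_right scaleR_add_left sum.distrib)
qed

text \<open>Finitely many positive numbers leave room for a common positive factor. It measures how
  far \<open>x\<close> can be moved away from a point of \<open>D\<close> before a coefficient
  becomes negative.\<close>

lemma small_multiple:
  assumes "finite R" "\<And>v. v \<in> R \<Longrightarrow> 0 < (r v :: real)"
  obtains t where "0 < t" "\<And>v. v \<in> R \<Longrightarrow> t * s v \<le> r v"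
proof -
  have "\<exists>t>0. \<forall>v\<in>R. t * s v \<le> r v"
    using assms
  proof (induction R rule: finite_induct)
    case empty
    then show ?case by (auto intro: exI[of _ 1])
  next
    case (insert v R)
    then obtain t where t: "t > 0" "\<forall>v\<in>R. t * s v \<le> r v" by auto
    have rv: "0 < r v" and rR: "\<And>w. w \<in> R \<Longrightarrow> 0 < r w" using insert.prems by auto
    define u where "u = min t (r v / (\<bar>s v\<bar> + 1))"
    have u: "0 < u" "u \<le> t" "u \<le> r v / (\<bar>s v\<bar> + 1)" using t rv by (auto simp: u_def)
    have "u * s v \<le> u * (\<bar>s v\<bar> + 1)" using u by (intro mult_left_mono) auto
    also have "\<dots> \<le> r v / (\<bar>s v\<bar> + 1) * (\<bar>s v\<bar> + 1)" using u by (intro mult_right_mono) auto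
    also have "\<dots> = r v" by auto
    finally have 1: "u * s v \<le> r v" .
    have "u * s w \<le> r w" if "w \<in> R" for w
    proof (cases "0 \<le> s w")
      case True
      then have "u * s w \<le> t * s w" using u by (intro mult_right_mono) auto
      then show ?thesis using t(2) that by (meson order_trans)
    next
      case False
      then have "u * s w \<le> 0" using u(1) by (simp add: mult_nonneg_nonpos)
      then show ?thesis using rR[OF that] by simp
    qed
    with 1 u(1) show ?case by auto
  qed
  then show thesis using that by blast
qed

text \<open>Assumption \<open>dual\<close> gives, for each direction \<open>u\<close>, a dual solution \<open>h\<close> which certifies that no
  nonnegative combination of the rays leaves the half-space supporting \<open>D\<close>, so these combinations lie in the
  closure of \<open>D\<close>. By positivity of its coefficients, \<open>x\<close> can be prolonged within them.\<close>

lemma cone_point_mem: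
  fixes D :: "'a::euclidean_space set"
  assumes R: "finite R" "finite \<Omega>" "i \<in> \<Omega>"
    and x: "pos_cone \<Omega> R (\<lambda>\<sigma>. - \<delta> i \<sigma>) x"
    and D: "convex D" "D \<noteq> {}"
    and dual: "\<And>u. \<exists>h. (\<forall>v\<in>R. (\<Sum>\<sigma>\<in>\<Omega>. fst v \<sigma> * h \<sigma>) + u \<bullet> snd v \<le> 0) \<and>
               (\<forall>B. (\<forall>d\<in>D. u \<bullet> d \<le> B) \<longrightarrow> h i \<le> B)"
    and weak: "\<And>d. d \<in> D \<Longrightarrow> nonneg_cone \<Omega> R (\<lambda>\<sigma>. - \<delta> i \<sigma>) d"
  shows "x \<in> D"
proof -
  have clo: "y \<in> closure D" if "nonneg_cone \<Omega> R (\<lambda>\<sigma>. - \<delta> i \<sigma>) y" for y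
  proof (rule ccontr)
    assume "y \<notin> closure D"
    then obtain a b where ab: "a \<bullet> y < b" "\<forall>d\<in>closure D. b < a \<bullet> d"
      using separating_hyperplane_closed_point[of "closure D" y] D(1) by (auto simp: convex_closure)
    obtain r where r: "\<forall>v\<in>R. 0 \<le> r v" "\<forall>\<sigma>\<in>\<Omega>. - \<delta> i \<sigma> = (\<Sum>v\<in>R. r v * fst v \<sigma>)" "y = (\<Sum>v\<in>R. r v *\<^sub>R snd v)"
      using \<open>nonneg_cone \<Omega> R (\<lambda>\<sigma>. - \<delta> i \<sigma>) y\<close> by (rule nonneg_coneE)
    obtain h where h: "\<forall>v\<in>R. (\<Sum>\<sigma>\<in>\<Omega>. fst v \<sigma> * h \<sigma>) + (- a) \<bullet> snd v \<le> 0"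
      "\<And>B. (\<forall>d\<in>D. (- a) \<bullet> d \<le> B) \<Longrightarrow> h i \<le> B" using dual[of "- a"] by auto
    have "h i \<le> - b" using ab(2) closure_subset[of D] by (intro h(2)) force
    \<comment> \<open>Weak duality: the dual inequalities, weighted by \<open>r\<close>, are added
      up; after exchanging the sums, the balance condition reduces the potential terms to
      \<open>- h i\<close>.\<close>
    have "(\<Sum>v\<in>R. r v * ((\<Sum>\<sigma>\<in>\<Omega>. fst v \<sigma> * h \<sigma>) + (- a) \<bullet> snd v)) \<le> 0"
      using r(1) h(1) by (intro sum_nonpos) (auto simp: mult_nonneg_nonpos)
    also have "(\<Sum>v\<in>R. r v * ((\<Sum>\<sigma>\<in>\<Omega>. fst v \<sigma> * h \<sigma>) + (- a) \<bullet> snd v))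
       = (\<Sum>v\<in>R. \<Sum>\<sigma>\<in>\<Omega>. r v * fst v \<sigma> * h \<sigma>) + (- a) \<bullet> y"
      unfolding r(3) inner_sum_right
      by (simp add: algebra_simps sum.distrib sum_distrib_left sum_subtractf sum_negf)
    also have "(\<Sum>v\<in>R. \<Sum>\<sigma>\<in>\<Omega>. r v * fst v \<sigma> * h \<sigma>) = (\<Sum>\<sigma>\<in>\<Omega>. (\<Sum>v\<in>R. r v * fst v \<sigma>) * h \<sigma>)"
      by (subst sum.swap) (simp add: sum_distrib_right)
    also have "\<dots> = (\<Sum>\<sigma>\<in>\<Omega>. - \<delta> i \<sigma> * h \<sigma>)" using r(2) by (intro sum.cong) auto
    also have "\<dots> = (\<Sum>\<sigma>\<in>\<Omega>. if \<sigma> = i then - h i else 0)" by (intro sum.cong) (auto simp: \<delta>_def)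
    also have "\<dots> = - h i" using R by simp
    finally show False using \<open>h i \<le> - b\<close> ab(1) by simp
  qed
  obtain r where r: "\<forall>v\<in>R. 0 < r v" "\<forall>\<sigma>\<in>\<Omega>. - \<delta> i \<sigma> = (\<Sum>v\<in>R. r v * fst v \<sigma>)" "x = (\<Sum>v\<in>R. r v *\<^sub>R snd v)"
    using x by (rule pos_coneE)
  have ext: "\<exists>e>1. (1 - e) *\<^sub>R d + e *\<^sub>R x \<in> closure D"
    if cl: "d \<in> D" for d
  proof -
    obtain s where s: "\<forall>v\<in>R. 0 \<le> s v" "\<forall>\<sigma>\<in>\<Omega>. - \<delta> i \<sigma> = (\<Sum>v\<in>R. s v * fst v \<sigma>)" "d = (\<Sum>v\<in>R. s v *\<^sub>R snd v)"
      using weak[OF cl] by (rule nonneg_coneE)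
    obtain t where t: "0 < t" "\<And>v. v \<in> R \<Longrightarrow> t * s v \<le> r v" using small_multiple[OF R(1), of r s] r(1) by auto
    \<comment> \<open>The point at parameter \<open>1 + t\<close> on the line from \<open>d\<close>
      through \<open>x\<close>; the choice of \<open>t\<close> keeps its coefficients
      nonnegative.\<close>
    have "nonneg_cone \<Omega> R (\<lambda>\<sigma>. - \<delta> i \<sigma>) ((1 - (1 + t)) *\<^sub>R d + (1 + t) *\<^sub>R x)"
      unfolding nonneg_cone_def
    proof (intro exI[of _ "\<lambda>v. (1 + t) * r v - t * s v"] conjI ballI)
      fix v assume "v \<in> R"
      then have "t * s v \<le> r v" "0 \<le> t * r v" using t r(1) by (auto intro: less_imp_le)
      then show "0 \<le> (1 + t) * r v - t * s v" by (simp add: algebra_simps)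
    next
      fix \<sigma> assume "\<sigma> \<in> \<Omega>"
      have "(\<Sum>v\<in>R. ((1 + t) * r v - t * s v) * fst v \<sigma>) = (1 + t) * (\<Sum>v\<in>R. r v * fst v \<sigma>) - t * (\<Sum>v\<in>R. s v * fst v \<sigma>)"
        by (simp add: sum_distrib_left algebra_simps sum_subtractf sum.distrib)
      also have "\<dots> = (1 + t) * - \<delta> i \<sigma> - t * - \<delta> i \<sigma>" using r(2) s(2) \<open>\<sigma> \<in> \<Omega>\<close> by simp
      finally show "- \<delta> i \<sigma> = (\<Sum>v\<in>R. ((1 + t) * r v - t * s v) * fst v \<sigma>)" by (simp add: algebra_simps)
    next
      show "(1 - (1 + t)) *\<^sub>R d + (1 + t) *\<^sub>R x = (\<Sum>v\<in>R. ((1 + t) * r v - t * s v) *\<^sub>R snd v)"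
        unfolding r(3) s(3) by (simp add: scaleR_sum_right algebra_simps sum_subtractf sum.distrib sum_negf)
    qed
    then show ?thesis using t(1) clo by (intro exI[of _ "1 + t"]) auto
  qed
  have xcl: "x \<in> closure D" using x by (intro clo) (auto simp: pos_cone_def nonneg_cone_def intro: less_imp_le)
  have "x \<in> rel_interior (closure D)"
  proof -
    have ne: "rel_interior D \<noteq> {}" using D by (simp add: rel_interior_eq_empty)
    then obtain d where d: "d \<in> rel_interior D" by auto
    then obtain e where e: "e > 1" "(1 - e) *\<^sub>R d + e *\<^sub>R x \<in> closure D" using ext rel_interior_subset by blast
    \<comment> \<open>\<open>x\<close> lies strictly between the relative interior point
      \<open>d\<close> and the point \<open>z\<close> of the closure, so it is itself a relative
      interior point.\<close>
    define z where "z = (1 - e) *\<^sub>R d + e *\<^sub>R x"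
    have "x = z - (1 - 1/e) *\<^sub>R (z - d)"
    proof -
      have "z - (1 - 1/e) *\<^sub>R (z - d) = (1/e) *\<^sub>R z + (1 - 1/e) *\<^sub>R d" by (simp add: algebra_simps)
      also have "(1/e) *\<^sub>R z = (1/e - 1) *\<^sub>R d + x"
        using e(1) by (simp add: z_def scaleR_add_right diff_divide_distrib)
      finally show ?thesis by (simp add: algebra_simps)
    qed
    moreover have "z - (1 - 1/e) *\<^sub>R (z - d) \<in> rel_interior D"
      using rel_interior_closure_convex_shrink[of D d z "1 - 1/e"] D d e unfolding z_def by auto
    ultimately show ?thesis using convex_rel_interior_closure[OF D(1)] by simp
  qed
  then show "x \<in> D" using convex_rel_interior_closure[OF D(1)] rel_interior_subset by blast
qed

section \<open>Flows along productions\<close>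

type_synonym ('s, 'a) production = "'s \<times> 's set \<times> (('s \<Rightarrow> real) \<times> 'a) set"

text \<open>A state \<open>(U, b, x)\<close> consists of the symbols produced so far, the balance of each symbol and
  the value. Production \<open>(k, Q, C)\<close> of the symbol \<open>k\<close> becomes available
  when all symbols in \<open>Q\<close> are produced. The balance may be negative in between: what a production consumes
  can be paid for later, and this is why boundedly many steps suffice (\<open>flow_bound\<close>).\<close>

inductive flow :: "'s set \<Rightarrow> ('s, 'a::real_vector) production set \<Rightarrow> nat \<Rightarrow> 's set \<Rightarrow> ('s \<Rightarrow> real) \<Rightarrow> 'a \<Rightarrow> bool"
  for \<Omega> \<P> where
  base: "(\<forall>\<sigma>\<in>\<Omega>. b \<sigma> = 0) \<Longrightarrow> flow \<Omega> \<P> 0 {} b 0"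
| weaken: "flow \<Omega> \<P> n U b x \<Longrightarrow> flow \<Omega> \<P> (Suc n) U b x"
| step: "flow \<Omega> \<P> n U b x \<Longrightarrow> (k, Q, C) \<in> \<P> \<Longrightarrow> Q \<subseteq> U \<Longrightarrow> (b', x') \<in> C \<Longrightarrow> (\<And>\<sigma>. \<sigma> \<in> \<Omega> \<Longrightarrow> c \<sigma> = b \<sigma> + b' \<sigma>) \<Longrightarrow> y = x + x' \<Longrightarrow>
    flow \<Omega> \<P> (Suc n) (insert k U) c y"

text \<open>The variant of \<open>flow\<close> in which each production fires at most once.
  \<open>W\<close> collects those that have fired, so its size counts the steps.\<close>

inductive flow_via :: "'s set \<Rightarrow> ('s, 'a::real_vector) production set \<Rightarrow> ('s, 'a::real_vector) production set \<Rightarrow> 's set \<Rightarrow> ('s \<Rightarrow> real) \<Rightarrow> 'a \<Rightarrow> bool"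
  for \<Omega> \<P> where
  base: "(\<forall>\<sigma>\<in>\<Omega>. b \<sigma> = 0) \<Longrightarrow> flow_via \<Omega> \<P> {} {} b 0"
| step: "flow_via \<Omega> \<P> W U b x \<Longrightarrow> (k, Q, C) \<in> \<P> \<Longrightarrow> (k, Q, C) \<notin> W \<Longrightarrow> Q \<subseteq> U \<Longrightarrow> (b', x') \<in> C \<Longrightarrow> (\<And>\<sigma>. \<sigma> \<in> \<Omega> \<Longrightarrow> c \<sigma> = b \<sigma> + b' \<sigma>) \<Longrightarrow> y = x + x' \<Longrightarrow>
    flow_via \<Omega> \<P> (insert (k, Q, C) W) (insert k U) c y"

text \<open>Closure under sums lets two firings merge, and closure under positive factors lets flows
  be mixed. Only the target of a production may lose mass, so a deficit at a symbol shows that it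
  has been produced.\<close>

definition cone_prods :: "('s, 'a::real_vector) production set \<Rightarrow> bool" where
  "cone_prods \<P> \<longleftrightarrow> (\<forall>(k, Q, C)\<in>\<P>.
     (\<forall>(b, x)\<in>C. \<forall>(c, y)\<in>C. (\<lambda>\<sigma>. b \<sigma> + c \<sigma>, x + y) \<in> C) \<and>
     (\<forall>(b, x)\<in>C. (\<forall>t>0. (\<lambda>\<sigma>. t * b \<sigma>, t *\<^sub>R x) \<in> C) \<and> (\<forall>\<sigma>. \<sigma> \<noteq> k \<longrightarrow> 0 \<le> b \<sigma>)))"

lemma cone_prodsD:
  assumes "cone_prods \<P>" "(k, Q, C) \<in> \<P>" "(b, x) \<in> C"
  shows "(c, y) \<in> C \<Longrightarrow> (\<lambda>\<sigma>. b \<sigma> + c \<sigma>, x + y) \<in> C"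
    "0 < t \<Longrightarrow> (\<lambda>\<sigma>. t * b \<sigma>, t *\<^sub>R x) \<in> C"
    "\<sigma> \<noteq> k \<Longrightarrow> 0 \<le> b \<sigma>"
proof -
  have *: "(\<forall>(b, x)\<in>C. \<forall>(c, y)\<in>C. (\<lambda>\<sigma>. b \<sigma> + c \<sigma>, x + y) \<in> C) \<and>
     (\<forall>(b, x)\<in>C. (\<forall>t>0. (\<lambda>\<sigma>. t * b \<sigma>, t *\<^sub>R x) \<in> C) \<and> (\<forall>\<sigma>. \<sigma> \<noteq> k \<longrightarrow> 0 \<le> b \<sigma>))"
    using assms(1)[unfolded cone_prods_def, THEN bspec, OF assms(2)] by simp
  show "(c, y) \<in> C \<Longrightarrow> (\<lambda>\<sigma>. b \<sigma> + c \<sigma>, x + y) \<in> C"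
    using conjunct1[OF *, THEN bspec, OF assms(3)] by auto
  show "0 < t \<Longrightarrow> (\<lambda>\<sigma>. t * b \<sigma>, t *\<^sub>R x) \<in> C" "\<sigma> \<noteq> k \<Longrightarrow> 0 \<le> b \<sigma>"
    using conjunct2[OF *, THEN bspec, OF assms(3)] by auto
qed

lemma flow_cong: "flow \<Omega> \<P> n U b x \<Longrightarrow> (\<And>\<sigma>. \<sigma> \<in> \<Omega> \<Longrightarrow> c \<sigma> = b \<sigma>) \<Longrightarrow> flow \<Omega> \<P> n U c x"
proof (induction arbitrary: c rule: flow.induct)
  case (step n U b x k Q C b' x' c y d)
  show ?case by (rule flow.step[OF step.hyps(1-4)]) (use step in auto)
qed (auto intro: flow.intros)

lemma flow_mono: "flow \<Omega> \<P> n U b x \<Longrightarrow> n \<le> m \<Longrightarrow> flow \<Omega> \<P> m U b x"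
  by (induction m) (auto simp: le_Suc_eq intro: flow.weaken)

text \<open>One flow is replayed on top of the other. Its productions stay available because the set
  of produced symbols only grows.\<close>

lemma flow_add:
  assumes "flow \<Omega> \<P> m V c y" "flow \<Omega> \<P> n U b x" "\<And>\<sigma>. \<sigma> \<in> \<Omega> \<Longrightarrow> d \<sigma> = b \<sigma> + c \<sigma>"
  shows "flow \<Omega> \<P> (n + m) (U \<union> V) d (x + y)"
  using assms
proof (induction arbitrary: d rule: flow.induct)
  case (base c)
  then show ?case by (auto intro: flow_cong)
next
  case (weaken m V c y)
  then show ?case by (auto intro: flow.weaken)
next
  case (step m V c y k Q C b' x' c' y')
  have "flow \<Omega> \<P> (n + m) (U \<union> V) (\<lambda>\<sigma>. b \<sigma> + c \<sigma>) (x + y)"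
    using step.IH step.prems by auto
  from flow.step[OF this step.hyps(2) _ step.hyps(4), of d "x + y'"] show ?case
    using step by auto
qed

lemma flow_scale:
  assumes "flow \<Omega> \<P> n U b x" "cone_prods \<P>" "0 < t" "\<And>\<sigma>. \<sigma> \<in> \<Omega> \<Longrightarrow> d \<sigma> = t * b \<sigma>"
  shows "flow \<Omega> \<P> n U d (t *\<^sub>R x)"
  using assms
proof (induction arbitrary: d rule: flow.induct)
  case (base b)
  then show ?case by (auto intro: flow.base)
next
  case (weaken n U b x)
  then show ?case by (auto intro: flow.weaken)
next
  case (step n U b x k Q C b' x' c y)
  have "flow \<Omega> \<P> n U (\<lambda>\<sigma>. t * b \<sigma>) (t *\<^sub>R x)" using step by auto
  from flow.step[OF this step.hyps(2,3) cone_prodsD(2)[OF step.prems(1) step.hyps(2,4) step.prems(2)]]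
  show ?case using step by (auto simp: algebra_simps)
qed

lemma flow_sum:
  assumes "finite J" "\<And>j. j \<in> J \<Longrightarrow> 0 < t j \<Longrightarrow> \<exists>n U. flow \<Omega> \<P> n U (b j) (x j)" "\<And>j. j \<in> J \<Longrightarrow> 0 \<le> t j"
    "\<And>\<sigma>. \<sigma> \<in> \<Omega> \<Longrightarrow> c \<sigma> = (\<Sum>j\<in>J. t j * b j \<sigma>)" "cone_prods \<P>"
  shows "\<exists>n U. flow \<Omega> \<P> n U c (\<Sum>j\<in>J. t j *\<^sub>R x j)"
  using assms
proof (induction J arbitrary: c rule: finite_induct)
  case empty
  then show ?case by (auto intro: flow.base)
next
  case (insert j J)
  obtain n U where 1: "flow \<Omega> \<P> n U (\<lambda>\<sigma>. \<Sum>j\<in>J. t j * b j \<sigma>) (\<Sum>j\<in>J. t j *\<^sub>R x j)"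
    using insert.IH[of "\<lambda>\<sigma>. \<Sum>j\<in>J. t j * b j \<sigma>"] insert.prems by auto
  show ?case
  proof (cases "t j = 0")
    case True
    then show ?thesis using 1 insert by (auto intro: flow_cong)
  next
    case False
    then have "t j > 0" using insert.prems(2)[of j] by auto
    then obtain m V where "flow \<Omega> \<P> m V (b j) (x j)"
      using insert.prems(1)[of j] by auto
    from flow_scale[OF this insert.prems(4) \<open>0 < t j\<close>]
    have 2: "flow \<Omega> \<P> m V (\<lambda>\<sigma>. t j * b j \<sigma>) (t j *\<^sub>R x j)" by simp
    have "flow \<Omega> \<P> (m + n) (V \<union> U) c (t j *\<^sub>R x j + (\<Sum>j\<in>J. t j *\<^sub>R x j))"
      by (rule flow_add[OF 1 2]) (use insert in auto)
    then show ?thesis using insert by auto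
  qed
qed

text \<open>Mass leaves a symbol only through a production of that symbol. Availability of a
  production can therefore be read off from balances.\<close>

lemma flow_neg_mem:
  assumes "flow \<Omega> \<P> n U b x" "cone_prods \<P>" "\<sigma> \<in> \<Omega>" "b \<sigma> < 0"
  shows "\<sigma> \<in> U"
  using assms
proof (induction rule: flow.induct)
  case (step n U b x k Q C b' x' c y)
  then show ?case using cone_prodsD(3)[OF step.prems(1) step.hyps(2,4), of \<sigma>] by fastforce
qed auto

text \<open>A further firing is added to the earlier one of the same production, by closure under
  sums. The other steps are undisturbed, as their availability depends on the produced symbols and
  not on the amounts.\<close>

lemma flow_via_absorb:
  assumes "flow_via \<Omega> \<P> W U b x" "cone_prods \<P>" "(k, Q, C) \<in> W" "(b', x') \<in> C" "\<And>\<sigma>. \<sigma> \<in> \<Omega> \<Longrightarrow> c \<sigma> = b \<sigma> + b' \<sigma>"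
  shows "flow_via \<Omega> \<P> W U c (x + x')"
  using assms
proof (induction arbitrary: c rule: flow_via.induct)
  case (step W U b x l R D c' y' d y)
  show ?case
  proof (cases "(k, Q, C) = (l, R, D)")
    case True
    then have "(\<lambda>\<sigma>. c' \<sigma> + b' \<sigma>, y' + x') \<in> D"
      using cone_prodsD(1)[OF step.prems(1) step.hyps(2,5)] step.prems(3) by auto
    from flow_via.step[OF step.hyps(1-4) this, of c "y + x'"] show ?thesis using step by auto
  next
    case False
    then have "flow_via \<Omega> \<P> W U (\<lambda>\<sigma>. b \<sigma> + b' \<sigma>) (x + x')"
      using step by auto
    from flow_via.step[OF this step.hyps(2-5), of c "y + x'"] show ?thesis using step by auto
  qed
qed auto

lemma flow_via_mem: "flow_via \<Omega> \<P> W U b x \<Longrightarrow> (k, Q, C) \<in> W \<Longrightarrow> k \<in> U"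
  by (induction rule: flow_via.induct) auto

lemma flow_via_subset: "flow_via \<Omega> \<P> W U b x \<Longrightarrow> finite W \<and> W \<subseteq> \<P> \<and> flow \<Omega> \<P> (card W) U b x"
  by (induction rule: flow_via.induct) (auto intro: flow.intros)

lemma flow_imp_flow_via:
  assumes "flow \<Omega> \<P> n U b x" "cone_prods \<P>"
  shows "\<exists>W. flow_via \<Omega> \<P> W U b x"
  using assms
proof (induction rule: flow.induct)
  case (step n U b x k Q C b' x' c y)
  then obtain W where W: "flow_via \<Omega> \<P> W U b x" by auto
  show ?case
  proof (cases "(k, Q, C) \<in> W")
    case True
    then have "flow_via \<Omega> \<P> W U c y"
      using flow_via_absorb[OF W step.prems _ step.hyps(4)] step by auto
    moreover have "insert k U = U" using flow_via_mem[OF W True] by auto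
    ultimately show ?thesis by auto
  next
    case False
    from flow_via.step[OF W step.hyps(2) False step.hyps(3,4,5,6)] show ?thesis by auto
  qed
qed (auto intro: flow_via.intros)

lemma flow_bound:
  assumes "flow \<Omega> \<P> n U b x" "cone_prods \<P>" "finite \<P>" "card \<P> \<le> m"
  shows "flow \<Omega> \<P> m U b x"
proof -
  obtain W where W: "flow_via \<Omega> \<P> W U b x" using flow_imp_flow_via assms by blast
  from flow_via_subset[OF this] have "flow \<Omega> \<P> (card W) U b x" "card W \<le> card \<P>"
    using assms(3) by (auto intro: card_mono)
  then show ?thesis using assms(4) by (auto intro: flow_mono)
qed

definition msupp :: "'s set \<Rightarrow> 's mono \<Rightarrow> 's set" where
  "msupp \<Omega> M = (\<Union>E\<in>set M. {\<sigma>\<in>\<Omega>. 0 < E \<sigma>})"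

text \<open>Mass \<open>w E\<close> is taken from \<open>k\<close> and distributed according to the
  coefficients of \<open>E\<close>; all factors take part because the join is positive. The value is
  0 since only parameters contribute positions.\<close>

definition mono_cone :: "'s \<Rightarrow> 's mono \<Rightarrow> (('s \<Rightarrow> real) \<times> 'a::real_vector) set" where
  "mono_cone k M = {(\<lambda>\<sigma>. \<Sum>E\<in>set M. w E * (E \<sigma> - \<delta> k \<sigma>), 0) | w. \<forall>E\<in>set M. 0 < w E}"

text \<open>The homogenisation of the cell: mass \<open>t\<close> leaves at \<open>p\<close> through
  the point \<open>y\<close>, and \<open>t *\<^sub>R y\<close> becomes one linear unknown.\<close>

definition cell_cone :: "'s \<Rightarrow> 'a set \<Rightarrow> (('s \<Rightarrow> real) \<times> 'a::real_vector) set" where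
  "cell_cone p T = {(\<lambda>\<sigma>. - t * \<delta> p \<sigma>, t *\<^sub>R y) | t y. 0 < t \<and> y \<in> T}"

text \<open>The parameters come with a decomposition \<open>\<T>\<close> into convex cells, since
  \<open>cone_prods\<close> asks for cones closed under addition and the cone over a nonconvex
  parameter is not.\<close>

locale conv_system =
  fixes \<Omega>v \<Omega>p :: "'s set" and I :: "'s system" and P X :: "'s \<Rightarrow> 'a::euclidean_space set"
    and \<T> :: "'s \<Rightarrow> 'a set set"
  assumes alph: "alphabet \<Omega>v \<Omega>p" and sys: "ineq_system \<Omega>v \<Omega>p I"
    and small: "smallest_solution \<Omega>v \<Omega>p I P X"
    and cells: "\<And>p. p \<in> \<Omega>p \<Longrightarrow> \<Union>(\<T> p) = P p" "\<And>p T. p \<in> \<Omega>p \<Longrightarrow> T \<in> \<T> p \<Longrightarrow> convex T"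
begin

abbreviation "\<Omega> \<equiv> \<Omega>v \<union> \<Omega>p"

definition mon :: "'s \<Rightarrow> 's mono \<Rightarrow> bool" where
  "mon k M \<longleftrightarrow> (\<exists>\<phi>. (k, \<phi>) \<in> set I \<and> M \<in> set \<phi>)"

definition \<P> :: "('s, 'a) production set" where
  "\<P> = {(k, msupp \<Omega> M, mono_cone k M) | k M. mon k M} \<union> {(p, {}, cell_cone p T) | p T. p \<in> \<Omega>p \<and> T \<in> \<T> p}"

lemma fin: "finite \<Omega>v" "finite \<Omega>p" "finite \<Omega>" "\<Omega>v \<inter> \<Omega>p = {}"
  using alph by (auto simp: alphabet_def)

lemma monD:
  assumes "mon k M"
  shows "k \<in> \<Omega>v" "M \<in> monomials \<Omega>v \<Omega>p" "M \<noteq> []" "set M \<subseteq> CL \<Omega>v \<Omega>p"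
  using assms sys by (force simp: mon_def ineq_system_def polynomials_def monomials_def)+

lemma CL_D:
  assumes "E \<in> CL \<Omega>v \<Omega>p"
  shows "0 \<le> E \<sigma>" "(\<Sum>\<sigma>\<in>\<Omega>. E \<sigma>) = 1" "\<sigma> \<notin> \<Omega> \<Longrightarrow> E \<sigma> = 0"
  using assms by (auto simp: CL_def)

lemma eval_mono_sub: "mon k M \<Longrightarrow> solution \<Omega>v \<Omega>p I P Y \<Longrightarrow> eval_mono \<Omega>v \<Omega>p Y P M \<subseteq> Y k"
  unfolding mon_def solution_def eval_poly_def by blast

lemma \<P>_cases:
  assumes "(k, Q, C) \<in> \<P>"
  obtains (m) M where "mon k M" "C = mono_cone k M" "Q = msupp \<Omega> M"
    | (c) T where "k \<in> \<Omega>p" "T \<in> \<T> k" "C = cell_cone k T"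
  using assms unfolding \<P>_def by blast

lemma cone_prods_\<P>: "cone_prods \<P>"
  unfolding cone_prods_def
proof (safe, goal_cases)
  case (1 k Q C b x c y)
  from 1(1) show ?case
  proof (cases rule: \<P>_cases)
    case (m M)
    with 1(2,3) obtain w w' where w: "\<forall>E\<in>set M. 0 < w E" "\<forall>E\<in>set M. 0 < w' E"
      "b = (\<lambda>\<sigma>. \<Sum>E\<in>set M. w E * (E \<sigma> - \<delta> k \<sigma>))" "c = (\<lambda>\<sigma>. \<Sum>E\<in>set M. w' E * (E \<sigma> - \<delta> k \<sigma>))" "x = 0" "y = 0"
      unfolding mono_cone_def by blast
    show ?thesis unfolding m(2) mono_cone_def mem_Collect_eq
      by (rule exI[of _ "\<lambda>E. w E + w' E"]) (use w in \<open>auto simp: algebra_simps sum.distrib sum_subtractf add_pos_pos\<close>)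
  next
    case (c T)
    with 1(2,3) obtain t t' z z' where *: "0 < t" "0 < t'" "z \<in> T" "z' \<in> T" "b = (\<lambda>\<sigma>. - t * \<delta> k \<sigma>)" "c = (\<lambda>\<sigma>. - t' * \<delta> k \<sigma>)"
      "x = t *\<^sub>R z" "y = t' *\<^sub>R z'"
      unfolding cell_cone_def by blast
    \<comment> \<open>The mean of the two points weighted by their masses: convexity of the cell
      makes the sum of two scaled points a scaled point.\<close>
    let ?z = "(t / (t + t')) *\<^sub>R z + (t' / (t + t')) *\<^sub>R z'"
    have "?z \<in> T" using cells(2)[OF c(1,2)] * by (intro convexD) (auto simp flip: add_divide_distrib)
    moreover have "(t + t') *\<^sub>R ?z = x + y" using * by (simp add: scaleR_add_right)
    ultimately show ?thesis unfolding c(3) cell_cone_def mem_Collect_eq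
      by (intro exI[of _ "t + t'"] exI[of _ ?z]) (use * in \<open>auto simp: algebra_simps\<close>)
  qed
next
  case (2 k Q C b x t)
  from 2(1) show ?case
  proof (cases rule: \<P>_cases)
    case (m M)
    with 2 obtain w where w: "\<forall>E\<in>set M. 0 < w E"
      "b = (\<lambda>\<sigma>. \<Sum>E\<in>set M. w E * (E \<sigma> - \<delta> k \<sigma>))"  "x = 0"
      unfolding mono_cone_def by blast
    show ?thesis unfolding m(2) mono_cone_def mem_Collect_eq
      by (rule exI[of _ "\<lambda>E. t * w E"]) (use w 2(3) in \<open>auto simp: sum_distrib_left mult.assoc\<close>)
  next
    case (c T)
    with 2 obtain s z where *: "0 < s" "z \<in> T" "b = (\<lambda>\<sigma>. - s * \<delta> k \<sigma>)" "x = s *\<^sub>R z"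
      unfolding cell_cone_def by blast
    then show ?thesis unfolding c(3) cell_cone_def mem_Collect_eq
      by (intro exI[of _ "t * s"] exI[of _ z]) (use 2(3) in \<open>auto simp: algebra_simps\<close>)
  qed
next
  case (3 k Q C b x \<sigma>)
  from 3(1) show ?case
  proof (cases rule: \<P>_cases)
    case (m M)
    with 3 obtain w where w: "\<forall>E\<in>set M. 0 < w E"
      "b = (\<lambda>\<sigma>. \<Sum>E\<in>set M. w E * (E \<sigma> - \<delta> k \<sigma>))"
      unfolding mono_cone_def by blast
    have "0 \<le> w E * (E \<sigma> - \<delta> k \<sigma>)" if "E \<in> set M" for E
      using w(1) that monD(4)[OF m(1)] CL_D(1)[of E \<sigma>] 3(3) by (auto simp: \<delta>_def less_imp_le)
    then show ?thesis unfolding w(2) by (intro sum_nonneg) auto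
  next
    case (c T)
    with 3 show ?thesis unfolding cell_cone_def by (auto simp: \<delta>_def)
  qed
qed

section \<open>Every point of the smallest solution has a flow\<close>

definition reach :: "'s \<Rightarrow> 'a set" where
  "reach k = {x. \<exists>n U. flow \<Omega> \<P> n U (\<lambda>\<sigma>. - \<delta> k \<sigma>) x}"

lemma param_reach: "p \<in> \<Omega>p \<Longrightarrow> y \<in> P p \<Longrightarrow> y \<in> reach p"
proof -
  assume p: "p \<in> \<Omega>p" "y \<in> P p"
  then obtain T where T: "T \<in> \<T> p" "y \<in> T" using cells(1) by blast
  have "(p, {}, cell_cone p T) \<in> \<P>" using p T unfolding \<P>_def by blast
  moreover have "(\<lambda>\<sigma>. - 1 * \<delta> p \<sigma>, 1 *\<^sub>R y) \<in> cell_cone p T" using T unfolding cell_cone_def by force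
  ultimately have "flow \<Omega> \<P> (Suc 0) (insert p {}) (\<lambda>\<sigma>. - \<delta> p \<sigma>) y"
    by (intro flow.step[OF flow.base[of \<Omega> "\<lambda>_. 0"]]) auto
  then show ?thesis unfolding reach_def by blast
qed

lemma reach_sum:
  assumes "finite J" "\<And>j. j \<in> J \<Longrightarrow> 0 < t j \<Longrightarrow> x j \<in> reach (s j)" "\<And>j. j \<in> J \<Longrightarrow> 0 \<le> t j"
    "\<And>\<sigma>. \<sigma> \<in> \<Omega> \<Longrightarrow> c \<sigma> = - (\<Sum>j\<in>J. t j * \<delta> (s j) \<sigma>)"
  shows "\<exists>n U. flow \<Omega> \<P> n U c (\<Sum>j\<in>J. t j *\<^sub>R x j)"
  using assms by (intro flow_sum[where b = "\<lambda>j \<sigma>. - \<delta> (s j) \<sigma>"] cone_prods_\<P>) (auto simp: reach_def sum_negf)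

lemma sum_\<delta>: "finite A \<Longrightarrow> \<sigma> \<in> A \<Longrightarrow> (\<Sum>\<tau>\<in>A. f \<tau> * \<delta> \<tau> \<sigma>) = f \<sigma>"
  unfolding \<delta>_def by (simp add: if_distrib[of "\<lambda>x. _ * x"] cong: if_cong)

text \<open>Flows to the chosen points are mixed with the weights of the combination, and one firing
  for \<open>k\<close> then moves the mass from \<open>k\<close> onto their symbols. As
  \<open>X\<close> is below every solution, this yields a flow for each of its points.\<close>

lemma reach_solution: "solution \<Omega>v \<Omega>p I P reach"
  unfolding solution_def
proof (intro conjI ballI)
  fix k assume "k \<in> \<Omega>v"
  show "convex (reach k)"
  proof (rule convexI)
    fix x y :: 'a and u v :: real
    assume *: "x \<in> reach k" "y \<in> reach k" "0 \<le> u" "0 \<le> v" "u + v = 1"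
    have "\<exists>n U. flow \<Omega> \<P> n U (\<lambda>\<sigma>. - \<delta> k \<sigma>) (\<Sum>j\<in>{True, False}. (if j then u else v) *\<^sub>R (if j then x else y))"
      using * by (intro reach_sum[where s = "\<lambda>_. k"]) (auto simp flip: distrib_right)
    then show "u *\<^sub>R x + v *\<^sub>R y \<in> reach k" unfolding reach_def by simp
  qed
next
  have "eval_mono \<Omega>v \<Omega>p reach P M \<subseteq> reach k" if kM: "mon k M" for k M
  proof
    fix x assume "x \<in> eval_mono \<Omega>v \<Omega>p reach P M"
    then obtain \<mu> y where my: "\<forall>E\<in>set M. 0 < \<mu> E \<and> (\<forall>\<sigma>\<in>\<Omega>. 0 < E \<sigma> \<longrightarrow> y E \<sigma> \<in> val \<Omega>v reach P \<sigma>)"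
      "sum \<mu> (set M) = 1" "x = (\<Sum>E\<in>set M. \<mu> E *\<^sub>R (\<Sum>\<sigma>\<in>\<Omega>. E \<sigma> *\<^sub>R y E \<sigma>))"
      using eval_mono_iff[OF alph monD(2)[OF kM], THEN iffD1] by blast
    have vr: "val \<Omega>v reach P \<sigma> \<subseteq> reach \<sigma>" if "\<sigma> \<in> \<Omega>" for \<sigma>
      using that param_reach by (auto simp: val_def)
    have pos: "0 \<le> E \<sigma>" if "E \<in> set M" for E \<sigma> using that monD(4)[OF kM] CL_D by blast
    let ?c = "\<lambda>\<sigma>. - (\<Sum>E\<in>set M. \<mu> E * E \<sigma>)"
    have "\<exists>n U. flow \<Omega> \<P> n U ?c (\<Sum>E\<in>set M. \<mu> E *\<^sub>R (\<Sum>\<sigma>\<in>\<Omega>. E \<sigma> *\<^sub>R y E \<sigma>))"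
    proof (rule flow_sum[where b = "\<lambda>E \<sigma>. - E \<sigma>"])
      fix E assume E: "E \<in> set M"
      show "\<exists>n U. flow \<Omega> \<P> n U (\<lambda>\<sigma>. - E \<sigma>) (\<Sum>\<sigma>\<in>\<Omega>. E \<sigma> *\<^sub>R y E \<sigma>)"
      proof (rule reach_sum[where s = "\<lambda>\<sigma>. \<sigma>"])
        fix \<sigma> assume "\<sigma> \<in> \<Omega>" "0 < E \<sigma>"
        then show "y E \<sigma> \<in> reach \<sigma>" using my(1) E vr by blast
      next
        fix \<sigma> assume "\<sigma> \<in> \<Omega>"
        then show "- E \<sigma> = - (\<Sum>\<tau>\<in>\<Omega>. E \<tau> * \<delta> \<tau> \<sigma>)" using sum_\<delta>[OF fin(3)] by simp
      qed (use fin(3) pos[OF E] in auto)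
    qed (use my cone_prods_\<P> in \<open>auto simp: sum_negf intro: less_imp_le\<close>)
    then obtain n U where flow: "flow \<Omega> \<P> n U ?c x" unfolding my(3) by blast
    \<comment> \<open>Every symbol with a positive coefficient has a negative balance in the mixed
      flow, hence was produced; so the production of \<open>M\<close> is available.\<close>
    have "msupp \<Omega> M \<subseteq> U"
    proof
      fix \<sigma> assume "\<sigma> \<in> msupp \<Omega> M"
      then obtain E where E: "E \<in> set M" "0 < E \<sigma>" "\<sigma> \<in> \<Omega>" unfolding msupp_def by auto
      have "0 < (\<Sum>E\<in>set M. \<mu> E * E \<sigma>)"
        using E my(1) pos by (intro sum_pos2[of _ E]) (auto intro: less_imp_le)
      then show "\<sigma> \<in> U" using flow_neg_mem[OF flow cone_prods_\<P> E(3)] by auto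
    qed
    moreover have "(k, msupp \<Omega> M, mono_cone k M) \<in> \<P>" using kM unfolding \<P>_def by blast
    moreover have "(\<lambda>\<sigma>. \<Sum>E\<in>set M. \<mu> E * (E \<sigma> - \<delta> k \<sigma>), 0) \<in> mono_cone k M"
      using my(1) unfolding mono_cone_def by blast
    ultimately have "flow \<Omega> \<P> (Suc n) (insert k U) (\<lambda>\<sigma>. - \<delta> k \<sigma>) x"
      using my(2) by (intro flow.step[OF flow]) (auto simp: algebra_simps sum_subtractf simp flip: sum_distrib_left sum_distrib_right)
    then show "x \<in> reach k" unfolding reach_def by blast
  qed
  then show "\<And>x. x \<in> set I \<Longrightarrow> case x of (x, \<phi>) \<Rightarrow> eval_poly \<Omega>v \<Omega>p reach P \<phi> \<subseteq> reach x"
    unfolding eval_poly_def mon_def by blast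
qed

lemma X_sub_reach: "k \<in> \<Omega>v \<Longrightarrow> X k \<subseteq> reach k"
  using small reach_solution unfolding smallest_solution_def by blast

end

section \<open>Every point with a flow lies in the smallest solution\<close>

context conv_system
begin

text \<open>For a variable this is the set \<open>D\<close> of \<open>cone_point_mem\<close>.
  Parameters are included because the dual certificate assigns a number to every symbol.\<close>

definition flow_pts :: "(('s \<Rightarrow> real) \<times> 'a) set \<Rightarrow> 's \<Rightarrow> 'a set" where
  "flow_pts R \<sigma> = {d \<in> val \<Omega>v X P \<sigma>. nonneg_cone \<Omega> R (\<lambda>\<tau>. - \<delta> \<sigma> \<tau>) d}"

definition ray :: "'s \<Rightarrow> 's cl \<Rightarrow> ('s \<Rightarrow> real) \<times> 'a" where
  "ray k E = (\<lambda>\<sigma>. E \<sigma> - \<delta> k \<sigma>, 0)"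

text \<open>What the order of a productive flow leaves behind in its rays: the factors of a monomial
  occur together, its symbols are in \<open>U\<close>, and every symbol of \<open>U\<close> has a
  point, so that suprema over these points make sense.\<close>

definition admissible :: "'s set \<Rightarrow> (('s \<Rightarrow> real) \<times> 'a) set \<Rightarrow> bool" where
  "admissible U R \<longleftrightarrow> finite R \<and> (\<forall>\<sigma>\<in>U. flow_pts R \<sigma> \<noteq> {}) \<and>
    (\<forall>v\<in>R. (\<exists>p\<in>\<Omega>p. \<exists>y\<in>P p. v = (\<lambda>\<sigma>. - \<delta> p \<sigma>, y)) \<or>
      (\<exists>k M. mon k M \<and> msupp \<Omega> M \<subseteq> U \<and> v \<in> ray k ` set M \<and> ray k ` set M \<subseteq> R))"

lemma sol: "solution \<Omega>v \<Omega>p I P X"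
  using small by (simp add: smallest_solution_def)

lemma flow_pts_mono: "R \<subseteq> R' \<Longrightarrow> finite R' \<Longrightarrow> flow_pts R \<sigma> \<subseteq> flow_pts R' \<sigma>"
  unfolding flow_pts_def by (auto intro: nonneg_cone_mono)

text \<open>The mixture is a value of the monomial at \<open>X\<close>, hence lies in
  \<open>X k\<close> because \<open>X\<close> is a solution. For the cone, the ray of each factor is
  put in front of the flows of its points and carries the mass from \<open>k\<close> to
  them.\<close>

lemma flow_pts_mon:
  assumes kM: "mon k M" and R: "ray k ` set M \<subseteq> R" "finite R"
    and \<mu>: "\<And>E. E \<in> set M \<Longrightarrow> 0 < \<mu> E" "sum \<mu> (set M) = 1"
    and d: "\<And>\<sigma>. \<sigma> \<in> msupp \<Omega> M \<Longrightarrow> d \<sigma> \<in> flow_pts R \<sigma>"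
  shows "(\<Sum>E\<in>set M. \<mu> E *\<^sub>R (\<Sum>\<sigma>\<in>\<Omega>. E \<sigma> *\<^sub>R d \<sigma>)) \<in> flow_pts R k"
proof -
  let ?x = "\<Sum>E\<in>set M. \<mu> E *\<^sub>R (\<Sum>\<sigma>\<in>\<Omega>. E \<sigma> *\<^sub>R d \<sigma>)"
  have dE: "d \<sigma> \<in> flow_pts R \<sigma>" if "E \<in> set M" "\<sigma> \<in> \<Omega>" "0 < E \<sigma>" for E \<sigma>
    using that by (intro d) (auto simp: msupp_def)
  have "?x \<in> eval_mono \<Omega>v \<Omega>p X P M"
    using \<mu> dE by (intro eval_mono_iff[OF alph monD(2)[OF kM], THEN iffD2] exI[of _ \<mu>] exI[of _ "\<lambda>_. d"])
      (auto simp: flow_pts_def)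
  then have X: "?x \<in> val \<Omega>v X P k"
    using eval_mono_sub[OF kM sol] monD(1)[OF kM] by (auto simp: val_def)
  have "nonneg_cone \<Omega> R (\<lambda>\<tau>. - \<delta> k \<tau>) (\<Sum>\<sigma>\<in>\<Omega>. E \<sigma> *\<^sub>R d \<sigma>)" if E: "E \<in> set M" for E
  proof -
    have 1: "nonneg_cone \<Omega> R (\<lambda>\<sigma>. E \<sigma> - \<delta> k \<sigma>) (snd (ray k E))"
      using R E by (intro nonneg_cone_ray) (auto simp: ray_def)
    have 2: "nonneg_cone \<Omega> R (\<lambda>\<tau>. - E \<tau>) (\<Sum>\<sigma>\<in>\<Omega>. E \<sigma> *\<^sub>R d \<sigma>)"
    proof (rule nonneg_cone_sum[where b = "\<lambda>\<sigma> \<tau>. - \<delta> \<sigma> \<tau>"])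
      fix \<tau> assume "\<tau> \<in> \<Omega>"
      then show "- E \<tau> = (\<Sum>\<sigma>\<in>\<Omega>. E \<sigma> * - \<delta> \<sigma> \<tau>)" using sum_\<delta>[OF fin(3)] by (simp add: sum_negf)
    next
      fix \<sigma> assume "\<sigma> \<in> \<Omega>" "0 < E \<sigma>"
      then show "nonneg_cone \<Omega> R (\<lambda>\<tau>. - \<delta> \<sigma> \<tau>) (d \<sigma>)" using dE[OF E] by (auto simp: flow_pts_def)
    next
      fix \<sigma> show "0 \<le> E \<sigma>" using CL_D(1) monD(4)[OF kM] E by blast
    qed (rule fin)
    show ?thesis using nonneg_cone_add[OF 1 2, of "\<lambda>\<tau>. - \<delta> k \<tau>"] by (simp add: ray_def)
  qed
  then have "nonneg_cone \<Omega> R (\<lambda>\<tau>. - \<delta> k \<tau>) ?x"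
  proof (rule nonneg_cone_sum[where b = "\<lambda>_ \<tau>. - \<delta> k \<tau>", rotated])
    fix \<tau> show "- \<delta> k \<tau> = (\<Sum>E\<in>set M. \<mu> E * - \<delta> k \<tau>)" using \<mu>(2) by (metis sum_distrib_right mult_1)
  qed (use \<mu> in \<open>auto simp: less_imp_le\<close>)
  with X show ?thesis by (simp add: flow_pts_def)
qed

text \<open>At a monomial step the premise \<open>Q \<subseteq> U\<close> provides points at all
  symbols of the monomial, and these are mixed into a point at \<open>k\<close>. Enlarging
  \<open>R\<close> preserves the points found before.\<close>

lemma flow_admissible:
  assumes "flow \<Omega> \<P> n U b x"
  shows "\<exists>R. admissible U R \<and> pos_cone \<Omega> R b x"
  using assms
proof (induction rule: flow.induct)
  case (base b)
  then show ?case by (intro exI[of _ "{}"]) (auto simp: admissible_def pos_cone_def)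
next
  case (step n U b x k Q C b' x' c y)
  then obtain R where R: "admissible U R" "pos_cone \<Omega> R b x" by auto
  then have finR: "finite R" and ne: "\<And>\<sigma>. \<sigma> \<in> U \<Longrightarrow> flow_pts R \<sigma> \<noteq> {}" by (auto simp: admissible_def)
  from step.hyps(2) show ?case
  proof (cases rule: \<P>_cases)
    case (m M)
    let ?S = "ray k ` set M"
    have finRS: "finite (R \<union> ?S)" using finR by auto
    obtain w where w: "\<forall>E\<in>set M. 0 < w E" "b' = (\<lambda>\<sigma>. \<Sum>E\<in>set M. w E * (E \<sigma> - \<delta> k \<sigma>))" "x' = 0"
      using step.hyps(4) unfolding m(2) mono_cone_def by blast
    \<comment> \<open>Distinct factors give distinct rays, so the weights of the factors can serve
      as coefficients of the rays.\<close>
    have inj: "inj_on (ray k) (set M)" by (auto simp: ray_def inj_on_def fun_eq_iff)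
    have "pos_cone \<Omega> ?S b' x'"
      unfolding pos_cone_def using w(1)
      by (intro exI[of _ "\<lambda>v. w (inv_into (set M) (ray k) v)"])
        (auto simp: sum.reindex[OF inj] inv_into_f_f[OF inj] w(2,3), auto simp: ray_def)
    from pos_cone_add[OF R(2) this step.hyps(5) finR] have "pos_cone \<Omega> (R \<union> ?S) c y"
      using step.hyps(6) by simp
    moreover have "admissible (insert k U) (R \<union> ?S)"
    proof -
      have U: "flow_pts (R \<union> ?S) \<sigma> \<noteq> {}" if "\<sigma> \<in> U" for \<sigma>
        using ne[OF that] flow_pts_mono[of R "R \<union> ?S" \<sigma>] finRS by auto
      then have "\<forall>\<sigma>\<in>U. \<exists>d. d \<in> flow_pts (R \<union> ?S) \<sigma>" by blast
      then obtain d where d: "\<And>\<sigma>. \<sigma> \<in> U \<Longrightarrow> d \<sigma> \<in> flow_pts (R \<union> ?S) \<sigma>" by metis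
      have "flow_pts (R \<union> ?S) k \<noteq> {}"
        using flow_pts_mon[OF m(1), of "R \<union> ?S" "\<lambda>_. 1 / card (set M)" d] finRS d step.hyps(3) m(3) monD(3)[OF m(1)]
        by (auto simp: subset_iff card_gt_0_iff)
      then show ?thesis
        using U finRS R(1) m(1,3) step.hyps(3) unfolding admissible_def by blast
    qed
    ultimately show ?thesis by blast
  next
    case (c T)
    obtain t z where t: "0 < t" "z \<in> T" "b' = (\<lambda>\<sigma>. - t * \<delta> k \<sigma>)" "x' = t *\<^sub>R z"
      using step.hyps(4) unfolding c(3) cell_cone_def by blast
    let ?v = "(\<lambda>\<sigma>. - \<delta> k \<sigma>, z)"
    have finR': "finite (R \<union> {?v})" using finR by auto
    have "pos_cone \<Omega> {?v} b' x'" using t unfolding pos_cone_def by (intro exI[of _ "\<lambda>_. t"]) auto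
    from pos_cone_add[OF R(2) this step.hyps(5) finR] have "pos_cone \<Omega> (R \<union> {?v}) c y"
      using step.hyps(6) by simp
    moreover have "z \<in> P k" using c t cells(1) by blast
    moreover have "admissible (insert k U) (R \<union> {?v})"
    proof -
      have U: "flow_pts (R \<union> {?v}) \<sigma> \<noteq> {}" if "\<sigma> \<in> U" for \<sigma>
        using ne[OF that] flow_pts_mono[of R "R \<union> {?v}" \<sigma>] finR' by auto
      have "nonneg_cone \<Omega> (R \<union> {?v}) (\<lambda>\<tau>. - \<delta> k \<tau>) (snd ?v)" using finR' by (intro nonneg_cone_ray) auto
      then have "z \<in> flow_pts (R \<union> {?v}) k"
        using \<open>z \<in> P k\<close> c(1) fin(4) by (auto simp: flow_pts_def val_def)
      then show ?thesis
        using U finR' R(1) c(1) \<open>z \<in> P k\<close> unfolding admissible_def by blast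
    qed
    ultimately show ?thesis by blast
  qed
qed auto

lemma \<delta>_sum1: "finite A \<Longrightarrow> k \<in> A \<Longrightarrow> (\<Sum>\<sigma>\<in>A. \<delta> k \<sigma> * f \<sigma>) = f k"
  unfolding \<delta>_def by (simp add: if_distrib[of "\<lambda>x. x * _"] cong: if_cong)

text \<open>Added up over all symbols, a monomial ray has balance 0, a parameter ray -1, and the
  flow -1. Thus the coefficients of the parameter rays sum to 1, and only these rays have a nonzero
  value. The bound makes the support functions finite.\<close>

lemma flow_pts_bounded:
  assumes "admissible U R" "\<sigma> \<in> \<Omega>" "d \<in> flow_pts R \<sigma>"
  shows "u \<bullet> d \<le> (\<Sum>v\<in>R. \<bar>u \<bullet> snd v\<bar>)"
proof -
  have finR: "finite R" using assms(1) by (simp add: admissible_def)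
  obtain r where r: "\<forall>v\<in>R. 0 \<le> r v" "\<forall>\<tau>\<in>\<Omega>. - \<delta> \<sigma> \<tau> = (\<Sum>v\<in>R. r v * fst v \<tau>)" "d = (\<Sum>v\<in>R. r v *\<^sub>R snd v)"
    using assms(3) unfolding flow_pts_def by (auto elim: nonneg_coneE)
  have ray: "(\<Sum>\<tau>\<in>\<Omega>. fst v \<tau>) \<le> 0 \<and> ((\<Sum>\<tau>\<in>\<Omega>. fst v \<tau>) = - 1 \<or> snd v = 0)" if v: "v \<in> R" for v
  proof -
    consider p y where "p \<in> \<Omega>p" "v = (\<lambda>\<sigma>. - \<delta> p \<sigma>, y)" | k M E where "mon k M" "E \<in> set M" "v = ray k E"
      using assms(1) v unfolding admissible_def by blast
    then show ?thesis
    proof cases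
      case 1
      then show ?thesis using \<delta>_sum1[OF fin(3), of p "\<lambda>_. 1"] by (simp add: sum_negf)
    next
      case 2
      then have "(\<Sum>\<tau>\<in>\<Omega>. E \<tau>) = 1" "k \<in> \<Omega>" using monD CL_D(2) by blast+
      then show ?thesis using 2(3) \<delta>_sum1[OF fin(3), of k "\<lambda>_. 1"] by (simp add: sum_subtractf ray_def)
    qed
  qed
  have "- 1 = (\<Sum>\<tau>\<in>\<Omega>. - \<delta> \<sigma> \<tau>)" using \<delta>_sum1[OF fin(3) assms(2), of "\<lambda>_. 1"] by (simp add: sum_negf)
  also have "\<dots> = (\<Sum>\<tau>\<in>\<Omega>. \<Sum>v\<in>R. r v * fst v \<tau>)" using r(2) by (intro sum.cong) auto
  also have "\<dots> = (\<Sum>v\<in>R. r v * (\<Sum>\<tau>\<in>\<Omega>. fst v \<tau>))" by (subst sum.swap) (simp add: sum_distrib_left)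
  finally have one: "(\<Sum>v\<in>R. - (r v * (\<Sum>\<tau>\<in>\<Omega>. fst v \<tau>))) = 1" by (simp add: sum_negf)
  have "u \<bullet> d = (\<Sum>v\<in>R. r v * (u \<bullet> snd v))" unfolding r(3) by (simp add: inner_sum_right)
  also have "\<dots> \<le> (\<Sum>v\<in>R. \<bar>u \<bullet> snd v\<bar>)"
  proof (rule sum_mono)
    fix v assume v: "v \<in> R"
    show "r v * (u \<bullet> snd v) \<le> \<bar>u \<bullet> snd v\<bar>"
    proof (cases "snd v = 0")
      case False
      then have s: "(\<Sum>\<tau>\<in>\<Omega>. fst v \<tau>) = - 1" using ray[OF v] by simp
      have "- (r v * (\<Sum>\<tau>\<in>\<Omega>. fst v \<tau>)) \<le> (\<Sum>v\<in>R. - (r v * (\<Sum>\<tau>\<in>\<Omega>. fst v \<tau>)))"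
        using v finR r(1) ray by (intro member_le_sum) (auto simp: mult_nonneg_nonpos)
      then have "r v \<le> 1" using one s by simp
      have "r v * (u \<bullet> snd v) \<le> r v * \<bar>u \<bullet> snd v\<bar>" using r(1) v by (intro mult_left_mono) auto
      also have "\<dots> \<le> 1 * \<bar>u \<bullet> snd v\<bar>" using \<open>r v \<le> 1\<close> by (intro mult_right_mono) auto
      finally show ?thesis by simp
    qed simp
  qed
  finally show ?thesis .
qed

text \<open>The mixture is concentrated on \<open>e\<close>. Monomials admit positive weights only,
  whereas the dual inequality is required at each single factor, an extreme case that is reached by
  passing to the limit.\<close>

lemma le_of_mixtures:
  fixes g :: "'b \<Rightarrow> real"
  assumes "finite A" "e \<in> A" "\<And>\<mu>. (\<And>x. x \<in> A \<Longrightarrow> 0 < \<mu> x) \<Longrightarrow> sum \<mu> A = 1 \<Longrightarrow> (\<Sum>x\<in>A. \<mu> x * g x) \<le> h"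
  shows "g e \<le> h"
proof -
  let ?n = "real (card A)"
  have n: "0 < ?n" using assms(1,2) card_gt_0_iff by auto
  define a where "a = (\<Sum>x\<in>A. g x) / ?n"
  have "z * (g e - a) \<le> h - a" if z: "0 < z" "z < 1" for z
  proof -
    \<comment> \<open>Weight \<open>z\<close> goes to \<open>e\<close> and the rest is spread
      evenly, so the mixture has the value \<open>z * g e + (1 - z) * a\<close> with
      \<open>a\<close> the mean of \<open>g\<close>; then \<open>z\<close> tends to 1.\<close>
    let ?\<mu> = "\<lambda>x. z * \<delta> e x + (1 - z) / ?n"
    have *: "(\<Sum>x\<in>A. ?\<mu> x * f x) = z * f e + (1 - z) * ((\<Sum>x\<in>A. f x) / ?n)" for f
    proof -
      have "(\<Sum>x\<in>A. ?\<mu> x * f x) = (\<Sum>x\<in>A. z * (\<delta> e x * f x)) + (\<Sum>x\<in>A. (1 - z) / ?n * f x)"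
        by (simp add: distrib_right sum.distrib mult.assoc)
      also have "\<dots> = z * f e + (1 - z) / ?n * (\<Sum>x\<in>A. f x)"
        using \<delta>_sum1[OF assms(1,2), of f] by (simp only: flip: sum_distrib_left)
      finally show ?thesis by simp
    qed
    have "(\<Sum>x\<in>A. ?\<mu> x * g x) \<le> h"
      using z n *[of "\<lambda>_. 1"] by (intro assms(3)) (auto simp: \<delta>_def add_pos_pos)
    then show ?thesis unfolding * a_def[symmetric] by (simp add: algebra_simps)
  qed
  then have "g e - a \<le> h - a" by (rule field_le_mult_one_interval)
  then show ?thesis by simp
qed

lemma reach_sub_X:
  assumes "x \<in> reach i" "i \<in> \<Omega>v"
  shows "x \<in> X i"
proof -
  from assms(1) obtain n U where flow: "flow \<Omega> \<P> n U (\<lambda>\<sigma>. - \<delta> i \<sigma>) x" unfolding reach_def by auto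
  then obtain R where R: "admissible U R" "pos_cone \<Omega> R (\<lambda>\<sigma>. - \<delta> i \<sigma>) x" using flow_admissible by blast
  have finR: "finite R" and ne: "\<And>\<sigma>. \<sigma> \<in> U \<Longrightarrow> flow_pts R \<sigma> \<noteq> {}" using R(1) by (auto simp: admissible_def)
  have iU: "i \<in> U" using flow_neg_mem[OF flow cone_prods_\<P>, of i] assms(2) by (auto simp: \<delta>_def)
  have "x \<in> flow_pts R i"
  proof (rule cone_point_mem[OF finR fin(3) _ R(2)])
    show "convex (flow_pts R i)"
    proof (rule convexI)
      fix a b :: 'a and s t :: real
      assume *: "a \<in> flow_pts R i" "b \<in> flow_pts R i" "0 \<le> s" "0 \<le> t" "s + t = 1"
      have "convex (X i)" using sol assms(2) by (auto simp: solution_def)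
      then have "s *\<^sub>R a + t *\<^sub>R b \<in> X i" using * assms(2) by (intro convexD) (auto simp: flow_pts_def val_def)
      moreover have "nonneg_cone \<Omega> R (\<lambda>\<tau>. s * - \<delta> i \<tau>) (s *\<^sub>R a)" "nonneg_cone \<Omega> R (\<lambda>\<tau>. t * - \<delta> i \<tau>) (t *\<^sub>R b)"
        using * by (auto simp: flow_pts_def intro: nonneg_cone_scale)
      then have "nonneg_cone \<Omega> R (\<lambda>\<tau>. - \<delta> i \<tau>) (s *\<^sub>R a + t *\<^sub>R b)"
        by (rule nonneg_cone_add) (metis *(5) distrib_right mult_1)
      ultimately show "s *\<^sub>R a + t *\<^sub>R b \<in> flow_pts R i" using assms(2) by (auto simp: flow_pts_def val_def)
    qed
    show "flow_pts R i \<noteq> {}" using ne iU by blast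
    show "nonneg_cone \<Omega> R (\<lambda>\<sigma>. - \<delta> i \<sigma>) d" if "d \<in> flow_pts R i" for d using that by (simp add: flow_pts_def)
    fix u
    \<comment> \<open>The dual certificate is the support function, in direction \<open>u\<close>,
      of the points at each symbol. Its inequality at a monomial ray says that the value at
      \<open>k\<close> dominates the combination of values prescribed by the factor.\<close>
    define h where "h \<sigma> = Sup ((\<bullet>) u ` flow_pts R \<sigma>)" for \<sigma>
    have bdd: "bdd_above ((\<bullet>) u ` flow_pts R \<sigma>)" if "\<sigma> \<in> \<Omega>" for \<sigma>
      using flow_pts_bounded[OF R(1) that] by (intro bdd_aboveI[of _ "\<Sum>v\<in>R. \<bar>u \<bullet> snd v\<bar>"]) auto
    have up: "u \<bullet> d \<le> h \<sigma>" if "\<sigma> \<in> \<Omega>" "d \<in> flow_pts R \<sigma>" for \<sigma> d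
      unfolding h_def using that bdd by (intro cSup_upper) auto
    have least: "h i \<le> B" if "\<forall>d\<in>flow_pts R i. u \<bullet> d \<le> B" for B
      unfolding h_def using that ne[OF iU] by (intro cSup_least) auto
    have rayle: "(\<Sum>\<sigma>\<in>\<Omega>. fst v \<sigma> * h \<sigma>) + u \<bullet> snd v \<le> 0" if v: "v \<in> R" for v
    proof -
      consider (p) p y where "p \<in> \<Omega>p" "y \<in> P p" "v = (\<lambda>\<sigma>. - \<delta> p \<sigma>, y)"
        | (m) k M E where "mon k M" "msupp \<Omega> M \<subseteq> U" "E \<in> set M" "v = ray k E" "ray k ` set M \<subseteq> R"
        using R(1) v unfolding admissible_def by blast
      then show ?thesis
      proof cases
        case p
        have "nonneg_cone \<Omega> R (\<lambda>\<tau>. - \<delta> p \<tau>) (snd v)" using finR v p(3) by (intro nonneg_cone_ray) auto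
        then have "y \<in> flow_pts R p" using p fin(4) by (auto simp: flow_pts_def val_def)
        then have "u \<bullet> y \<le> h p" using p(1) by (intro up) auto
        then show ?thesis using p \<delta>_sum1[OF fin(3), of p h] by (simp add: sum_negf)
      next
        case m
        have pos: "0 \<le> F \<sigma>" and one: "(\<Sum>\<sigma>\<in>\<Omega>. F \<sigma>) = 1" if "F \<in> set M" for F \<sigma>
          using that monD(4)[OF m(1)] CL_D by blast+
        have k: "k \<in> \<Omega>" using monD(1)[OF m(1)] by simp
        have "(\<Sum>\<sigma>\<in>\<Omega>. E \<sigma> * h \<sigma>) \<le> h k"
        proof (rule le_of_mixtures[of "set M" E "\<lambda>F. \<Sum>\<sigma>\<in>\<Omega>. F \<sigma> * h \<sigma>"])
          fix \<mu> :: "'s cl \<Rightarrow> real" assume \<mu>: "\<And>x. x \<in> set M \<Longrightarrow> 0 < \<mu> x" "sum \<mu> (set M) = 1"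
          show "(\<Sum>F\<in>set M. \<mu> F * (\<Sum>\<sigma>\<in>\<Omega>. F \<sigma> * h \<sigma>)) \<le> h k"
          proof (rule field_le_epsilon)
            fix \<epsilon> :: real assume "0 < \<epsilon>"
            \<comment> \<open>Suprema need not be attained, so points within \<epsilon> of them are
              inserted into the monomial. The total error is again \<epsilon> because the weights
              and the coefficients of each factor sum to 1.\<close>
            have "\<exists>d\<in>flow_pts R \<sigma>. h \<sigma> - \<epsilon> < u \<bullet> d" if "\<sigma> \<in> msupp \<Omega> M" for \<sigma>
              using less_cSupD[of "(\<bullet>) u ` flow_pts R \<sigma>" "h \<sigma> - \<epsilon>"] ne[of \<sigma>] that m(2) \<open>0 < \<epsilon>\<close>
              unfolding h_def by auto
            then obtain d where d: "\<And>\<sigma>. \<sigma> \<in> msupp \<Omega> M \<Longrightarrow> d \<sigma> \<in> flow_pts R \<sigma> \<and> h \<sigma> - \<epsilon> < u \<bullet> d \<sigma>" by metis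
            have "(\<Sum>F\<in>set M. \<mu> F *\<^sub>R (\<Sum>\<sigma>\<in>\<Omega>. F \<sigma> *\<^sub>R d \<sigma>)) \<in> flow_pts R k"
              using d by (intro flow_pts_mon[OF m(1,5) finR \<mu>]) auto
            from up[OF k this] have "(\<Sum>F\<in>set M. \<mu> F * (\<Sum>\<sigma>\<in>\<Omega>. F \<sigma> * (u \<bullet> d \<sigma>))) \<le> h k"
              by (simp add: inner_sum_right)
            moreover have "(\<Sum>F\<in>set M. \<mu> F * (\<Sum>\<sigma>\<in>\<Omega>. F \<sigma> * (h \<sigma> - \<epsilon>))) \<le> (\<Sum>F\<in>set M. \<mu> F * (\<Sum>\<sigma>\<in>\<Omega>. F \<sigma> * (u \<bullet> d \<sigma>)))"
            proof (rule sum_mono, rule mult_left_mono, rule sum_mono)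
              fix F \<sigma> assume F: "F \<in> set M" "\<sigma> \<in> \<Omega>"
              show "F \<sigma> * (h \<sigma> - \<epsilon>) \<le> F \<sigma> * (u \<bullet> d \<sigma>)"
              proof (cases "F \<sigma> = 0")
                case False
                then have "0 < F \<sigma>" using pos[OF F(1), of \<sigma>] by simp
                then have "\<sigma> \<in> msupp \<Omega> M" using F by (auto simp: msupp_def)
                then show ?thesis using d \<open>0 < F \<sigma>\<close> by (intro mult_left_mono) (auto intro: less_imp_le)
              qed simp
            qed (auto simp: \<mu> less_imp_le)
            moreover have "(\<Sum>F\<in>set M. \<mu> F * (\<Sum>\<sigma>\<in>\<Omega>. F \<sigma> * (h \<sigma> - \<epsilon>))) = (\<Sum>F\<in>set M. \<mu> F * (\<Sum>\<sigma>\<in>\<Omega>. F \<sigma> * h \<sigma>)) - \<epsilon>"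
            proof -
              have "(\<Sum>\<sigma>\<in>\<Omega>. F \<sigma> * (h \<sigma> - \<epsilon>)) = (\<Sum>\<sigma>\<in>\<Omega>. F \<sigma> * h \<sigma>) - \<epsilon>" if "F \<in> set M" for F
                using one[OF that] by (simp add: right_diff_distrib sum_subtractf flip: sum_distrib_right)
              then have "(\<Sum>F\<in>set M. \<mu> F * (\<Sum>\<sigma>\<in>\<Omega>. F \<sigma> * (h \<sigma> - \<epsilon>))) = (\<Sum>F\<in>set M. \<mu> F * ((\<Sum>\<sigma>\<in>\<Omega>. F \<sigma> * h \<sigma>) - \<epsilon>))"
                by (intro sum.cong) auto
              then show ?thesis using \<mu>(2) by (simp add: right_diff_distrib sum_subtractf flip: sum_distrib_right)
            qed
            ultimately show "(\<Sum>F\<in>set M. \<mu> F * (\<Sum>\<sigma>\<in>\<Omega>. F \<sigma> * h \<sigma>)) \<le> h k + \<epsilon>" by linarith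
          qed
        qed (use m in auto)
        then show ?thesis using m(4) \<delta>_sum1[OF fin(3) k, of h]
          by (simp add: ray_def left_diff_distrib sum_subtractf)
      qed
    qed
    show "\<exists>h. (\<forall>v\<in>R. (\<Sum>\<sigma>\<in>\<Omega>. fst v \<sigma> * h \<sigma>) + u \<bullet> snd v \<le> 0) \<and> (\<forall>B. (\<forall>d\<in>flow_pts R i. u \<bullet> d \<le> B) \<longrightarrow> h i \<le> B)"
      using rayle least by blast
  qed (use assms in auto)
  then show ?thesis using assms(2) by (auto simp: flow_pts_def val_def)
qed

theorem X_iff_flow:
  assumes "finite \<P>" "card \<P> \<le> m" "i \<in> \<Omega>v"
  shows "x \<in> X i \<longleftrightarrow> (\<exists>U. flow \<Omega> \<P> m U (\<lambda>\<sigma>. - \<delta> i \<sigma>) x)"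
proof
  assume "x \<in> X i"
  then have "x \<in> reach i" using X_sub_reach assms(3) by blast
  then show "\<exists>U. flow \<Omega> \<P> m U (\<lambda>\<sigma>. - \<delta> i \<sigma>) x"
    unfolding reach_def using flow_bound[OF _ cone_prods_\<P> assms(1,2)] by blast
next
  assume "\<exists>U. flow \<Omega> \<P> m U (\<lambda>\<sigma>. - \<delta> i \<sigma>) x"
  then show "x \<in> X i" using reach_sub_X assms(3) unfolding reach_def by blast
qed

end

section \<open>Correctness of the algorithm\<close>

lemma dot_simps [simp]:
  "dot [] v = 0" "dot l [] = 0" "dot (x # l) (y # v) = x * y + dot l v"
  by (auto simp: dot_def)

lemma dot_append: "length l = length v \<Longrightarrow> dot (l @ l') (v @ v') = dot l v + dot l' v'"
  by (induction l v rule: list_induct2) auto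

lemma dot_zero [simp]: "dot (map (\<lambda>_. 0) us) v = 0" "dot v (map (\<lambda>_. 0) us) = 0"
  by (induction us v rule: list_induct2') auto

lemma dot_sum: "length l = length v \<Longrightarrow> dot l v = (\<Sum>i<length v. l ! i * v ! i)"
  by (induction l v rule: list_induct2) (auto simp: sum.lessThan_Suc_shift simp del: sum.lessThan_Suc)

lemma dot_neg: "dot (neg l) v = - dot l v"
  unfolding neg_def by (induction l v rule: list_induct2') auto

lemma length_neg [simp]: "length (neg l) = length l"
  by (simp add: neg_def)

lemma dot_map_uminus: "dot (map (\<lambda>g. - f g) l) v = - dot (map f l) v"
  by (induction l v rule: list_induct2') auto

lemma length_units [simp]: "length (units l) = length l"
  by (induction l) (auto simp: units_def)

lemma units_Cons: "units (x # l) = (1 # map (\<lambda>_. 0) (units l)) # map (\<lambda>u. 0 # u) (units l)"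
  by (simp add: units_def)

lemma units_nth: "j < length l \<Longrightarrow> units l ! j = map (\<lambda>i. if i = j then 1 else 0) [0..<length l]"
proof (induction l arbitrary: j)
  case (Cons x l)
  show ?case
  proof (cases j)
    case 0
    then show ?thesis by (auto simp: units_Cons upt_conv_Cons map_Suc_upt[symmetric] simp del: upt_Suc intro!: nth_equalityI)
  next
    case (Suc i)
    then show ?thesis using Cons by (auto simp: units_Cons upt_conv_Cons map_Suc_upt[symmetric] simp del: upt_Suc)
  qed
qed simp

lemma dot_unit: "j < length l \<Longrightarrow> length v = length l \<Longrightarrow> dot (units l ! j) v = v ! j"
  by (subst dot_sum) (auto simp: units_nth if_distrib[of "\<lambda>x. x * _"] cong: if_cong)

lemma holds_scale: "0 < c \<Longrightarrow> holds s (c * r) = holds s r"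
  by (auto simp: holds_def zero_less_mult_iff zero_le_mult_iff)

lemma sat_append: "sat v (A @ B) \<longleftrightarrow> sat v A \<and> sat v B"
  by (auto simp: sat_def)

lemma sat_Cons: "sat v (a # B) \<longleftrightarrow> holds (fst a) (dot (snd a) v) \<and> sat v B"
  by (auto simp: sat_def)

text \<open>The midpoint between the largest lower and the smallest upper bound works: if the two
  coincide, the pairwise hypothesis prevents a strict bound from attaining their common value. If
  one side is empty, moving by 1 past the extreme bound suffices.\<close>

lemma between_bounds:
  fixes L U :: "(bool \<times> real) set"
  assumes "finite L" "finite U" "\<And>s a t b. (s, a) \<in> L \<Longrightarrow> (t, b) \<in> U \<Longrightarrow> holds (s \<or> t) (b - a)"
  shows "\<exists>w. (\<forall>(s, a)\<in>L. holds s (w - a)) \<and> (\<forall>(t, b)\<in>U. holds t (b - w))"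
proof -
  have fin: "finite (snd ` L)" "finite (snd ` U)" using assms by auto
  consider "L = {}" "U = {}" | "L = {}" "U \<noteq> {}" | "L \<noteq> {}" "U = {}" | "L \<noteq> {}" "U \<noteq> {}" by blast
  then show ?thesis
  proof cases
    case 2
    have "Min (snd ` U) \<le> b" if "(t, b) \<in> U" for t b using fin that by (intro Min_le) force+
    then show ?thesis using 2 by (intro exI[of _ "Min (snd ` U) - 1"]) (fastforce simp: holds_def)
  next
    case 3
    have "a \<le> Max (snd ` L)" if "(t, a) \<in> L" for t a using fin that by (intro Max_ge) force+
    then show ?thesis using 3 by (intro exI[of _ "Max (snd ` L) + 1"]) (fastforce simp: holds_def)
  next
    case 4
    define p where "p = Max (snd ` L)"
    define q where "q = Min (snd ` U)"
    have p: "a \<le> p" if "(s, a) \<in> L" for s a unfolding p_def using fin that by (intro Max_ge) force+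
    have q: "q \<le> b" if "(t, b) \<in> U" for t b unfolding q_def using fin that by (intro Min_le) force+
    have "p \<in> snd ` L" "q \<in> snd ` U" unfolding p_def q_def using fin 4 by (auto intro: Max_in Min_in)
    then obtain s0 t0 where *: "(s0, p) \<in> L" "(t0, q) \<in> U" by auto
    have pq: "p \<le> q" using assms(3)[OF *] by (auto simp: holds_def split: if_splits)
    have "holds s ((p + q) / 2 - a)" if "(s, a) \<in> L" for s a
      using p[OF that] pq assms(3)[OF that *(2)] by (auto simp: holds_def split: if_splits)
    moreover have "holds t (b - (p + q) / 2)" if "(t, b) \<in> U" for t b
      using q[OF that] pq assms(3)[OF *(1) that] by (auto simp: holds_def split: if_splits)
    ultimately show ?thesis by blast
  qed auto
qed

lemma in_eliminate:
  "a \<in> set (eliminate A) \<longleftrightarrow>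
    (\<exists>s t. (s, 0 # t) \<in> set A \<and> a = (s, t)) \<or>
    (\<exists>s h t s' h' t'. (s, h # t) \<in> set A \<and> (s', h' # t') \<in> set A \<and> 0 < h \<and> h' < 0 \<and>
       a = (s \<or> s', map (\<lambda>p. h * snd p - h' * fst p) (zip t t')))"
    (is "?l \<longleftrightarrow> ?r")
proof
  assume ?l
  then show ?r
    by (fastforce simp: eliminate_def combine_def split: list.splits if_splits)
next
  assume ?r
  then show ?l
  proof (elim disjE exE conjE)
    fix s t assume "(s, 0 # t) \<in> set A" "a = (s, t)"
    then show ?thesis unfolding eliminate_def set_concat set_map image_image by (intro UN_I[of "(s, 0 # t)"]) auto
  next
    fix s h t s' h' t' assume *: "(s, h # t) \<in> set A" "(s', h' # t') \<in> set A" "0 < h" "h' < 0"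
       "a = (s \<or> s', map (\<lambda>p. h * snd p - h' * fst p) (zip t t'))"
    then have "a \<in> set (combine h (s, t) (s', h' # t'))" by (simp add: combine_def)
    then show ?thesis unfolding eliminate_def set_concat set_map image_image using *
      by (intro UN_I[of "(s, h # t)"]) auto
  qed
qed

lemma length_eliminate:
  assumes "\<forall>a\<in>set A. length (snd a) = Suc n"
  shows "\<forall>a\<in>set (eliminate A). length (snd a) = n"
proof
  fix a assume "a \<in> set (eliminate A)"
  then consider s t where "(s, 0 # t) \<in> set A" "a = (s, t)"
    | s h t s' h' t' where "(s, h # t) \<in> set A" "(s', h' # t') \<in> set A"
     "a = (s \<or> s', map (\<lambda>p. h * snd p - h' * fst p) (zip t t'))"
    unfolding in_eliminate by blast
  then show "length (snd a) = n"
  proof cases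
    case 1
    then show ?thesis using bspec[OF assms 1(1)] by simp
  next
    case 2
    then show ?thesis using bspec[OF assms 2(1)] bspec[OF assms 2(2)] by simp
  qed
qed

lemma dot_combination:
  "length t = length v \<Longrightarrow> length t' = length v \<Longrightarrow>
    dot (map (\<lambda>p. h * snd p - h' * fst p) (zip t t')) v = h * dot t' v - h' * dot t v"
  by (induction t v arbitrary: t' rule: list_induct2) (auto simp: length_Suc_conv algebra_simps)

lemma holds_lower: "0 < h \<Longrightarrow> holds s (h * w + r) \<longleftrightarrow> holds s (w - (- r / h))"
  using holds_scale[of h s "w - (- r / h)"] by (simp add: algebra_simps)

lemma holds_upper: "h < 0 \<Longrightarrow> holds s (h * w + r) \<longleftrightarrow> holds s ((- r / h) - w)"
  using holds_scale[of "- h" s "(- r / h) - w"] by (simp add: algebra_simps)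

lemma holds_disj: "holds s r \<Longrightarrow> holds s' r' \<Longrightarrow> holds (s \<or> s') (r + r')"
  by (auto simp: holds_def split: if_splits)

text \<open>Division by the leading coefficient turns a constraint into a lower or an upper bound
  for \<open>w\<close>, and the resolvents compare every lower bound with every upper one.\<close>

lemma sat_eliminate:
  assumes len: "\<forall>a\<in>set A. length (snd a) = Suc (length v)"
  shows "sat v (eliminate A) \<longleftrightarrow> (\<exists>w. sat (w # v) A)"
proof
  assume "\<exists>w. sat (w # v) A"
  then obtain w where w: "\<And>s h t. (s, h # t) \<in> set A \<Longrightarrow> holds s (h * w + dot t v)"
    by (fastforce simp: sat_def)
  show "sat v (eliminate A)"
    unfolding sat_def
  proof
    fix a assume "a \<in> set (eliminate A)"
    then consider s t where "(s, 0 # t) \<in> set A" "a = (s, t)"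
      | s h t s' h' t' where "(s, h # t) \<in> set A" "(s', h' # t') \<in> set A" "0 < h" "h' < 0"
       "a = (s \<or> s', map (\<lambda>p. h * snd p - h' * fst p) (zip t t'))"
      unfolding in_eliminate by blast
    then show "holds (fst a) (dot (snd a) v)"
    proof cases
      case 1
      then show ?thesis using w[of s 0 t] by simp
    next
      case 2
      have l: "length t = length v" "length t' = length v" using len 2 by force+
      have "holds s ((- h') * (h * w + dot t v))" "holds s' (h * (h' * w + dot t' v))"
        using w[OF 2(1)] w[OF 2(2)] 2(3,4) by (simp_all only: holds_scale neg_0_less_iff_less)
      from holds_disj[OF this] show ?thesis
        unfolding 2(5) fst_conv snd_conv dot_combination[OF l] by (simp add: algebra_simps)
    qed
  qed
next
  assume sat: "sat v (eliminate A)"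
  define L where "L = {(s, - dot t v / h) | s h t. (s, h # t) \<in> set A \<and> 0 < h}"
  define U where "U = {(s, - dot t v / h) | s h t. (s, h # t) \<in> set A \<and> h < 0}"
  have "L \<subseteq> (\<lambda>a. (fst a, - dot (tl (snd a)) v / hd (snd a))) ` set A"
    "U \<subseteq> (\<lambda>a. (fst a, - dot (tl (snd a)) v / hd (snd a))) ` set A"
    unfolding L_def U_def by force+
  then have fin: "finite L" "finite U" by (auto intro: finite_subset)
  have "holds (s \<or> s') (b - a)" if mem: "(s, a) \<in> L" "(s', b) \<in> U" for s a s' b
  proof -
    obtain h t h' t' where *: "(s, h # t) \<in> set A" "0 < h" "a = - dot t v / h"
      "(s', h' # t') \<in> set A" "h' < 0" "b = - dot t' v / h'"
      using mem unfolding L_def U_def by blast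
    have l: "length t = length v" "length t' = length v" using len * by force+
    have "(s \<or> s', map (\<lambda>p. h * snd p - h' * fst p) (zip t t')) \<in> set (eliminate A)"
      unfolding in_eliminate using * by blast
    then have 1: "holds (s \<or> s') (h * dot t' v - h' * dot t v)"
      using sat dot_combination[OF l] unfolding sat_def by fastforce
    \<comment> \<open>The resolvent is the gap between the two bounds times the positive number
      \<open>h * - h'\<close>.\<close>
    have "(h * - h') * (b - a) = h' * (h * a) - h * (h' * b)" by (simp add: algebra_simps)
    also have "\<dots> = h * dot t' v - h' * dot t v" using * by simp
    finally have "h * dot t' v - h' * dot t v = (h * - h') * (b - a)" by simp
    moreover have "0 < h * - h'" using * by (intro mult_pos_pos) auto
    ultimately show ?thesis using 1 holds_scale by metis
  qed
  from between_bounds[OF fin this] obtain w where w: "\<forall>(s, a)\<in>L. holds s (w - a)" "\<forall>(t, b)\<in>U. holds t (b - w)" by blast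
  have "holds (fst a) (dot (snd a) (w # v))" if a: "a \<in> set A" for a
  proof -
    obtain s h t where sht: "a = (s, h # t)" using len a by (cases a) (auto simp: length_Suc_conv)
    consider "h = 0" | "0 < h" | "h < 0" by linarith
    then show ?thesis
    proof cases
      case 1
      then have "(s, t) \<in> set (eliminate A)" using a sht unfolding in_eliminate by blast
      then show ?thesis using sat 1 sht unfolding sat_def by fastforce
    next
      case 2
      then have "(s, - dot t v / h) \<in> L" using a sht unfolding L_def by blast
      then show ?thesis using w(1) sht holds_lower[OF 2] by auto
    next
      case 3
      then have "(s, - dot t v / h) \<in> U" using a sht unfolding U_def by blast
      then show ?thesis using w(2) sht holds_upper[OF 3] by auto
    qed
  qed
  then show "\<exists>w. sat (w # v) A" unfolding sat_def by blast
qed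

lemma length_eliminates:
  "\<forall>a\<in>set A. length (snd a) = length G + n \<Longrightarrow> \<forall>a\<in>set (fold (\<lambda>_ C. eliminate C) G A). length (snd a) = n"
proof (induction G arbitrary: A)
  case (Cons g G)
  then have "\<forall>a\<in>set A. length (snd a) = Suc (length G + n)" by simp
  from Cons.IH[OF length_eliminate[OF this]] show ?case by simp
qed simp

lemma sat_eliminates:
  "\<forall>a\<in>set A. length (snd a) = length G + length v \<Longrightarrow>
    sat v (fold (\<lambda>_ C. eliminate C) G A) \<longleftrightarrow> (\<exists>ws. length ws = length G \<and> sat (ws @ v) A)"
proof (induction G arbitrary: A)
  case (Cons g G)
  have 1: "\<forall>a\<in>set (eliminate A). length (snd a) = length G + length v"
    using Cons.prems by (intro length_eliminate) simp
  have "sat (ws @ v) (eliminate A) \<longleftrightarrow> (\<exists>w. sat (w # ws @ v) A)" if "length ws = length G" for ws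
    using Cons.prems that by (intro sat_eliminate) simp
  then have "sat v (fold (\<lambda>_ C. eliminate C) (g # G) A) \<longleftrightarrow> (\<exists>ws w. length ws = length G \<and> sat (w # ws @ v) A)"
    using Cons.IH[OF 1] by auto
  also have "\<dots> \<longleftrightarrow> (\<exists>ws. length ws = length (g # G) \<and> sat (ws @ v) A)"
  proof
    assume "\<exists>ws w. length ws = length G \<and> sat (w # ws @ v) A"
    then obtain ws w where "length ws = length G" "sat (w # ws @ v) A" by blast
    then show "\<exists>ws. length ws = length (g # G) \<and> sat (ws @ v) A" by (intro exI[of _ "w # ws"]) simp
  next
    assume "\<exists>ws. length ws = length (g # G) \<and> sat (ws @ v) A"
    then obtain ws where "length ws = length (g # G)" "sat (ws @ v) A" by blast
    then show "\<exists>ws w. length ws = length G \<and> sat (w # ws @ v) A"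
      by (cases ws) auto
  qed
  finally show ?case .
qed simp

lemma length_add_generators:
  assumes "\<forall>a\<in>set A. length (snd a) = length z" "\<forall>b\<in>set B. length (snd b) = length G"
  shows "\<forall>a\<in>set (add_generators G B z A). length (snd a) = length z"
  unfolding add_generators_def using assms by (intro length_eliminates) auto

lemma sat_add_generators:
  assumes "\<forall>a\<in>set A. length (snd a) = length v" "\<forall>b\<in>set B. length (snd b) = length G"
    "length z = length v" "\<forall>x\<in>set z. x = 0"
  shows "sat v (add_generators G B z A) \<longleftrightarrow> (\<exists>ws. length ws = length G \<and> sat ws B \<and>
    (\<forall>a\<in>set A. holds (fst a) (dot (snd a) v - dot (map (dot (snd a)) G) ws)))"
proof -
  let ?C = "map (\<lambda>a. (fst a, map (\<lambda>g. - dot (snd a) g) G @ snd a)) A @ map (\<lambda>b. (fst b, snd b @ z)) B"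
  have z: "z = map (\<lambda>_. 0) z" using assms(4) by (simp add: map_idI)
  have "sat (ws @ v) ?C \<longleftrightarrow> sat ws B \<and>
    (\<forall>a\<in>set A. holds (fst a) (dot (snd a) v - dot (map (dot (snd a)) G) ws))" if ws: "length ws = length G" for ws
  proof -
    have "dot (map (\<lambda>g. - dot l g) G @ l) (ws @ v) = dot l v - dot (map (dot l) G) ws" for l
      using ws by (subst dot_append) (auto simp: dot_map_uminus)
    moreover have "dot (snd b @ z) (ws @ v) = dot (snd b) ws" if "b \<in> set B" for b
      using ws assms(2) that by (subst z, subst dot_append) auto
    then have "sat (ws @ v) (map (\<lambda>b. (fst b, snd b @ z)) B) \<longleftrightarrow> sat ws B" by (simp add: sat_def)
    ultimately show ?thesis unfolding sat_append by (auto simp: sat_def[of "ws @ v"])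
  qed
  then show ?thesis unfolding add_generators_def
    using assms by (subst sat_eliminates) auto
qed

section \<open>Meaning of formulas and of the worklist\<close>

fun qf_holds :: "real list qf \<Rightarrow> real list \<Rightarrow> bool" where
  "qf_holds (EqAt a c) y \<longleftrightarrow> dot a y = c"
| "qf_holds (LeAt a c) y \<longleftrightarrow> dot a y \<le> c"
| "qf_holds (LessAt a c) y \<longleftrightarrow> dot a y < c"
| "qf_holds (NotF F) y \<longleftrightarrow> \<not> qf_holds F y"
| "qf_holds (AndF F G) y \<longleftrightarrow> qf_holds F y \<and> qf_holds G y"
| "qf_holds (OrF F G) y \<longleftrightarrow> qf_holds F y \<or> qf_holds G y"

text \<open>A branch is read as a conjunction of its signed formulas and constraints, a state as the
  disjunction of its open and finished branches. This reading is the loop invariant of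
  \<open>dnf\<close>.\<close>

definition branch_sem :: "real list \<Rightarrow> branch \<Rightarrow> bool" where
  "branch_sem y br \<longleftrightarrow> (\<forall>it\<in>set (fst br). qf_holds (snd it) y = fst it) \<and> sat (1 # y) (snd br)"

definition state_sem :: "real list \<Rightarrow> branch list \<times> constr list list \<Rightarrow> bool" where
  "state_sem y s \<longleftrightarrow> (\<exists>br\<in>set (fst s). branch_sem y br) \<or> (\<exists>A\<in>set (snd s). sat (1 # y) A)"

definition state_dim :: "nat \<Rightarrow> branch list \<times> constr list list \<Rightarrow> bool" where
  "state_dim d s \<longleftrightarrow> (\<forall>br\<in>set (fst s). (\<forall>it\<in>set (fst br). \<forall>a\<in>set_qf (snd it). length a = d) \<and>
     (\<forall>a\<in>set (snd br). length (snd a) = Suc d)) \<and> (\<forall>A\<in>set (snd s). \<forall>a\<in>set A. length (snd a) = Suc d)"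

lemma dnf_step_sem: "state_sem y (dnf_step s) = state_sem y s"
proof -
  obtain W D where s: "s = (W, D)" by (cases s)
  show ?thesis
  proof (cases W)
    case (Cons br w)
    obtain todo cs where br: "br = (todo, cs)" by (cases br)
    show ?thesis
    proof (cases todo)
      case Nil
      then show ?thesis using s Cons br by (auto simp: dnf_step_def state_sem_def branch_sem_def)
    next
      case (Cons it t)
      obtain b F where it: "it = (b, F)" by (cases it)
      show ?thesis using s \<open>W = br # w\<close> br Cons it
        by (cases F) (auto simp: dnf_step_def state_sem_def branch_sem_def sat_Cons holds_def dot_neg)
    qed
  qed (simp add: s dnf_step_def)
qed

lemma dnf_step_dim: "state_dim d s \<Longrightarrow> state_dim d (dnf_step s)"
proof -
  assume d: "state_dim d s"
  obtain W D where s: "s = (W, D)" by (cases s)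
  show ?thesis
  proof (cases W)
    case (Cons br w)
    obtain todo cs where br: "br = (todo, cs)" by (cases br)
    show ?thesis
    proof (cases todo)
      case Nil
      then show ?thesis using d s Cons br by (auto simp: dnf_step_def state_dim_def)
    next
      case (Cons it t)
      obtain b F where it: "it = (b, F)" by (cases it)
      show ?thesis using d s \<open>W = br # w\<close> br Cons it
        by (cases F) (auto simp: dnf_step_def state_dim_def)
    qed
  qed (use d in \<open>simp add: s dnf_step_def\<close>)
qed

lemma dnf_correct:
  assumes "\<forall>a\<in>set_qf F. length a = d"
  shows "(\<exists>A\<in>set (dnf F). sat (1 # y) A) \<longleftrightarrow> qf_holds F y"
    and "A \<in> set (dnf F) \<Longrightarrow> a \<in> set A \<Longrightarrow> length (snd a) = Suc d"
proof -
  let ?b = "\<lambda>s :: branch list \<times> constr list list. case fst s of [] \<Rightarrow> False | _ # _ \<Rightarrow> True"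
  let ?s0 = "([([(True, F)], [])], [])"
  let ?P = "\<lambda>s. (\<forall>y. state_sem y s = qf_holds F y) \<and> state_dim d s"
  have "?P (while ?b dnf_step ?s0) \<and> \<not> ?b (while ?b dnf_step ?s0)"
  proof (rule while_rule[where P = ?P and r = "Wellfounded.measure (\<lambda>s. \<Sum>br\<leftarrow>fst s. qf_weight br)"])
    show "?P ?s0" using assms by (simp add: state_sem_def branch_sem_def state_dim_def sat_def)
  qed (auto simp: dnf_step_sem dnf_step_dim dnf_step_less)
  then have *: "?P (while ?b dnf_step ?s0)" "fst (while ?b dnf_step ?s0) = []" by (auto split: list.splits)
  then show "(\<exists>A\<in>set (dnf F). sat (1 # y) A) \<longleftrightarrow> qf_holds F y"
    unfolding dnf_def by (auto simp: state_sem_def)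
  show "A \<in> set (dnf F) \<Longrightarrow> a \<in> set A \<Longrightarrow> length (snd a) = Suc d"
    using * unfolding dnf_def by (auto simp: state_dim_def)
qed

lemma dot_linear:
  "dot l (map (\<lambda>i. u * f i + v * g i) J) = u * dot l (map f J) + v * dot l (map g J)"
  by (induction l J rule: list_induct2') (auto simp: algebra_simps)

lemma dot_neg_right: "dot l (neg v) = - dot l v"
  unfolding neg_def by (induction l v rule: list_induct2') auto

lemma holds_add:
  assumes "holds s a" "holds s b" "0 \<le> u" "0 \<le> v" "u + v = 1"
  shows "holds s (u * a + v * b)"
proof (cases s)
  case True
  then have ab: "0 < a" "0 < b" using assms by (auto simp: holds_def)
  have "0 < u * a + v * b"
  proof (cases "u = 0")
    case False
    then have "0 < u * a" "0 \<le> v * b" using ab assms by auto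
    then show ?thesis by linarith
  qed (use ab assms in simp)
  then show ?thesis using True by (simp add: holds_def)
qed (use assms in \<open>simp add: holds_def\<close>)

lemma fold_const: "fold (\<lambda>_. f) xs = f ^^ length xs"
  by (induction xs) (auto simp: fun_eq_iff funpow_swap1)

lemma flow_0_iff: "flow \<Omega> \<P> 0 U b x \<longleftrightarrow> U = {} \<and> (\<forall>\<sigma>\<in>\<Omega>. b \<sigma> = 0) \<and> x = 0"
  by (auto elim: flow.cases intro: flow.base)

text \<open>Read backwards, the last firing subtracts an element of its cone from balance and value.
  This is the form in which \<open>add_generators\<close> computes.\<close>

lemma flow_Suc_iff: "flow \<Omega> \<P> (Suc n) U c y \<longleftrightarrow> flow \<Omega> \<P> n U c y \<or>
  (\<exists>k Q C V b' x'. (k, Q, C) \<in> \<P> \<and> flow \<Omega> \<P> n V (\<lambda>\<sigma>. c \<sigma> - b' \<sigma>) (y - x') \<and> Q \<subseteq> V \<and> (b', x') \<in> C \<and> U = insert k V)"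
  (is "?l \<longleftrightarrow> ?r")
proof
  assume ?l
  then show ?r
  proof (cases rule: flow.cases)
    case (step V b x k Q C b' x')
    have "flow \<Omega> \<P> n V (\<lambda>\<sigma>. c \<sigma> - b' \<sigma>) (y - x')" using step by (auto intro: flow_cong)
    then show ?thesis using step by blast
  qed auto
next
  assume ?r
  then show ?l
  proof (elim disjE exE conjE)
    fix k Q C V b' x' assume "(k, Q, C) \<in> \<P>" "flow \<Omega> \<P> n V (\<lambda>\<sigma>. c \<sigma> - b' \<sigma>) (y - x')" "Q \<subseteq> V" "(b', x') \<in> C" "U = insert k V"
    then show ?l using flow.step[of \<Omega> \<P> n V "\<lambda>\<sigma>. c \<sigma> - b' \<sigma>" "y - x'" k Q C b' x' c y] by simp
  qed (rule flow.weaken)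
qed

section \<open>Coordinates of the space\<close>

definition coords :: "'a::euclidean_space list \<Rightarrow> 'a \<Rightarrow> real list" where
  "coords bs x = map (\<lambda>b. x \<bullet> b) bs"

definition point :: "'a::euclidean_space list \<Rightarrow> real list \<Rightarrow> 'a" where
  "point bs y = (\<Sum>i<length bs. y ! i *\<^sub>R bs ! i)"

lemma sum_basis:
  assumes "distinct bs" "set bs = Basis"
  shows "(\<Sum>i<length bs. f (bs ! i)) = (\<Sum>b\<in>Basis. f b)"
  using sum.reindex_bij_betw[OF bij_betw_nth[OF assms(1) refl refl], of f] assms(2) by simp

lemma coords_point:
  assumes "distinct bs" "set bs = Basis" "length y = length bs"
  shows "coords bs (point bs y) = y"
proof (rule nth_equalityI)
  fix j assume "j < length (coords bs (point bs y))"
  then have j: "j < length bs" by (simp add: coords_def)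
  have "point bs y \<bullet> bs ! j = (\<Sum>i<length bs. y ! i * (bs ! i \<bullet> bs ! j))" by (simp add: point_def inner_sum_left)
  also have "\<dots> = (\<Sum>i<length bs. if i = j then y ! i else 0)"
    using assms j by (intro sum.cong) (auto simp: inner_Basis nth_eq_iff_index_eq nth_mem[of _ bs, unfolded assms(2)])
  also have "\<dots> = y ! j" using j by simp
  finally show "coords bs (point bs y) ! j = y ! j" using j by (simp add: coords_def)
qed (use assms(3) in \<open>simp add: coords_def\<close>)

lemma point_coords:
  assumes "distinct bs" "set bs = Basis"
  shows "point bs (coords bs x) = x"
  using sum_basis[OF assms, of "\<lambda>b. (x \<bullet> b) *\<^sub>R b"]
  by (simp add: point_def coords_def euclidean_representation)

lemma dot_coords:
  assumes "distinct bs" "set bs = Basis"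
  shows "dot (coords bs a) (coords bs x) = a \<bullet> x"
  using sum_basis[OF assms, of "\<lambda>b. (a \<bullet> b) * (x \<bullet> b)"]
  by (simp add: dot_sum coords_def euclidean_inner[of a x])

locale lin_system =
  fixes bs :: "'a::euclidean_space list" and \<Omega>v \<Omega>p :: "'s set" and I :: "'s system"
    and P X :: "'s \<Rightarrow> 'a set" and ps :: "'s list" and Fs :: "real list qf list"
  assumes bs: "distinct bs" "set bs = Basis"
    and alph': "alphabet \<Omega>v \<Omega>p" and sys': "ineq_system \<Omega>v \<Omega>p I"
    and small': "smallest_solution \<Omega>v \<Omega>p I P X"
    and ps: "distinct ps" "set ps = \<Omega>p"
    and Fs: "length Fs = length ps" "\<And>j. j < length ps \<Longrightarrow> P (ps ! j) = {x. qf_holds (Fs ! j) (coords bs x)}"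
      "\<And>F a. F \<in> set Fs \<Longrightarrow> a \<in> set_qf F \<Longrightarrow> length a = length bs"
begin

abbreviation crd :: "'a \<Rightarrow> real list" where "crd \<equiv> coords bs"

definition cell :: "constr list \<Rightarrow> 'a set" where "cell c = {x. sat (1 # crd x) c}"

text \<open>The cells are the branches of the normal form; each is a conjunction of affine
  inequalities, hence convex. Cells may overlap.\<close>

definition cells_of :: "'s \<Rightarrow> 'a set set" where
  "cells_of p = {cell c | c F. (F, p) \<in> set (zip Fs ps) \<and> c \<in> set (dnf F)}"

lemma crd_linear: "dot l ((u * s + v * t) # crd (u *\<^sub>R x + v *\<^sub>R y)) = u * dot l (s # crd x) + v * dot l (t # crd y)"
proof (cases l)
  case (Cons a k)
  show ?thesis using dot_linear[of k u "\<lambda>b. x \<bullet> b" v "\<lambda>b. y \<bullet> b" bs]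
    by (simp add: Cons coords_def inner_add_left algebra_simps)
qed simp

lemma convex_cell: "convex (cell c)"
proof (rule convexI)
  fix x y :: 'a and u v :: real
  assume *: "x \<in> cell c" "y \<in> cell c" "0 \<le> u" "0 \<le> v" "u + v = 1"
  have "holds (fst a) (dot (snd a) (1 # crd (u *\<^sub>R x + v *\<^sub>R y)))" if "a \<in> set c" for a
    using crd_linear[of "snd a" u 1 v 1 x y] * that holds_add[of "fst a"] by (simp add: cell_def sat_def)
  then show "u *\<^sub>R x + v *\<^sub>R y \<in> cell c" by (simp add: cell_def sat_def)
qed

lemma zip_mem: "(F, p) \<in> set (zip Fs ps) \<Longrightarrow> F \<in> set Fs \<and> p \<in> \<Omega>p \<and> P p = {x. qf_holds F (crd x)}"
  using Fs(1,2) ps(2) by (fastforce simp: in_set_zip)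

lemma dnf_mem:
  assumes "(F, p) \<in> set (zip Fs ps)"
  shows "(\<exists>c\<in>set (dnf F). x \<in> cell c) \<longleftrightarrow> x \<in> P p"
    "c \<in> set (dnf F) \<Longrightarrow> a \<in> set c \<Longrightarrow> length (snd a) = Suc (length bs)"
proof -
  have F: "\<forall>a\<in>set_qf F. length a = length bs" using Fs(3) zip_mem[OF assms] by auto
  show "(\<exists>c\<in>set (dnf F). x \<in> cell c) \<longleftrightarrow> x \<in> P p"
    using dnf_correct(1)[OF F, of "crd x"] zip_mem[OF assms] by (simp add: cell_def)
  show "c \<in> set (dnf F) \<Longrightarrow> a \<in> set c \<Longrightarrow> length (snd a) = Suc (length bs)"
    using dnf_correct(2)[OF F] .
qed

sublocale conv_system \<Omega>v \<Omega>p I P X cells_of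
proof
  fix p assume "p \<in> \<Omega>p"
  then obtain j where j: "j < length ps" "p = ps ! j" using ps(2) by (metis in_set_conv_nth)
  then have zip: "(Fs ! j, p) \<in> set (zip Fs ps)" using Fs(1) by (force simp: in_set_zip)
  have "x \<in> \<Union>(cells_of p) \<longleftrightarrow> x \<in> P p" for x
  proof
    assume "x \<in> \<Union>(cells_of p)"
    then obtain c F where "(F, p) \<in> set (zip Fs ps)" "c \<in> set (dnf F)" "x \<in> cell c" unfolding cells_of_def by blast
    then show "x \<in> P p" using dnf_mem(1)[of F p x] by blast
  next
    assume "x \<in> P p"
    then obtain c where "c \<in> set (dnf (Fs ! j))" "x \<in> cell c" using dnf_mem(1)[OF zip] by blast
    then show "x \<in> \<Union>(cells_of p)" using zip unfolding cells_of_def by blast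
  qed
  then show "\<Union>(cells_of p) = P p" by blast
next
  fix p T assume "p \<in> \<Omega>p" "T \<in> cells_of p"
  then show "convex T" unfolding cells_of_def using convex_cell by auto
qed (use alph' sys' small' in auto)

section \<open>Coordinates of flows\<close>

definition ss :: "'s list" where "ss = map fst I @ ps"

definition J :: "('s + 'a) list" where "J = map Inl ss @ map Inr bs"

definition vec :: "('s \<Rightarrow> real) \<Rightarrow> 'a \<Rightarrow> real list" where
  "vec b x = map (case_sum b (\<lambda>c. x \<bullet> c)) J"

definition zb :: "real list" where "zb = map (\<lambda>_. 0) bs"
definition zJ :: "real list" where "zJ = map (\<lambda>_. 0) J"

definition S :: "real list list list list" where
  "S = map (\<lambda>(x, \<phi>). map (map (\<lambda>E. map E ss)) \<phi>) I"

definition E :: "real list list" where "E = units (map (\<lambda>_. 0) S @ map (\<lambda>_. 0) Fs @ zb)"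

definition V :: "real list list" where "V = map (\<lambda>c. vec (\<lambda>_. 0) c) bs"

lemma ss: "distinct ss" "set ss = \<Omega>"
  using sys ps fin(4) by (auto simp: ineq_system_def ss_def)

lemma distinct_J: "distinct J"
  using ss bs by (auto simp: J_def distinct_map)

lemma length_J [simp]: "length (vec b x) = length J" "length zJ = length J"
  by (auto simp: vec_def zJ_def)

lemma vec_append: "vec b x = map b ss @ crd x"
  by (simp add: vec_def J_def coords_def)

lemma dot_vec_linear:
  "dot l (vec (\<lambda>\<sigma>. u * b \<sigma> + v * c \<sigma>) (u *\<^sub>R x + v *\<^sub>R y)) = u * dot l (vec b x) + v * dot l (vec c y)"
proof -
  have "vec (\<lambda>\<sigma>. u * b \<sigma> + v * c \<sigma>) (u *\<^sub>R x + v *\<^sub>R y) =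
     map (\<lambda>i. u * case_sum b (\<lambda>c. x \<bullet> c) i + v * case_sum c (\<lambda>c. y \<bullet> c) i) J"
    unfolding vec_def by (rule map_cong) (auto simp: inner_add_left split: sum.split)
  then show ?thesis unfolding vec_def by (simp only: dot_linear)
qed

lemma dot_vec_diff: "dot l (vec (\<lambda>\<sigma>. b \<sigma> - c \<sigma>) (x - y)) = dot l (vec b x) - dot l (vec c y)"
  using dot_vec_linear[of l 1 b "-1" c x y] by simp

lemma dot_vec_0: "dot l (vec (\<lambda>_. 0) 0) = 0"
  using dot_vec_linear[of l 0 "\<lambda>_. 0" 0 "\<lambda>_. 0" 0 0] by simp

lemma dot_vec_sum:
  "finite A \<Longrightarrow> dot l (vec (\<lambda>\<sigma>. \<Sum>i\<in>A. w i * f i \<sigma>) (\<Sum>i\<in>A. w i *\<^sub>R y i)) = (\<Sum>i\<in>A. w i * dot l (vec (f i) (y i)))"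
proof (induction A rule: finite_induct)
  case (insert i A)
  then show ?case
    using dot_vec_linear[of l "w i" "f i" 1 "\<lambda>\<sigma>. \<Sum>i\<in>A. w i * f i \<sigma>" "y i" "\<Sum>i\<in>A. w i *\<^sub>R y i"] by simp
qed (simp add: dot_vec_0)

lemma E_eq: "E = map (\<lambda>\<sigma>. vec (\<delta> \<sigma>) 0) (map fst I) @ map (\<lambda>p. vec (\<delta> p) 0) ps @ V"
proof -
  have len: "length (map (\<lambda>_. 0) S @ map (\<lambda>_. 0) Fs @ zb) = length J"
    using Fs(1) by (simp add: S_def zb_def J_def ss_def)
  have "E = map (\<lambda>i. map (\<lambda>i'. if i' = i then 1 else 0) J) J"
    using distinct_J len by (intro nth_equalityI) (auto simp: E_def units_nth nth_eq_iff_index_eq intro!: nth_equalityI)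
  also have "\<dots> = map (\<lambda>\<sigma>. vec (\<delta> \<sigma>) 0) ss @ V"
  proof -
    have "(\<lambda>i'. if i' = Inl \<sigma> then 1 else 0) = case_sum (\<delta> \<sigma>) (\<lambda>c. 0 \<bullet> c)" for \<sigma> :: 's
      by (auto simp: fun_eq_iff \<delta>_def split: sum.split)
    moreover have "map (\<lambda>i'. if i' = Inr c then 1 else 0) J = vec (\<lambda>_. 0) c" if "c \<in> set bs" for c
      unfolding vec_def using that bs by (intro map_cong) (auto simp: J_def inner_Basis split: if_splits)
    ultimately show ?thesis by (auto simp: J_def V_def vec_def[of _ 0] \<delta>_def)
  qed
  finally show ?thesis by (simp add: ss_def)
qed

lemma length_E: "length E = length J" by (simp add: E_eq J_def ss_def V_def)

lemma zip_S: "zip S E = map (\<lambda>(x, \<phi>). (map (map (\<lambda>E. map E ss)) \<phi>, vec (\<delta> x) 0)) I"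
  unfolding E_eq S_def by (simp add: zip_append2 zip_map_map zip_same_conv_map case_prod_unfold)

lemma drop_E: "drop (length S) E = map (\<lambda>p. vec (\<delta> p) 0) ps @ V"
  "drop (length Fs) (drop (length S) E) = V"
  unfolding E_eq S_def using Fs(1) by simp_all

lemma zip_Fs: "zip Fs (drop (length S) E) = map (\<lambda>(F, p). (F, vec (\<delta> p) 0)) (zip Fs ps)"
  unfolding drop_E using Fs(1) by (simp add: zip_append2 zip_map2)

text \<open>Indices of the productions, in the order in which the solver lists them. Different
  indices may denote the same abstract production, so their number is an upper bound for the number
  of productions.\<close>

definition keys :: "('s \<times> 's mono + 's \<times> constr list) list" where
  "keys = concat (map (\<lambda>(k, \<phi>). map (\<lambda>M. Inl (k, M)) \<phi>) I) @
     concat (map (\<lambda>(F, p). map (\<lambda>c. Inr (p, c)) (dnf F)) (zip Fs ps))"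

definition list_prod :: "'s \<times> 's mono + 's \<times> constr list \<Rightarrow> list_production" where
  "list_prod = case_sum (\<lambda>(k, M). mono_prod zb (vec (\<delta> k) 0) (map (\<lambda>E. map E ss) M))
      (\<lambda>(p, c). cell_prod zb V (vec (\<delta> p) 0) c)"

definition abs_prod :: "'s \<times> 's mono + 's \<times> constr list \<Rightarrow> 's \<times> 's set \<times> (('s \<Rightarrow> real) \<times> 'a) set" where
  "abs_prod = case_sum (\<lambda>(k, M). (k, msupp \<Omega> M, mono_cone k M)) (\<lambda>(p, c). (p, {}, cell_cone p (cell c)))"

lemma prods_eq: "prods zb S Fs E = map list_prod keys"
  unfolding prods_def zip_Fs zip_S drop_E(2)
  by (simp add: keys_def list_prod_def map_concat o_def case_prod_unfold)

lemma keys_mem: "Inl (k, M) \<in> set keys \<longleftrightarrow> mon k M"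
  "Inr (p, c) \<in> set keys \<longleftrightarrow> (\<exists>F. (F, p) \<in> set (zip Fs ps) \<and> c \<in> set (dnf F))"
  by (force simp: keys_def mon_def)+

lemma \<P>_eq: "\<P> = abs_prod ` set keys"
proof (intro equalityI subsetI)
  fix q assume "q \<in> \<P>"
  then consider k M where "mon k M" "q = (k, msupp \<Omega> M, mono_cone k M)"
    | p T where "p \<in> \<Omega>p" "T \<in> cells_of p" "q = (p, {}, cell_cone p T)"
    unfolding \<P>_def by blast
  then show "q \<in> abs_prod ` set keys"
  proof cases
    case 1
    then show ?thesis using keys_mem(1)[of k M] by (intro image_eqI[of _ _ "Inl (k, M)"]) (auto simp: abs_prod_def)
  next
    case 2
    then obtain c F where "(F, p) \<in> set (zip Fs ps)" "c \<in> set (dnf F)" "T = cell c" unfolding cells_of_def by blast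
    then show ?thesis using keys_mem(2)[of p c] 2(3) by (intro image_eqI[of _ _ "Inr (p, c)"]) (auto simp: abs_prod_def)
  qed
next
  fix q assume "q \<in> abs_prod ` set keys"
  then obtain \<kappa> where k: "\<kappa> \<in> set keys" "q = abs_prod \<kappa>" by auto
  show "q \<in> \<P>"
  proof (cases \<kappa>)
    case (Inl a)
    then show ?thesis using k keys_mem(1)[of "fst a" "snd a"] unfolding \<P>_def abs_prod_def by (auto simp: case_prod_unfold)
  next
    case (Inr a)
    then obtain F where F: "(F, fst a) \<in> set (zip Fs ps)" "snd a \<in> set (dnf F)" using k keys_mem(2)[of "fst a" "snd a"] by auto
    then have "cell (snd a) \<in> cells_of (fst a)" "fst a \<in> \<Omega>p" using zip_mem unfolding cells_of_def by blast+
    then show ?thesis using k Inr unfolding \<P>_def abs_prod_def by (auto simp: case_prod_unfold)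
  qed
qed

section \<open>List productions implement the abstract ones\<close>

definition support :: "real list \<Rightarrow> 's set" where
  "support U = {ss ! j | j. j < length ss \<and> 0 < U ! j}"

lemma support_nth: "j < length ss \<Longrightarrow> ss ! j \<in> support U \<longleftrightarrow> 0 < U ! j"
  using ss(1) by (auto simp: support_def nth_eq_iff_index_eq)

lemma support_subset: "support U \<subseteq> \<Omega>"
  unfolding support_def ss(2)[symmetric] by auto

text \<open>A simulation relation. The map \<open>cb\<close> sends a coefficient vector to balance
  and value; testing with all \<open>l\<close> says that the coordinates of \<open>cb ws\<close> are
  the combination of the generators with weights \<open>ws\<close>.\<close>

definition implements :: "list_production \<Rightarrow> 's \<times> 's set \<times> (('s \<Rightarrow> real) \<times> 'a) set \<Rightarrow> bool" where
  "implements p q \<longleftrightarrow> fst q \<in> \<Omega> \<and> fst (fst p) = vec (\<delta> (fst q)) 0 \<and>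
     (\<forall>U. length U = length J \<longrightarrow> enabled U (snd (fst p)) = (fst (snd q) \<subseteq> support U)) \<and>
     (\<forall>b\<in>set (snd (snd p)). length (snd b) = length (fst (snd p))) \<and>
     (\<exists>cb. snd (snd q) = cb ` {ws. length ws = length (fst (snd p)) \<and> sat ws (snd (snd p))} \<and>
       (\<forall>ws l. length ws = length (fst (snd p)) \<longrightarrow>
          dot l (vec (fst (cb ws)) (snd (cb ws))) = dot (map (dot l) (fst (snd p))) ws))"

lemma implements_mono:
  assumes "mon k M"
  shows "implements (list_prod (Inl (k, M))) (abs_prod (Inl (k, M)))"
proof -
  let ?M = "map (\<lambda>E. map E ss) M"
  let ?G = "map (\<lambda>E. vec (\<lambda>\<sigma>. E \<sigma> - \<delta> k \<sigma>) 0) M"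
  let ?B = "map (\<lambda>u. (True, u)) (units (map (\<lambda>_. 0) ?M))"
  have G: "map (\<lambda>E. map (\<lambda>p. fst p - snd p) (zip (E @ zb) (vec (\<delta> k) 0))) ?M = ?G"
  proof -
    have "map E ss @ zb = vec E 0" for E by (simp add: vec_append zb_def coords_def)
    then show ?thesis by (simp add: vec_def zip_map_map zip_same_conv_map) (auto split: sum.split)
  qed
  have B: "sat ws ?B \<longleftrightarrow> (\<forall>i<length M. 0 < ws ! i)" if "length ws = length M" for ws
  proof -
    have "sat ws ?B \<longleftrightarrow> (\<forall>i<length M. 0 < dot (units (map (\<lambda>_. 0) ?M) ! i) ws)"
      by (simp add: sat_def holds_def all_set_conv_all_nth)
    then show ?thesis using that by (simp add: dot_unit)
  qed
  define cb where "cb = (\<lambda>ws. (\<lambda>\<sigma>. \<Sum>i<length M. ws ! i * ((M ! i) \<sigma> - \<delta> k \<sigma>), 0 :: 'a))"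
  have bij: "bij_betw ((!) M) {..<length M} (set M)"
    using monD(2)[OF assms] by (intro bij_betw_nth) (auto simp: monomials_def)
  have "mono_cone k M = cb ` {ws. length ws = length M \<and> sat ws ?B}"
  proof (intro equalityI subsetI)
    fix z :: "('s \<Rightarrow> real) \<times> 'a" assume "z \<in> mono_cone k M"
    then obtain w where w: "\<forall>E\<in>set M. 0 < w E" "z = (\<lambda>\<sigma>. \<Sum>E\<in>set M. w E * (E \<sigma> - \<delta> k \<sigma>), 0)" by (auto simp: mono_cone_def)
    have "z = cb (map w M)"
      unfolding w(2) cb_def by (auto simp: fun_eq_iff simp flip: sum.reindex_bij_betw[OF bij])
    moreover have "length (map w M) = length M \<and> sat (map w M) ?B" using w(1) B[of "map w M"] by simp
    ultimately show "z \<in> cb ` {ws. length ws = length M \<and> sat ws ?B}" by blast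
  next
    fix z assume "z \<in> cb ` {ws. length ws = length M \<and> sat ws ?B}"
    then obtain ws where ws: "length ws = length M" "\<forall>i<length M. 0 < ws ! i" "z = cb ws" using B by auto
    define w where "w E = ws ! (inv_into {..<length M} ((!) M) E)" for E
    have wM: "w (M ! i) = ws ! i" if "i < length M" for i
      unfolding w_def using bij that by (simp add: bij_betw_def inv_into_f_f)
    have "\<forall>E\<in>set M. 0 < w E" using wM ws(2) by (auto simp: in_set_conv_nth)
    moreover have "z = (\<lambda>\<sigma>. \<Sum>E\<in>set M. w E * (E \<sigma> - \<delta> k \<sigma>), 0)"
      unfolding ws(3) cb_def by (auto simp: fun_eq_iff wM simp flip: sum.reindex_bij_betw[OF bij])
    ultimately show "z \<in> mono_cone k M" unfolding mono_cone_def by blast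
  qed
  moreover have "dot l (vec (fst (cb ws)) (snd (cb ws))) = dot (map (dot l) ?G) ws" if "length ws = length M" for ws l
    using that dot_vec_sum[of "{..<length M}" l "\<lambda>i. ws ! i" "\<lambda>i \<sigma>. (M ! i) \<sigma> - \<delta> k \<sigma>" "\<lambda>_. 0"]
    by (simp add: cb_def dot_sum mult.commute)
  moreover have "enabled U ?M \<longleftrightarrow> msupp \<Omega> M \<subseteq> support U" if "length U = length J" for U
  proof -
    have len: "length ss \<le> length U" using that by (simp add: J_def)
    have "list_all (\<lambda>p. 0 < fst p \<longrightarrow> 0 < snd p) (zip (map E ss) U) \<longleftrightarrow>
        (\<forall>j<length ss. 0 < E (ss ! j) \<longrightarrow> ss ! j \<in> support U)" for E :: "'s cl"
      using len by (auto simp: list_all_length support_nth)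
    then have "enabled U ?M \<longleftrightarrow> (\<forall>E\<in>set M. \<forall>j<length ss. 0 < E (ss ! j) \<longrightarrow> ss ! j \<in> support U)"
      unfolding enabled_def by (simp add: list_all_iff)
    also have "\<dots> \<longleftrightarrow> (\<forall>E\<in>set M. \<forall>\<sigma>\<in>\<Omega>. 0 < E \<sigma> \<longrightarrow> \<sigma> \<in> support U)"
      unfolding ss(2)[symmetric] by (simp add: all_set_conv_all_nth)
    finally show ?thesis by (auto simp: msupp_def)
  qed
  moreover have "\<forall>b\<in>set ?B. length (snd b) = length M" by (auto simp: in_set_conv_nth units_nth)
  moreover have list_prod: "list_prod (Inl (k, M)) = ((vec (\<delta> k) 0, ?M), (?G, ?B))"
    by (simp only: list_prod_def sum.case prod.case mono_prod_def G)
  moreover have abs_prod: "abs_prod (Inl (k, M)) = (k, msupp \<Omega> M, mono_cone k M)" by (simp add: abs_prod_def)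
  moreover have "k \<in> \<Omega>" using monD(1)[OF assms] by simp
  ultimately show ?thesis
    unfolding implements_def list_prod abs_prod fst_conv snd_conv length_map by blast
qed

lemma implements_cell:
  assumes "(F, p) \<in> set (zip Fs ps)" "c \<in> set (dnf F)"
  shows "implements (list_prod (Inr (p, c))) (abs_prod (Inr (p, c)))"
proof -
  let ?G = "neg (vec (\<delta> p) 0) # V"
  let ?B = "(True, 1 # zb) # c"
  define cb where "cb ws = (\<lambda>\<sigma>. - hd ws * \<delta> p \<sigma>, point bs (tl ws))" for ws
  note crd_pt = coords_point[OF bs] and pt_crd = point_coords[OF bs]
  \<comment> \<open>Homogeneity: for positive \<open>t\<close>, the constraints hold at
    \<open>1\<close> and \<open>x\<close> exactly if they hold at \<open>t\<close> and the scaled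
    point. So the vector coordinates may range freely, subject to \<open>c\<close> and
    \<open>0 < t\<close>.\<close>
  have hom: "sat (t # crd (t *\<^sub>R x)) c \<longleftrightarrow> x \<in> cell c" if "0 < t" for t x
    using crd_linear[of _ t 1 0 0 x 0] holds_scale[OF that] by (simp add: sat_def cell_def)
  have "cell_cone p (cell c) = cb ` {ws. length ws = Suc (length bs) \<and> sat ws ?B}"
  proof (intro equalityI subsetI)
    fix z :: "('s \<Rightarrow> real) \<times> 'a" assume "z \<in> cell_cone p (cell c)"
    then obtain t x where z: "0 < t" "x \<in> cell c" "z = (\<lambda>\<sigma>. - t * \<delta> p \<sigma>, t *\<^sub>R x)" by (auto simp: cell_cone_def)
    have "sat (t # crd (t *\<^sub>R x)) ?B" using hom[OF z(1)] z by (simp add: sat_Cons zb_def holds_def)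
    then show "z \<in> cb ` {ws. length ws = Suc (length bs) \<and> sat ws ?B}"
      using z(3) by (intro image_eqI[of _ _ "t # crd (t *\<^sub>R x)"]) (auto simp: cb_def pt_crd, simp add: coords_def)
  next
    fix z assume "z \<in> cb ` {ws. length ws = Suc (length bs) \<and> sat ws ?B}"
    then obtain t y where y: "length y = length bs" "sat (t # y) ?B" "z = (\<lambda>\<sigma>. - t * \<delta> p \<sigma>, point bs y)"
      by (auto simp: cb_def length_Suc_conv)
    have t: "0 < t" using y(2) by (simp add: sat_Cons zb_def holds_def)
    let ?x = "(1 / t) *\<^sub>R point bs y"
    have "t *\<^sub>R ?x = point bs y" using t by simp
    moreover have "?x \<in> cell c" using hom[OF t, of ?x] y t crd_pt by (simp add: sat_Cons)
    ultimately show "z \<in> cell_cone p (cell c)" using t y(3) unfolding cell_cone_def by force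
  qed
  moreover have "dot l (vec (fst (cb ws)) (snd (cb ws))) = dot (map (dot l) ?G) ws" if len: "length ws = Suc (length bs)" for ws l
  proof -
    obtain t y where ty: "ws = t # y" "length y = length bs" using len by (auto simp: length_Suc_conv)
    have 1: "dot l (vec (\<lambda>_. 0) (point bs y)) = dot (map (dot l) V) y"
      using ty dot_vec_sum[of "{..<length bs}" l "\<lambda>i. y ! i" "\<lambda>_ _. 0" "\<lambda>i. bs ! i"]
      by (simp add: point_def dot_sum V_def mult.commute)
    have "dot l (vec (\<lambda>\<sigma>. - t * \<delta> p \<sigma> + 1 * 0) ((- t) *\<^sub>R 0 + 1 *\<^sub>R point bs y)) = - t * dot l (vec (\<delta> p) 0) + 1 * dot l (vec (\<lambda>_. 0) (point bs y))"
      by (rule dot_vec_linear)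
    then show ?thesis using 1 ty by (simp add: cb_def mult.commute dot_neg_right)
  qed
  moreover have "\<forall>b\<in>set ?B. length (snd b) = Suc (length bs)" using dnf_mem(2)[OF assms] by (auto simp: zb_def)
  ultimately show ?thesis
    unfolding implements_def list_prod_def abs_prod_def cell_prod_def using zip_mem[OF assms(1)] by (auto simp: V_def enabled_def)
qed

lemma implements_keys: "\<kappa> \<in> set keys \<Longrightarrow> implements (list_prod \<kappa>) (abs_prod \<kappa>)"
proof -
  assume k: "\<kappa> \<in> set keys"
  show ?thesis
  proof (cases \<kappa>)
    case (Inl a)
    then show ?thesis using k implements_mono[of "fst a" "snd a"] keys_mem(1)[of "fst a" "snd a"] by simp
  next
    case (Inr a)
    then obtain F where "(F, fst a) \<in> set (zip Fs ps)" "snd a \<in> set (dnf F)"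
      using k keys_mem(2)[of "fst a" "snd a"] by auto
    from implements_cell[OF this] show ?thesis using Inr by simp
  qed
qed


section \<open>Rounds of the solver compute the flows\<close>

definition good :: "real list \<times> constr list \<Rightarrow> bool" where
  "good s \<longleftrightarrow> length (fst s) = length J \<and> (\<forall>j<length J. 0 \<le> fst s ! j) \<and> (\<forall>a\<in>set (snd s). length (snd a) = length J)"

definition init :: "real list \<times> constr list" where
  "init = (zJ, concat (map (\<lambda>u. [(False, u), (False, neg u)]) E))"

definition rounds :: "nat \<Rightarrow> (real list \<times> constr list) list" where
  "rounds n = (extend zJ (map list_prod keys) ^^ n) [init]"

definition fire :: "list_production \<Rightarrow> real list \<times> constr list \<Rightarrow> real list \<times> constr list" where
  "fire p s = (map (\<lambda>q. fst q + snd q) (zip (fst s) (fst (fst p))), add_generators (fst (snd p)) (snd (snd p)) zJ (snd s))"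

lemma extend_mem: "s' \<in> set (extend zJ Ps T) \<longleftrightarrow>
    s' \<in> set T \<or> (\<exists>s\<in>set T. \<exists>p\<in>set Ps. enabled (fst s) (snd (fst p)) \<and> s' = fire p s)"
  by (auto simp: extend_def fire_def)

lemma good_init: "good init"
  by (auto simp: good_def init_def zJ_def E_eq V_def)

text \<open>The first component counts how often each symbol was produced. As counts are nonnegative
  they cannot cancel, so the support grows by exactly the target of the fired production.\<close>

lemma good_fire:
  assumes "good s" "implements p q"
  shows "good (fire p s)" "support (fst (fire p s)) = insert (fst q) (support (fst s))"
proof -
  have p: "fst (fst p) = vec (\<delta> (fst q)) 0" "fst q \<in> \<Omega>"
    "\<forall>b\<in>set (snd (snd p)). length (snd b) = length (fst (snd p))"
    using assms(2) by (auto simp: implements_def)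
  have s: "length (fst s) = length J" "\<forall>j<length J. 0 \<le> fst s ! j" "\<forall>a\<in>set (snd s). length (snd a) = length J"
    using assms(1) by (auto simp: good_def)
  have \<delta>0: "0 \<le> vec (\<delta> (fst q)) 0 ! j" if "j < length J" for j
    using that by (auto simp: vec_def \<delta>_def split: sum.split)
  have nth: "fst (fire p s) ! j = fst s ! j + vec (\<delta> (fst q)) 0 ! j" if "j < length J" for j
    using that s p by (simp add: fire_def)
  have ssJ: "length ss \<le> length J" by (simp add: J_def)
  show "good (fire p s)"
    unfolding good_def
  proof (intro conjI)
    show "\<forall>a\<in>set (snd (fire p s)). length (snd a) = length J"
      using length_add_generators[of "snd s" zJ "snd (snd p)" "fst (snd p)"] s p by (simp add: fire_def)
    show "length (fst (fire p s)) = length J" using s p by (simp add: fire_def)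
    show "\<forall>j<length J. 0 \<le> fst (fire p s) ! j" using s(2) \<delta>0 nth by simp
  qed
  have pos: "0 < fst (fire p s) ! j \<longleftrightarrow> ss ! j = fst q \<or> 0 < fst s ! j" if j: "j < length ss" for j
  proof -
    have jJ: "j < length J" using j ssJ by simp
    have "vec (\<delta> (fst q)) 0 ! j = \<delta> (fst q) (ss ! j)" using j by (simp add: vec_append nth_append)
    then have "fst (fire p s) ! j = fst s ! j + \<delta> (fst q) (ss ! j)" using nth[OF jJ] by simp
    moreover have "0 \<le> fst s ! j" using s(2) jJ by blast
    ultimately show ?thesis by (auto simp: \<delta>_def)
  qed
  have "\<sigma> \<in> support (fst (fire p s)) \<longleftrightarrow> \<sigma> \<in> insert (fst q) (support (fst s))" for \<sigma>
  proof (cases "\<sigma> \<in> \<Omega>")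
    case True
    then obtain j where "j < length ss" "\<sigma> = ss ! j" using ss(2) by (metis in_set_conv_nth)
    then show ?thesis using pos by (simp add: support_nth)
  next
    case False
    then show ?thesis using support_subset p(2) by blast
  qed
  then show "support (fst (fire p s)) = insert (fst q) (support (fst s))" by blast
qed

text \<open>Elimination leaves an existential over the weights \<open>ws\<close>, which
  \<open>cb\<close> turns into one over the elements of the cone \<open>C\<close>.\<close>

lemma sat_fire:
  assumes "good s" "implements p (k, Q, C)"
  shows "sat (vec b x) (snd (fire p s)) \<longleftrightarrow> (\<exists>(b', x')\<in>C. sat (vec (\<lambda>\<sigma>. b \<sigma> - b' \<sigma>) (x - x')) (snd s))"
proof -
  have B: "\<forall>b\<in>set (snd (snd p)). length (snd b) = length (fst (snd p))"
    using assms(2) by (auto simp: implements_def)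
  obtain cb where cb: "C = cb ` {ws. length ws = length (fst (snd p)) \<and> sat ws (snd (snd p))}"
    "\<And>ws l. length ws = length (fst (snd p)) \<Longrightarrow> dot l (vec (fst (cb ws)) (snd (cb ws))) = dot (map (dot l) (fst (snd p))) ws"
    using assms(2) by (auto simp: implements_def)
  have "sat (vec b x) (snd (fire p s)) \<longleftrightarrow> (\<exists>ws. length ws = length (fst (snd p)) \<and> sat ws (snd (snd p)) \<and>
    (\<forall>a\<in>set (snd s). holds (fst a) (dot (snd a) (vec b x) - dot (map (dot (snd a)) (fst (snd p))) ws)))"
    unfolding fire_def snd_conv using assms(1) B by (intro sat_add_generators) (auto simp: good_def zJ_def)
  also have "\<dots> \<longleftrightarrow> (\<exists>ws. length ws = length (fst (snd p)) \<and> sat ws (snd (snd p)) \<and>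
      sat (vec (\<lambda>\<sigma>. b \<sigma> - fst (cb ws) \<sigma>) (x - snd (cb ws))) (snd s))"
  proof -
    have "(\<forall>a\<in>set (snd s). holds (fst a) (dot (snd a) (vec b x) - dot (map (dot (snd a)) (fst (snd p))) ws)) \<longleftrightarrow>
      sat (vec (\<lambda>\<sigma>. b \<sigma> - fst (cb ws) \<sigma>) (x - snd (cb ws))) (snd s)"
      if "length ws = length (fst (snd p))" for ws
      unfolding sat_def dot_vec_diff cb(2)[OF that] ..
    then show ?thesis by (intro ex_cong1) blast
  qed
  also have "\<dots> \<longleftrightarrow> (\<exists>(b', x')\<in>C. sat (vec (\<lambda>\<sigma>. b \<sigma> - b' \<sigma>) (x - x')) (snd s))"
    unfolding cb(1) by (auto simp: case_prod_unfold)
  finally show ?thesis .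
qed

lemma sat_init: "sat (vec b x) (snd init) \<longleftrightarrow> (\<forall>\<sigma>\<in>\<Omega>. b \<sigma> = 0) \<and> x = 0"
proof -
  have "sat (vec b x) (snd init) \<longleftrightarrow> (\<forall>u\<in>set E. dot u (vec b x) = 0)"
    by (auto simp: sat_def init_def holds_def dot_neg intro: antisym)
  also have "\<dots> \<longleftrightarrow> (\<forall>j<length J. vec b x ! j = 0)"
  proof -
    have len: "length (map (\<lambda>_. 0) S @ map (\<lambda>_. 0) Fs @ zb) = length J"
      using Fs(1) by (simp add: S_def zb_def J_def ss_def)
    have "dot (E ! j) (vec b x) = vec b x ! j" if "j < length J" for j
      unfolding E_def using len that by (intro dot_unit) (simp_all only: length_J)
    then show ?thesis by (simp add: all_set_conv_all_nth length_E)
  qed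
  also have "\<dots> \<longleftrightarrow> (\<forall>r\<in>set (vec b x). r = 0)" by (simp add: all_set_conv_all_nth)
  also have "\<dots> \<longleftrightarrow> (\<forall>\<sigma>\<in>\<Omega>. b \<sigma> = 0) \<and> (\<forall>c\<in>Basis. x \<bullet> c = 0)"
    using ss(2) bs(2) by (auto simp: vec_append coords_def)
  finally show ?thesis by (simp add: euclidean_all_zero_iff)
qed

lemma good_rounds: "s \<in> set (rounds n) \<Longrightarrow> good s"
proof (induction n arbitrary: s)
  case (Suc n)
  from Suc.prems have "s \<in> set (rounds n) \<or> (\<exists>s'\<in>set (rounds n). \<exists>\<kappa>\<in>set keys. s = fire (list_prod \<kappa>) s')"
    by (auto simp: rounds_def extend_mem)
  then show ?case using Suc.IH good_fire(1)[OF _ implements_keys] by blast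
qed (simp add: rounds_def good_init)

text \<open>A state kept by \<open>extend\<close> corresponds to the rule \<open>weaken\<close>, a
  fired one to \<open>step\<close>. Supports are matched exactly, so that availability of
  productions transfers in both directions.\<close>

lemma rounds_flow:
  "(\<exists>s\<in>set (rounds n). support (fst s) = U \<and> sat (vec b x) (snd s)) \<longleftrightarrow> flow \<Omega> \<P> n U b x"
proof (induction n arbitrary: U b x)
  case 0
  have "support zJ = {}" by (auto simp: support_def zJ_def J_def nth_append)
  then show ?case by (auto simp: rounds_def flow_0_iff sat_init, simp_all add: init_def)
next
  case (Suc n)
  have mem: "s' \<in> set (rounds (Suc n)) \<longleftrightarrow> s' \<in> set (rounds n) \<or>
    (\<exists>s\<in>set (rounds n). \<exists>\<kappa>\<in>set keys. enabled (fst s) (snd (fst (list_prod \<kappa>))) \<and> s' = fire (list_prod \<kappa>) s)" for s'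
    by (simp add: rounds_def extend_mem)
  have en: "enabled (fst s) (snd (fst (list_prod \<kappa>))) \<longleftrightarrow> fst (snd (abs_prod \<kappa>)) \<subseteq> support (fst s)"
    if "s \<in> set (rounds n)" "\<kappa> \<in> set keys" for s \<kappa>
    using good_rounds[OF that(1)] implements_keys[OF that(2)] by (auto simp: good_def implements_def)
  have fire: "(support (fst (fire (list_prod \<kappa>) s)) = U \<and> sat (vec b x) (snd (fire (list_prod \<kappa>) s))) \<longleftrightarrow>
      U = insert (fst (abs_prod \<kappa>)) (support (fst s)) \<and>
      (\<exists>(b', x')\<in>snd (snd (abs_prod \<kappa>)). sat (vec (\<lambda>\<sigma>. b \<sigma> - b' \<sigma>) (x - x')) (snd s))"
    if "s \<in> set (rounds n)" "\<kappa> \<in> set keys" for s \<kappa> b x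
    using good_fire(2)[OF good_rounds[OF that(1)] implements_keys[OF that(2)]]
      sat_fire[OF good_rounds[OF that(1)], of "list_prod \<kappa>" "fst (abs_prod \<kappa>)" "fst (snd (abs_prod \<kappa>))" "snd (snd (abs_prod \<kappa>))" b x]
      implements_keys[OF that(2)] by auto
  show ?case
  proof
    assume "\<exists>s\<in>set (rounds (Suc n)). support (fst s) = U \<and> sat (vec b x) (snd s)"
    then obtain s' where s': "s' \<in> set (rounds (Suc n))" "support (fst s') = U" "sat (vec b x) (snd s')" by blast
    from s'(1)[unfolded mem] show "flow \<Omega> \<P> (Suc n) U b x"
    proof (elim disjE bexE conjE)
      assume "s' \<in> set (rounds n)"
      then have "flow \<Omega> \<P> n U b x" using Suc.IH s' by blast
      then show ?thesis by (rule flow.weaken)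
    next
      fix s \<kappa> assume s: "s \<in> set (rounds n)" and k: "\<kappa> \<in> set keys"
        and e: "enabled (fst s) (snd (fst (list_prod \<kappa>)))" and eq: "s' = fire (list_prod \<kappa>) s"
      obtain b' x' where bx: "(b', x') \<in> snd (snd (abs_prod \<kappa>))" "sat (vec (\<lambda>\<sigma>. b \<sigma> - b' \<sigma>) (x - x')) (snd s)"
        and U: "U = insert (fst (abs_prod \<kappa>)) (support (fst s))"
        using fire[OF s k, of b x] s' eq by blast
      have "flow \<Omega> \<P> n (support (fst s)) (\<lambda>\<sigma>. b \<sigma> - b' \<sigma>) (x - x')" using Suc.IH bx s by blast
      moreover have "(fst (abs_prod \<kappa>), fst (snd (abs_prod \<kappa>)), snd (snd (abs_prod \<kappa>))) \<in> \<P>" using k by (simp add: \<P>_eq)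
      moreover have "fst (snd (abs_prod \<kappa>)) \<subseteq> support (fst s)" using en[OF s k] e by simp
      ultimately show ?thesis unfolding flow_Suc_iff using bx(1) U by blast
    qed
  next
    assume "flow \<Omega> \<P> (Suc n) U b x"
    then consider "flow \<Omega> \<P> n U b x"
      | k Q C W b' x' where "(k, Q, C) \<in> \<P>" "flow \<Omega> \<P> n W (\<lambda>\<sigma>. b \<sigma> - b' \<sigma>) (x - x')" "Q \<subseteq> W" "(b', x') \<in> C" "U = insert k W"
      unfolding flow_Suc_iff by blast
    then show "\<exists>s\<in>set (rounds (Suc n)). support (fst s) = U \<and> sat (vec b x) (snd s)"
    proof cases
      case 1
      then obtain s where "s \<in> set (rounds n)" "support (fst s) = U" "sat (vec b x) (snd s)" using Suc.IH by blast
      then show ?thesis using mem by blast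
    next
      case 2
      obtain s where s: "s \<in> set (rounds n)" "support (fst s) = W" "sat (vec (\<lambda>\<sigma>. b \<sigma> - b' \<sigma>) (x - x')) (snd s)"
        using Suc.IH 2(2) by blast
      obtain \<kappa> where k: "\<kappa> \<in> set keys" "abs_prod \<kappa> = (k, Q, C)" using 2(1) unfolding \<P>_eq by (metis imageE)
      have "enabled (fst s) (snd (fst (list_prod \<kappa>)))" using en[OF s(1) k(1)] k(2) s(2) 2(3) by simp
      then have "fire (list_prod \<kappa>) s \<in> set (rounds (Suc n))" using mem s(1) k(1) by blast
      moreover have "support (fst (fire (list_prod \<kappa>) s)) = U \<and> sat (vec b x) (snd (fire (list_prod \<kappa>) s))"
        unfolding fire[OF s(1) k(1)] using k(2) s(2,3) 2(4,5) by auto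
      ultimately show ?thesis by blast
    qed
  qed
qed

section \<open>Reading off the descriptions\<close>

lemma qf_holds_read_off:
  assumes "\<forall>s\<in>set T. \<forall>a\<in>set (snd s). length (snd a) = length J"
  shows "qf_holds (read_off zb V (vec (\<delta> i) 0) T) (crd x) \<longleftrightarrow> (\<exists>s\<in>set T. sat (vec (\<lambda>\<sigma>. - \<delta> i \<sigma>) x) (snd s))"
proof -
  have dotV: "dot (map (\<lambda>u. - dot a u) V) (crd x) = - dot a (vec (\<lambda>_. 0) x)" for a
  proof -
    have "x = (\<Sum>j<length bs. (x \<bullet> bs ! j) *\<^sub>R bs ! j)"
      using point_coords[OF bs, of x] by (simp add: point_def coords_def)
    then have "dot a (vec (\<lambda>_. 0) x) = (\<Sum>j<length bs. (x \<bullet> bs ! j) * dot a (vec (\<lambda>_. 0) (bs ! j)))"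
      using dot_vec_sum[of "{..<length bs}" a "\<lambda>j. x \<bullet> bs ! j" "\<lambda>_ _. 0" "\<lambda>j. bs ! j"] by simp
    then show ?thesis
      by (simp add: dot_map_uminus dot_sum V_def coords_def mult.commute sum_negf)
  qed
  have val: "dot a (vec (\<lambda>\<sigma>. - \<delta> i \<sigma>) x) = dot a (vec (\<lambda>_. 0) x) - dot a (vec (\<delta> i) 0)" for a
    using dot_vec_diff[of a "\<lambda>_. 0" "\<delta> i" x 0] by simp
  have "qf_holds (foldr (\<lambda>a G. AndF
     (if fst a then LessAt (map (\<lambda>u. - dot (snd a) u) V) (- dot (snd a) (vec (\<delta> i) 0))
      else LeAt (map (\<lambda>u. - dot (snd a) u) V) (- dot (snd a) (vec (\<delta> i) 0))) G) A (LeAt zb 0)) (crd x) \<longleftrightarrow>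
     sat (vec (\<lambda>\<sigma>. - \<delta> i \<sigma>) x) A" for A
    by (induction A) (auto simp: sat_Cons holds_def dotV val zb_def, simp_all add: sat_def)
  then show ?thesis unfolding read_off_def
    by (induction T) (auto simp: zb_def)
qed

lemma set_qf_read_off: "a \<in> set_qf (read_off zb V i T) \<Longrightarrow> length a = length bs"
proof -
  have "\<forall>a\<in>set_qf (foldr (\<lambda>a G. AndF
     (if fst a then LessAt (map (\<lambda>u. - dot (snd a) u) V) (- dot (snd a) i)
      else LeAt (map (\<lambda>u. - dot (snd a) u) V) (- dot (snd a) i)) G) A (LeAt zb 0)). length a = length bs" for A
    by (induction A) (auto simp: zb_def V_def)
  then have "\<forall>a\<in>set_qf (read_off zb V i T). length a = length bs"
    unfolding read_off_def by (induction T) (auto simp: zb_def)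
  then show "a \<in> set_qf (read_off zb V i T) \<Longrightarrow> length a = length bs" by blast
qed

lemma solve_eq: "solve zb S Fs = map (\<lambda>(k, \<phi>). read_off zb V (vec (\<delta> k) 0) (rounds (length keys))) I"
proof -
  have "map (\<lambda>_. 0) E = zJ" using length_E by (simp add: zJ_def map_replicate_const)
  then show ?thesis
    unfolding solve_def Let_def E_def[symmetric] prods_eq fold_const zip_S drop_E(2)
    by (simp add: rounds_def init_def case_prod_unfold)
qed

theorem solve_correct:
  assumes "j < length I"
  shows "qf_holds (solve zb S Fs ! j) (crd x) \<longleftrightarrow> x \<in> X (fst (I ! j))"
    and "a \<in> set_qf (solve zb S Fs ! j) \<Longrightarrow> length a = length bs"
proof -
  have mem: "fst (I ! j) \<in> \<Omega>v" using sys assms by (auto simp: ineq_system_def)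
  have card: "finite \<P>" "card \<P> \<le> length keys"
    unfolding \<P>_eq using card_image_le[of "set keys" abs_prod] card_length[of keys] by auto
  have "qf_holds (solve zb S Fs ! j) (crd x) \<longleftrightarrow> (\<exists>s\<in>set (rounds (length keys)). sat (vec (\<lambda>\<sigma>. - \<delta> (fst (I ! j)) \<sigma>) x) (snd s))"
    using assms good_rounds by (simp add: solve_eq case_prod_unfold good_def qf_holds_read_off)
  also have "\<dots> \<longleftrightarrow> (\<exists>U. flow \<Omega> \<P> (length keys) U (\<lambda>\<sigma>. - \<delta> (fst (I ! j)) \<sigma>) x)"
    using rounds_flow by blast
  also have "\<dots> \<longleftrightarrow> x \<in> X (fst (I ! j))" using X_iff_flow[OF card mem] by simp
  finally show "qf_holds (solve zb S Fs ! j) (crd x) \<longleftrightarrow> x \<in> X (fst (I ! j))" .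
  show "a \<in> set_qf (solve zb S Fs ! j) \<Longrightarrow> length a = length bs"
    using assms set_qf_read_off by (simp add: solve_eq case_prod_unfold)
qed

end

section \<open>The theorem\<close>

text \<open>The convex hull \<open>H\<close> of all parameters, taken as value of every variable, is
  a solution: monomials evaluate to convex combinations of points of \<open>H\<close>. The smallest
  solution lies below it.\<close>

lemma smallest_solution_bounded:
  fixes P :: "'s \<Rightarrow> 'a::euclidean_space set"
  assumes "alphabet \<Omega>v \<Omega>p" "ineq_system \<Omega>v \<Omega>p I" "smallest_solution \<Omega>v \<Omega>p I P X"
    "\<And>p. p \<in> \<Omega>p \<Longrightarrow> bounded (P p)" "x \<in> \<Omega>v"
  shows "bounded (X x)"
proof -
  define H where "H = convex hull (\<Union>p\<in>\<Omega>p. P p)"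
  let ?\<Omega> = "\<Omega>v \<union> \<Omega>p"
  have fin: "finite \<Omega>p" "finite ?\<Omega>" using assms(1) by (auto simp: alphabet_def)
  have H: "convex H" "bounded H" using fin assms(4) by (auto simp: H_def intro: bounded_convex_hull)
  have vH: "val \<Omega>v (\<lambda>_. H) P \<sigma> \<subseteq> H" if "\<sigma> \<in> ?\<Omega>" for \<sigma>
    using that hull_subset[of "\<Union>p\<in>\<Omega>p. P p" convex] by (auto simp: val_def H_def)
  have "eval_mono \<Omega>v \<Omega>p (\<lambda>_. H) P M \<subseteq> H" if M: "M \<in> monomials \<Omega>v \<Omega>p" for M
  proof
    fix z assume "z \<in> eval_mono \<Omega>v \<Omega>p (\<lambda>_. H) P M"
    then obtain \<mu> y where my: "\<forall>E\<in>set M. 0 < \<mu> E \<and> (\<forall>\<sigma>\<in>?\<Omega>. 0 < E \<sigma> \<longrightarrow> y E \<sigma> \<in> val \<Omega>v (\<lambda>_. H) P \<sigma>)"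
      "sum \<mu> (set M) = 1" "z = (\<Sum>E\<in>set M. \<mu> E *\<^sub>R (\<Sum>\<sigma>\<in>?\<Omega>. E \<sigma> *\<^sub>R y E \<sigma>))"
      using eval_mono_iff[OF assms(1) M, THEN iffD1] by blast
    have mem: "(\<Sum>\<sigma>\<in>?\<Omega>. E \<sigma> *\<^sub>R y E \<sigma>) \<in> H" if E: "E \<in> set M" for E
    proof -
      have cl: "\<And>\<sigma>. 0 \<le> E \<sigma>" "(\<Sum>\<sigma>\<in>?\<Omega>. E \<sigma>) = 1" using M E by (auto simp: monomials_def CL_def)
      have yH: "y E \<sigma> \<in> H" if "\<sigma> \<in> ?\<Omega>" "0 < E \<sigma>" for \<sigma> using my(1) E that vH by blast
      \<comment> \<open>Points chosen at symbols of coefficient zero may lie outside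
        \<open>H\<close>; the point at a symbol \<tau> of positive coefficient stands in for
        them.\<close>
      have "\<exists>\<tau>\<in>?\<Omega>. 0 < E \<tau>"
      proof (rule ccontr)
        assume "\<not> (\<exists>\<tau>\<in>?\<Omega>. 0 < E \<tau>)"
        then have "(\<Sum>\<sigma>\<in>?\<Omega>. E \<sigma>) \<le> 0" by (intro sum_nonpos) force
        then show False using cl(2) by simp
      qed
      then obtain \<tau> where \<tau>: "\<tau> \<in> ?\<Omega>" "0 < E \<tau>" by blast
      have "(\<Sum>\<sigma>\<in>?\<Omega>. E \<sigma> *\<^sub>R (if 0 < E \<sigma> then y E \<sigma> else y E \<tau>)) \<in> H"
        using fin H cl yH \<tau> by (intro convex_sum) auto
      also have "(\<Sum>\<sigma>\<in>?\<Omega>. E \<sigma> *\<^sub>R (if 0 < E \<sigma> then y E \<sigma> else y E \<tau>)) = (\<Sum>\<sigma>\<in>?\<Omega>. E \<sigma> *\<^sub>R y E \<sigma>)"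
        using cl(1) by (intro sum.cong) (auto simp: order.order_iff_strict)
      finally show ?thesis .
    qed
    show "z \<in> H" unfolding my(3)
      by (rule convex_sum[OF _ H(1) my(2)]) (use my(1) mem in \<open>auto intro: less_imp_le\<close>)
  qed
  then have "solution \<Omega>v \<Omega>p I P (\<lambda>_. H)"
    using assms(2) H(1) unfolding solution_def eval_poly_def ineq_system_def polynomials_def by fast
  then have "X x \<subseteq> H" using assms(3,5) unfolding smallest_solution_def by blast
  then show ?thesis using H(2) bounded_subset by blast
qed

lemma described_qf_holds:
  assumes "distinct bs" "set bs = Basis"
  shows "described F = {x. qf_holds (map_qf (coords bs) F) (coords bs x)}"
  by (induction F) (auto simp: dot_coords[OF assms])

lemma enc_qf_coords: "enc_qf bs F = enc_lqf (map_qf (coords bs) F)"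
  by (induction F) (auto simp: enc_vec_def coords_def o_def)

text \<open>The output of the solver consists of formulas on lists. Since vectors of the right
  length survive decoding and encoding, this output is the encoding of the decoded formulas.\<close>

lemma map_qf_coords_point:
  assumes "distinct bs" "set bs = Basis" "\<And>a. a \<in> set_qf G \<Longrightarrow> length a = length bs"
  shows "map_qf (coords bs) (map_qf (point bs) G) = G"
  unfolding qf.map_comp using coords_point[OF assms(1,2)] assms(3)
  by (intro qf.map_ident_strong) auto

lemma enc_system_eq: "enc_system ps I =
    lst (lst enc_vecs) (map (\<lambda>(x, \<phi>). map (map (\<lambda>E. map E (map fst I @ ps))) \<phi>) I)"
  unfolding enc_system_def enc_polynom_def[abs_def] enc_mono_def[abs_def] enc_cl_def[abs_def]
  by (simp add: o_def case_prod_unfold)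

lemma solve_descriptions:
  fixes bs :: "'a::euclidean_space list"
  assumes bs: "distinct bs" "set bs = Basis"
    and "alphabet \<Omega>v \<Omega>p" "ineq_system \<Omega>v \<Omega>p I" "smallest_solution \<Omega>v \<Omega>p I P X"
    and "distinct ps" "set ps = \<Omega>p"
    and Fs: "length Fs = length ps" "\<forall>j<length ps. described (Fs ! j) = P (ps ! j)"
  defines "R \<equiv> solve (replicate (length bs) 0) (map (\<lambda>(x, \<phi>). map (map (\<lambda>E. map E (map fst I @ ps))) \<phi>) I) (map (map_qf (coords bs)) Fs)"
  shows "length R = length I" "enc_qfs bs (map (map_qf (point bs)) R) = lst enc_lqf R"
    "\<forall>i<length I. described (map_qf (point bs) (R ! i)) = X (fst (I ! i))"
proof -
  interpret lin_system bs \<Omega>v \<Omega>p I P X ps "map (map_qf (coords bs)) Fs"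
    using assms described_qf_holds[OF bs] by unfold_locales (auto simp: qf.set_map coords_def)
  have R: "R = solve zb S (map (map_qf (coords bs)) Fs)"
    unfolding R_def S_def ss_def zb_def by (simp add: map_replicate_const)
  show len: "length R = length I" unfolding R solve_eq by simp
  have roundtrip: "map_qf (coords bs) (map_qf (point bs) (R ! i)) = R ! i" if "i < length I" for i
    using solve_correct(2)[OF that] unfolding R by (intro map_qf_coords_point bs)
  show "enc_qfs bs (map (map_qf (point bs)) R) = lst enc_lqf R"
    unfolding enc_qfs_def enc_qf_coords using roundtrip len
    by (auto intro!: arg_cong[where f = enc_list] simp: in_set_conv_nth)
  show "\<forall>i<length I. described (map_qf (point bs) (R ! i)) = X (fst (I ! i))"
    using solve_correct(1) roundtrip unfolding described_qf_holds[OF bs] by (auto simp: R)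
qed

theorem corollary1:
  fixes bs :: "'a::euclidean_space list"
  assumes "distinct bs" and "set bs = Basis"
  shows
    "(\<forall>(\<Omega>v :: 's set) \<Omega>p I (P :: 's \<Rightarrow> 'a set) X.
        alphabet \<Omega>v \<Omega>p \<and> ineq_system \<Omega>v \<Omega>p I \<and>
        (\<forall>p\<in>\<Omega>p. finite_union_of_hemihedra (P p)) \<and>
        smallest_solution \<Omega>v \<Omega>p I P X \<longrightarrow>
        (\<forall>x\<in>\<Omega>v. hemihedron (X x)))
     \<and>
     (\<exists>algo :: prog. \<forall>(\<Omega>v :: 's set) \<Omega>p I (P :: 's \<Rightarrow> 'a set) X ps Fs.
        alphabet \<Omega>v \<Omega>p \<and> ineq_system \<Omega>v \<Omega>p I \<and>
        (\<forall>p\<in>\<Omega>p. finite_union_of_hemihedra (P p)) \<and>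
        smallest_solution \<Omega>v \<Omega>p I P X \<and>
        distinct ps \<and> set ps = \<Omega>p \<and>
        length Fs = length ps \<and> (\<forall>j<length ps. described (Fs ! j) = P (ps ! j)) \<longrightarrow>
        (\<exists>Gs. length Gs = length I \<and>
           run algo (Pair (enc_system ps I) (enc_qfs bs Fs)) (enc_qfs bs Gs) \<and>
           (\<forall>i<length I. described (Gs ! i) = X (fst (I ! i)))))"
proof (intro conjI allI impI ballI, goal_cases)
  case (1 \<Omega>v \<Omega>p I P X x)
  then obtain ps where ps: "distinct ps" "set ps = \<Omega>p"
    using finite_distinct_list[of \<Omega>p] by (auto simp: alphabet_def)
  \<comment> \<open>No formulas for the parameters are given here, so some are chosen; the
    descriptions computed from them show that \<open>X x\<close> is semi-linear.\<close>
  have "\<forall>p\<in>\<Omega>p. \<exists>F. described F = P p" using 1 semilinear_hemihedra unfolding semilinear_def by blast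
  then obtain F where F: "\<And>p. p \<in> \<Omega>p \<Longrightarrow> described (F p) = P p" by metis
  obtain i where i: "i < length I" "x = fst (I ! i)"
    using 1 by (force simp: ineq_system_def in_set_conv_nth)
  have d: "length (map F ps) = length ps" "\<forall>j<length ps. described (map F ps ! j) = P (ps ! j)"
    using F ps nth_mem by auto
  have a: "alphabet \<Omega>v \<Omega>p" "ineq_system \<Omega>v \<Omega>p I" "smallest_solution \<Omega>v \<Omega>p I P X" using 1 by auto
  have "semilinear (X x)"
    using solve_descriptions(3)[OF assms a ps d] i unfolding semilinear_def by blast
  moreover have "convex (X x)" using 1 by (simp add: smallest_solution_def solution_def)
  moreover have "bounded (X x)" using 1 bounded_hemihedra by (intro smallest_solution_bounded) auto
  ultimately show ?case by (intro hemihedron_of_semilinear)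
next
  case 2
  \<comment> \<open>The program is fixed before alphabet, system and parameters are introduced,
    hence uniform in them.\<close>
  obtain algo where algo: "\<And>z. run algo (enc_pair (lst (lst enc_vecs)) (lst enc_lqf) z)
      (lst enc_lqf (solve (replicate (length bs) 0) (fst z) (snd z)))"
    using comp_solve by (rule compE) blast
  show ?case
  proof (intro exI[of _ algo] allI impI, goal_cases)
    case (1 \<Omega>v \<Omega>p I P X ps Fs)
    let ?S = "map (\<lambda>(x, \<phi>). map (map (\<lambda>E. map E (map fst I @ ps))) \<phi>) I"
    let ?R = "solve (replicate (length bs) 0) ?S (map (map_qf (coords bs)) Fs)"
    note R = solve_descriptions[OF assms, of \<Omega>v \<Omega>p I P X ps Fs]
    have "run algo (Pair (enc_system ps I) (enc_qfs bs Fs)) (lst enc_lqf ?R)"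
      using algo[of "(?S, map (map_qf (coords bs)) Fs)"]
      by (simp add: enc_pair_def enc_system_eq enc_qfs_def enc_qf_coords[abs_def] o_def)
    then show ?case
      using R 1 by (intro exI[of _ "map (map_qf (point bs)) ?R"]) simp
  qed
qed

end
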